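(* Let $\mathcal{V}$ be a closed symmetric monoidal category and let $\mathcal{S}$ be a category. If $\mathcal{S}$ is a closed $\mathcal{V}$-module, then there exists a unique closed $\mathcal{V}$-bimodule structure on $\mathcal{S}$ extending the closed $\mathcal{V}$-module structure of $\mathcal{S}$. In particular, there is a bijection from the set of $\mathcal{V}$-structures with cylinder and path on $\mathcal{S}$ to the set of closed $\mathcal{V}$-module structures on $\mathcal{S}$.
   Context: Composition of morphisms is written $g\cdot f$. A monoidal category $\mathcal{V}=(\mathcal{V},\otimes,I,a,l,r)$ has structure isomorphisms $a_{X,Y,Z}:(X\otimes Y)\otimes Z\to X\otimes(Y\otimes Z)$, $l_X:I\otimes X\to X$, $r_X:X\otimes I\to X$; when symmetric, its symmetry is $c_{X,Y}:X\otimes Y\to Y\otimes X$. It is closed if each $-\otimes Y$ has a right adjoint $\underline{\mathcal{V}}(Y,-)$, with counit $\epsilon_Z:\underline{\mathcal{V}}(Y,Z)\otimes Y\to Z$. A (left) $\mathcal{V}$-module structure on $\mathcal{S}$: a functor $-\otimes-:\mathcal{V}\times\mathcal{S}\to\mathcal{S}$ and isomorphisms $a_{K,L,X}:(K\otimes L)\otimes X\to K\otimes(L\otimes X)$ natural in $K,L,X$, and $l_X:I\otimes X\to X$ natural in $X$, satisfying $a_{K,L,M\otimes X}\cdot a_{K\otimes L,M,X}=(1\otimes a_{L,M,X})\cdot a_{K,L\otimes M,X}\cdot(a_{K,L,M}\otimes1)$ and $(1\otimes l_X)\cdot a_{K,I,X}=r_K\otimes1$. A tensor-closed $\mathcal{V}$-module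 structure is this together with a functor $\underline{\mathcal{S}}(-,-):\mathcal{S}^{\mathrm{op}}\times\mathcal{S}\to\mathcal{V}$ and bijections $\phi_{K,X,Y}:\mathcal{S}(K\otimes X,Y)\to\mathcal{V}(K,\underline{\mathcal{S}}(X,Y))$ natural in $K,X,Y$, with counit $\epsilon_Y:\underline{\mathcal{S}}(X,Y)\otimes X\to Y$ of $\phi_{-,X,-}$. A closed $\mathcal{V}$-module structure on $\mathcal{S}$ is a tensor-closed $\mathcal{V}$-module structure together with a functor $-\pitchfork-:\mathcal{V}\times\mathcal{S}^{\mathrm{op}}\to\mathcal{S}^{\mathrm{op}}$ and bijections $\psi_{K,X,Y}:\mathcal{S}(Y,K\pitchfork X)\to\mathcal{V}(K,\underline{\mathcal{S}}(Y,X))$ natural in $K,X,Y$. A $\mathcal{V}$-structure on $\mathcal{S}$ consists of: a functor $\underline{\mathcal{S}}(-,-):\mathcal{S}^{\mathrm{op}}\times\mathcal{S}\to\mathcal{V}$; morphisms $\underline{\bullet}_{X,Y,Z}:\underline{\mathcal{S}}(Y,Z)\otimes\underline{\mathcal{S}}(X,Y)\to\underline{\mathcal{S}}(X,Z)$ of $\mathcal{V}$; and a natural isomorphism $\varphi:\mathcal{S}(-,-)\to\mathcal{V}(I,\underline{\mathcal{S}}(-,-))$; such that (i) $\underline{\bullet}\cdot(\underline{\bullet}\otimes1)=\underline{\bullet}\cdot(1\otimes\underline{\bullet})\cdot a$; (ii) for $f\in\mathcal{S}(X,Y)$, $\underline{\mathcal{S}}(f,Z)=\underline{\bullet}\cdot(1\otimes\varphi(f))\cdot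 r^{-1}$; (iii) for $g\in\mathcal{S}(Y,Z)$, $\underline{\mathcal{S}}(X,g)=\underline{\bullet}\cdot(\varphi(g)\otimes1)\cdot l^{-1}$. A tensor-closed $\mathcal{V}$-module has a canonical $\mathcal{V}$-structure: its functor $\underline{\mathcal{S}}(-,-)$, $\underline{\bullet}_{X,Y,Z}=\phi_{\underline{\mathcal{S}}(Y,Z)\otimes\underline{\mathcal{S}}(X,Y),X,Z}(\epsilon_Z\cdot(1\otimes\epsilon_Y)\cdot a)$, and $\varphi_{X,Y}(f)=\phi_{I,X,Y}(f\cdot l_X)$. For $\mathcal{V}$ symmetric, the opposite $\mathcal{V}$-structure on $\mathcal{S}^{\mathrm{op}}$ is given by $\underline{\mathcal{S}}^{\mathrm{op}}(X,Y)=\underline{\mathcal{S}}(Y,X)$ (as a functor $\mathcal{S}\times\mathcal{S}^{\mathrm{op}}\to\mathcal{V}$, by swapping variables), $\underline{\bullet}^{\mathrm{op}}_{X,Y,Z}=\underline{\bullet}_{Z,Y,X}\cdot c$, and $\varphi^{\mathrm{op}}_{X,Y}=\varphi_{Y,X}$. A closed $\mathcal{V}$-bimodule structure on $\mathcal{S}$ consists of tensor-closed $\mathcal{V}$-module structures on $\mathcal{S}$ and on $\mathcal{S}^{\mathrm{op}}$ such that the canonical $\mathcal{V}$-structure of $\mathcal{S}^{\mathrm{op}}$ is the opposite of the canonical $\mathcal{V}$-structure of $\mathcal{S}$. Explicitly, the structure on $\mathcal{S}^{\mathrm{op}}$ consists of a functor $-\pitchfork-:\mathcal{V}\times\mathcal{S}^{\mathrm{op}}\to\mathcal{S}^{\mathrm{op}}$,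 natural isomorphisms $a^{\mathrm{op}}_{K,L,X}:K\pitchfork(L\pitchfork X)\to(K\otimes L)\pitchfork X$ and $l^{\mathrm{op}}_X:X\to I\pitchfork X$ of $\mathcal{S}$ satisfying the pentagon and triangle in $\mathcal{S}^{\mathrm{op}}$, the functor $\underline{\mathcal{S}}^{\mathrm{op}}(-,-)$, and natural bijections $\psi_{K,X,Y}:\mathcal{S}(Y,K\pitchfork X)\to\mathcal{V}(K,\underline{\mathcal{S}}(Y,X))$. It extends a closed $\mathcal{V}$-module structure on $\mathcal{S}$ if its tensor-closed $\mathcal{V}$-module structure on $\mathcal{S}$, its $\pitchfork$ and its $\psi$ are the given ones (so that only $a^{\mathrm{op}}$ and $l^{\mathrm{op}}$ are additional data). A cylinder on a category $\mathcal{S}$ with $\mathcal{V}$-structure consists of, for all $K\in\operatorname{ob}\mathcal{V}$, $X\in\operatorname{ob}\mathcal{S}$, an object $K\otimes X$ of $\mathcal{S}$, a morphism $\alpha_{K,X}:K\to\underline{\mathcal{S}}(X,K\otimes X)$ of $\mathcal{V}$, and for all $Y$ an isomorphism $\underline\phi_{K,X,Y}:\underline{\mathcal{S}}(K\otimes X,Y)\to\underline{\mathcal{V}}(K,\underline{\mathcal{S}}(X,Y))$ of $\mathcal{V}$ such that $\epsilon_{\underline{\mathcal{S}}(X,Y)}\cdot(\underline\phi_{K,X,Y}\otimes1)=\underline{\bullet}\cdot(1\otimes\alpha_{K,X})$. A path on $\mathcal{S}$ is a cylinder on $\mathcal{S}^{\mathrm{op}}$ with the opposite $\mathcal{V}$-structure: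 objects $K\pitchfork X$, morphisms $\beta_{K,X}:K\to\underline{\mathcal{S}}(K\pitchfork X,X)$, and isomorphisms $\underline\psi_{K,X,Y}:\underline{\mathcal{S}}(Y,K\pitchfork X)\to\underline{\mathcal{V}}(K,\underline{\mathcal{S}}(Y,X))$ with $\epsilon_{\underline{\mathcal{S}}(Y,X)}\cdot(\underline\psi_{K,X,Y}\otimes1)=\underline{\bullet}\cdot c\cdot(1\otimes\beta_{K,X})$. A $\mathcal{V}$-structure with cylinder and path is a $\mathcal{V}$-structure together with such data. *)

theory Defs
  imports "HOL-Library.FuncSet"
begin

text \<open>
  Categories have explicit carriers for objects and arrows. Every map that is part of a functor
  or of a structure on \<open>\<S>\<close> is extensional (equal to \<^const>\<open>undefined\<close> off its domain, as in
  \<^const>\<open>PiE\<close>), so that equality of structures in HOL is equality of the set-theoretic data, and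
  uniqueness and sets of structures have their usual meaning.
\<close>

section \<open>Categories and functors\<close>

record ('o, 'a) category =
  Obj :: "'o set"
  Arr :: "'a set"
  Dom :: "'a \<Rightarrow> 'o"
  Cod :: "'a \<Rightarrow> 'o"
  Id :: "'o \<Rightarrow> 'a"
  Comp :: "'a \<Rightarrow> 'a \<Rightarrow> 'a" (infixl "\<cdot>\<index>" 70)

definition hom :: "('o, 'a, 'z) category_scheme \<Rightarrow> 'o \<Rightarrow> 'o \<Rightarrow> 'a set" where
  "hom C X Y = {f \<in> Arr C. Dom C f = X \<and> Cod C f = Y}"

locale category =
  fixes C :: "('o, 'a, 'z) category_scheme" (structure)
  assumes Dom_Obj: "f \<in> Arr C \<Longrightarrow> Dom C f \<in> Obj C"
    and Cod_Obj: "f \<in> Arr C \<Longrightarrow> Cod C f \<in> Obj C"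
    and Id_hom: "X \<in> Obj C \<Longrightarrow> Id C X \<in> hom C X X"
    and Comp_hom: "\<lbrakk>f \<in> hom C X Y; g \<in> hom C Y Z\<rbrakk> \<Longrightarrow> g \<cdot> f \<in> hom C X Z"
    and Comp_Id: "f \<in> hom C X Y \<Longrightarrow> f \<cdot> Id C X = f"
    and Id_Comp: "f \<in> hom C X Y \<Longrightarrow> Id C Y \<cdot> f = f"
    and Comp_assoc: "\<lbrakk>f \<in> hom C W X; g \<in> hom C X Y; h \<in> hom C Y Z\<rbrakk>
      \<Longrightarrow> (h \<cdot> g) \<cdot> f = h \<cdot> (g \<cdot> f)"

definition inverse_arrows :: "('o, 'a, 'z) category_scheme \<Rightarrow> 'a \<Rightarrow> 'a \<Rightarrow> bool" where
  "inverse_arrows C f g \<longleftrightarrow> f \<in> Arr C \<and> g \<in> hom C (Cod C f) (Dom C f) \<and>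
    g \<cdot>\<^bsub>C\<^esub> f = Id C (Dom C f) \<and> f \<cdot>\<^bsub>C\<^esub> g = Id C (Cod C f)"

definition iso_hom :: "('o, 'a, 'z) category_scheme \<Rightarrow> 'o \<Rightarrow> 'o \<Rightarrow> 'a set" where
  "iso_hom C X Y = {f \<in> hom C X Y. \<exists>g. inverse_arrows C f g}"

definition inv_arr :: "('o, 'a, 'z) category_scheme \<Rightarrow> 'a \<Rightarrow> 'a" where
  "inv_arr C f = (THE g. inverse_arrows C f g)"

definition op_cat :: "('o, 'a, 'z) category_scheme \<Rightarrow> ('o, 'a) category" where
  "op_cat C = \<lparr>Obj = Obj C, Arr = Arr C, Dom = Cod C, Cod = Dom C, Id = Id C,
    Comp = (\<lambda>g f. f \<cdot>\<^bsub>C\<^esub> g)\<rparr>"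

definition prod_cat ::
    "('o, 'a, 'y) category_scheme \<Rightarrow> ('p, 'b, 'z) category_scheme \<Rightarrow> ('o \<times> 'p, 'a \<times> 'b) category"
  where
  "prod_cat C D = \<lparr>Obj = Obj C \<times> Obj D, Arr = Arr C \<times> Arr D,
    Dom = map_prod (Dom C) (Dom D), Cod = map_prod (Cod C) (Cod D), Id = map_prod (Id C) (Id D),
    Comp = (\<lambda>(g, k) (f, h). (g \<cdot>\<^bsub>C\<^esub> f, k \<cdot>\<^bsub>D\<^esub> h))\<rparr>"

record ('o, 'a, 'p, 'b) cat_map =
  Fob :: "'o \<Rightarrow> 'p"
  Far :: "'a \<Rightarrow> 'b"

definition is_functor ::
    "('o, 'a, 'y) category_scheme \<Rightarrow> ('p, 'b, 'z) category_scheme \<Rightarrow> ('o, 'a, 'p, 'b) cat_map \<Rightarrow> bool"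
  where
  "is_functor C D F \<longleftrightarrow>
    Fob F \<in> Obj C \<rightarrow>\<^sub>E Obj D \<and>
    Far F \<in> (\<Pi>\<^sub>E f\<in>Arr C. hom D (Fob F (Dom C f)) (Fob F (Cod C f))) \<and>
    (\<forall>X\<in>Obj C. Far F (Id C X) = Id D (Fob F X)) \<and>
    (\<forall>X Y Z. \<forall>f\<in>hom C X Y. \<forall>g\<in>hom C Y Z. Far F (g \<cdot>\<^bsub>C\<^esub> f) = Far F g \<cdot>\<^bsub>D\<^esub> Far F f)"


section \<open>Closed symmetric monoidal categories\<close>

text \<open>\<open>ihom V Y\<close> is the right adjoint of \<open>- \<otimes> Y\<close>, with adjunction bijections \<open>transp V (X, Y, Z)\<close>
  from \<open>hom V (X \<otimes> Y) Z\<close> to \<open>hom V X (ihom V Y Z)\<close>.\<close>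

record ('o, 'a) csm_category = "('o, 'a) category" +
  tensor :: "('o \<times> 'o, 'a \<times> 'a, 'o, 'a) cat_map"
  unit_ob :: "'o"
  assoc :: "'o \<times> 'o \<times> 'o \<Rightarrow> 'a"
  lunit :: "'o \<Rightarrow> 'a"
  runit :: "'o \<Rightarrow> 'a"
  braid :: "'o \<times> 'o \<Rightarrow> 'a"
  ihom :: "'o \<Rightarrow> ('o, 'a, 'o, 'a) cat_map"
  transp :: "'o \<times> 'o \<times> 'o \<Rightarrow> 'a \<Rightarrow> 'a"

abbreviation tensor_ob (infixr "\<otimes>\<index>" 75) where
  "X \<otimes>\<^bsub>V\<^esub> Y \<equiv> Fob (tensor V) (X, Y)"

abbreviation tensor_ar (infixr "\<^bold>\<otimes>\<index>" 75) where
  "f \<^bold>\<otimes>\<^bsub>V\<^esub> g \<equiv> Far (tensor V) (f, g)"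

locale monoidal_category = category V for V :: "('o, 'a, 'z) csm_category_scheme" (structure) +
  assumes tensor_functor: "is_functor (prod_cat V V) V (tensor V)"
    and unit_ob: "unit_ob V \<in> Obj V"
    and assoc_iso: "\<lbrakk>X \<in> Obj V; Y \<in> Obj V; Z \<in> Obj V\<rbrakk>
      \<Longrightarrow> assoc V (X, Y, Z) \<in> iso_hom V ((X \<otimes> Y) \<otimes> Z) (X \<otimes> (Y \<otimes> Z))"
    and assoc_natural: "\<lbrakk>f \<in> hom V X X'; g \<in> hom V Y Y'; h \<in> hom V Z Z'\<rbrakk>
      \<Longrightarrow> assoc V (X', Y', Z') \<cdot> ((f \<^bold>\<otimes> g) \<^bold>\<otimes> h) = (f \<^bold>\<otimes> (g \<^bold>\<otimes> h)) \<cdot> assoc V (X, Y, Z)"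
    and lunit_iso: "X \<in> Obj V \<Longrightarrow> lunit V X \<in> iso_hom V (unit_ob V \<otimes> X) X"
    and lunit_natural: "f \<in> hom V X Y
      \<Longrightarrow> lunit V Y \<cdot> (Id V (unit_ob V) \<^bold>\<otimes> f) = f \<cdot> lunit V X"
    and runit_iso: "X \<in> Obj V \<Longrightarrow> runit V X \<in> iso_hom V (X \<otimes> unit_ob V) X"
    and runit_natural: "f \<in> hom V X Y
      \<Longrightarrow> runit V Y \<cdot> (f \<^bold>\<otimes> Id V (unit_ob V)) = f \<cdot> runit V X"
    and pentagon: "\<lbrakk>W \<in> Obj V; X \<in> Obj V; Y \<in> Obj V; Z \<in> Obj V\<rbrakk>
      \<Longrightarrow> assoc V (W, X, Y \<otimes> Z) \<cdot> assoc V (W \<otimes> X, Y, Z) =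
        (Id V W \<^bold>\<otimes> assoc V (X, Y, Z)) \<cdot> assoc V (W, X \<otimes> Y, Z) \<cdot> (assoc V (W, X, Y) \<^bold>\<otimes> Id V Z)"
    and triangle: "\<lbrakk>X \<in> Obj V; Y \<in> Obj V\<rbrakk>
      \<Longrightarrow> (Id V X \<^bold>\<otimes> lunit V Y) \<cdot> assoc V (X, unit_ob V, Y) = runit V X \<^bold>\<otimes> Id V Y"

locale symmetric_monoidal_category = monoidal_category V
  for V :: "('o, 'a, 'z) csm_category_scheme" (structure) +
  assumes braid_hom: "\<lbrakk>X \<in> Obj V; Y \<in> Obj V\<rbrakk> \<Longrightarrow> braid V (X, Y) \<in> hom V (X \<otimes> Y) (Y \<otimes> X)"
    and braid_natural: "\<lbrakk>f \<in> hom V X X'; g \<in> hom V Y Y'\<rbrakk>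
      \<Longrightarrow> braid V (X', Y') \<cdot> (f \<^bold>\<otimes> g) = (g \<^bold>\<otimes> f) \<cdot> braid V (X, Y)"
    and braid_braid: "\<lbrakk>X \<in> Obj V; Y \<in> Obj V\<rbrakk>
      \<Longrightarrow> braid V (Y, X) \<cdot> braid V (X, Y) = Id V (X \<otimes> Y)"
    and hexagon: "\<lbrakk>X \<in> Obj V; Y \<in> Obj V; Z \<in> Obj V\<rbrakk>
      \<Longrightarrow> assoc V (Y, Z, X) \<cdot> braid V (X, Y \<otimes> Z) \<cdot> assoc V (X, Y, Z) =
        (Id V Y \<^bold>\<otimes> braid V (X, Z)) \<cdot> assoc V (Y, X, Z) \<cdot> (braid V (X, Y) \<^bold>\<otimes> Id V Z)"
    and braid_unit: "X \<in> Obj V \<Longrightarrow> lunit V X \<cdot> braid V (X, unit_ob V) = runit V X"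

locale closed_symmetric_monoidal_category = symmetric_monoidal_category V
  for V :: "('o, 'a, 'z) csm_category_scheme" (structure) +
  assumes ihom_functor: "Y \<in> Obj V \<Longrightarrow> is_functor V V (ihom V Y)"
    and transp_bij: "\<lbrakk>X \<in> Obj V; Y \<in> Obj V; Z \<in> Obj V\<rbrakk>
      \<Longrightarrow> bij_betw (transp V (X, Y, Z)) (hom V (X \<otimes> Y) Z) (hom V X (Fob (ihom V Y) Z))"
    and transp_natural: "\<lbrakk>f \<in> hom V X' X; Y \<in> Obj V; h \<in> hom V Z Z'; t \<in> hom V (X \<otimes> Y) Z\<rbrakk>
      \<Longrightarrow> transp V (X', Y, Z') (h \<cdot> t \<cdot> (f \<^bold>\<otimes> Id V Y)) =
        Far (ihom V Y) h \<cdot> transp V (X, Y, Z) t \<cdot> f"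

definition ihom_counit :: "('o, 'a, 'z) csm_category_scheme \<Rightarrow> 'o \<Rightarrow> 'o \<Rightarrow> 'a" where
  "ihom_counit V Y Z = inv_into (hom V (Fob (ihom V Y) Z \<otimes>\<^bsub>V\<^esub> Y) Z)
    (transp V (Fob (ihom V Y) Z, Y, Z)) (Id V (Fob (ihom V Y) Z))"


section \<open>Tensor-closed and closed modules\<close>

record ('o, 'a, 's, 'b) tc_module =
  act :: "('o \<times> 's, 'a \<times> 'b, 's, 'b) cat_map"
  act_assoc :: "'o \<times> 'o \<times> 's \<Rightarrow> 'b"
  act_unit :: "'s \<Rightarrow> 'b"
  shom :: "('s \<times> 's, 'b \<times> 'b, 'o, 'a) cat_map"
  adj :: "'o \<times> 's \<times> 's \<Rightarrow> 'b \<Rightarrow> 'a"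

abbreviation act_ob (infixr "\<odot>\<index>" 75) where
  "K \<odot>\<^bsub>M\<^esub> X \<equiv> Fob (act M) (K, X)"

abbreviation act_ar (infixr "\<^bold>\<odot>\<index>" 75) where
  "k \<^bold>\<odot>\<^bsub>M\<^esub> x \<equiv> Far (act M) (k, x)"

locale tensor_closed_module =
  fixes V :: "('o, 'a, 'y) csm_category_scheme"
    and S :: "('s, 'b) category"
    and M :: "('o, 'a, 's, 'b, 'z) tc_module_scheme"
  assumes act_functor: "is_functor (prod_cat V S) S (act M)"
    and act_assoc_iso: "act_assoc M \<in> (\<Pi>\<^sub>E (K, L, X) \<in> Obj V \<times> Obj V \<times> Obj S.
      iso_hom S ((K \<otimes>\<^bsub>V\<^esub> L) \<odot>\<^bsub>M\<^esub> X) (K \<odot>\<^bsub>M\<^esub> (L \<odot>\<^bsub>M\<^esub> X)))"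
    and act_assoc_natural: "\<lbrakk>k \<in> hom V K K'; l \<in> hom V L L'; x \<in> hom S X X'\<rbrakk>
      \<Longrightarrow> act_assoc M (K', L', X') \<cdot>\<^bsub>S\<^esub> ((k \<^bold>\<otimes>\<^bsub>V\<^esub> l) \<^bold>\<odot>\<^bsub>M\<^esub> x) =
        (k \<^bold>\<odot>\<^bsub>M\<^esub> (l \<^bold>\<odot>\<^bsub>M\<^esub> x)) \<cdot>\<^bsub>S\<^esub> act_assoc M (K, L, X)"
    and act_unit_iso: "act_unit M \<in> (\<Pi>\<^sub>E X \<in> Obj S. iso_hom S (unit_ob V \<odot>\<^bsub>M\<^esub> X) X)"
    and act_unit_natural: "x \<in> hom S X X'
      \<Longrightarrow> act_unit M X' \<cdot>\<^bsub>S\<^esub> (Id V (unit_ob V) \<^bold>\<odot>\<^bsub>M\<^esub> x) = x \<cdot>\<^bsub>S\<^esub> act_unit M X"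
    and act_pentagon: "\<lbrakk>K \<in> Obj V; L \<in> Obj V; N \<in> Obj V; X \<in> Obj S\<rbrakk>
      \<Longrightarrow> act_assoc M (K, L, N \<odot>\<^bsub>M\<^esub> X) \<cdot>\<^bsub>S\<^esub> act_assoc M (K \<otimes>\<^bsub>V\<^esub> L, N, X) =
        (Id V K \<^bold>\<odot>\<^bsub>M\<^esub> act_assoc M (L, N, X)) \<cdot>\<^bsub>S\<^esub> act_assoc M (K, L \<otimes>\<^bsub>V\<^esub> N, X)
          \<cdot>\<^bsub>S\<^esub> (assoc V (K, L, N) \<^bold>\<odot>\<^bsub>M\<^esub> Id S X)"
    and act_triangle: "\<lbrakk>K \<in> Obj V; X \<in> Obj S\<rbrakk>
      \<Longrightarrow> (Id V K \<^bold>\<odot>\<^bsub>M\<^esub> act_unit M X) \<cdot>\<^bsub>S\<^esub> act_assoc M (K, unit_ob V, X) =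
        runit V K \<^bold>\<odot>\<^bsub>M\<^esub> Id S X"
    and shom_functor: "is_functor (prod_cat (op_cat S) S) V (shom M)"
    and adj_maps: "adj M \<in> (\<Pi>\<^sub>E (K, X, Y) \<in> Obj V \<times> Obj S \<times> Obj S.
      hom S (K \<odot>\<^bsub>M\<^esub> X) Y \<rightarrow>\<^sub>E hom V K (Fob (shom M) (X, Y)))"
    and adj_bij: "\<lbrakk>K \<in> Obj V; X \<in> Obj S; Y \<in> Obj S\<rbrakk>
      \<Longrightarrow> bij_betw (adj M (K, X, Y)) (hom S (K \<odot>\<^bsub>M\<^esub> X) Y) (hom V K (Fob (shom M) (X, Y)))"
    and adj_natural: "\<lbrakk>k \<in> hom V K' K; x \<in> hom S X' X; y \<in> hom S Y Y'; f \<in> hom S (K \<odot>\<^bsub>M\<^esub> X) Y\<rbrakk>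
      \<Longrightarrow> adj M (K', X', Y') (y \<cdot>\<^bsub>S\<^esub> f \<cdot>\<^bsub>S\<^esub> (k \<^bold>\<odot>\<^bsub>M\<^esub> x)) =
        Far (shom M) (x, y) \<cdot>\<^bsub>V\<^esub> adj M (K, X, Y) f \<cdot>\<^bsub>V\<^esub> k"

definition adj_counit ::
    "('o, 'a, 'y) csm_category_scheme \<Rightarrow> ('s, 'b) category \<Rightarrow> ('o, 'a, 's, 'b, 'z) tc_module_scheme
      \<Rightarrow> 's \<Rightarrow> 's \<Rightarrow> 'b" where
  "adj_counit V S M X Y = inv_into (hom S (Fob (shom M) (X, Y) \<odot>\<^bsub>M\<^esub> X) Y)
    (adj M (Fob (shom M) (X, Y), X, Y)) (Id V (Fob (shom M) (X, Y)))"

record ('o, 'a, 's, 'b) cl_module = "('o, 'a, 's, 'b) tc_module" +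
  cotensor :: "('o \<times> 's, 'a \<times> 'b, 's, 'b) cat_map"
  coadj :: "'o \<times> 's \<times> 's \<Rightarrow> 'b \<Rightarrow> 'a"

text \<open>Since \<open>\<pitchfork>\<close> has target \<open>\<S>\<^sup>o\<^sup>p\<close>, for \<open>k : K' \<rightarrow> K\<close> in \<open>\<V>\<close> and \<open>x : X \<rightarrow> X'\<close> in \<open>\<S>\<close>
  the arrow \<open>k \<pitchfork> x\<close> of \<open>\<S>\<close> goes from \<open>K \<pitchfork> X\<close> to \<open>K' \<pitchfork> X'\<close>.\<close>

locale closed_module = tensor_closed_module V S M
  for V :: "('o, 'a, 'y) csm_category_scheme"
    and S :: "('s, 'b) category"
    and M :: "('o, 'a, 's, 'b, 'z) cl_module_scheme" +
  assumes cotensor_functor: "is_functor (prod_cat V (op_cat S)) (op_cat S) (cotensor M)"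
    and coadj_maps: "coadj M \<in> (\<Pi>\<^sub>E (K, X, Y) \<in> Obj V \<times> Obj S \<times> Obj S.
      hom S Y (Fob (cotensor M) (K, X)) \<rightarrow>\<^sub>E hom V K (Fob (shom M) (Y, X)))"
    and coadj_bij: "\<lbrakk>K \<in> Obj V; X \<in> Obj S; Y \<in> Obj S\<rbrakk>
      \<Longrightarrow> bij_betw (coadj M (K, X, Y))
        (hom S Y (Fob (cotensor M) (K, X))) (hom V K (Fob (shom M) (Y, X)))"
    and coadj_natural: "\<lbrakk>k \<in> hom V K' K; x \<in> hom S X X'; y \<in> hom S Y' Y;
        f \<in> hom S Y (Fob (cotensor M) (K, X))\<rbrakk>
      \<Longrightarrow> coadj M (K', X', Y') (Far (cotensor M) (k, x) \<cdot>\<^bsub>S\<^esub> f \<cdot>\<^bsub>S\<^esub> y) =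
        Far (shom M) (y, x) \<cdot>\<^bsub>V\<^esub> coadj M (K, X, Y) f \<cdot>\<^bsub>V\<^esub> k"


section \<open>\<open>\<V>\<close>-structures\<close>

record ('o, 'a, 's, 'b) v_struct =
  vhom :: "('s \<times> 's, 'b \<times> 'b, 'o, 'a) cat_map"
  vcomp :: "'s \<times> 's \<times> 's \<Rightarrow> 'a"
  vname :: "'s \<times> 's \<Rightarrow> 'b \<Rightarrow> 'a"

abbreviation vhom_ob ("\<langle>_, _\<rangle>\<index>") where
  "\<langle>X, Y\<rangle>\<^bsub>A\<^esub> \<equiv> Fob (vhom A) (X, Y)"

locale v_structure =
  fixes V :: "('o, 'a, 'y) csm_category_scheme"
    and S :: "('s, 'b) category"
    and A :: "('o, 'a, 's, 'b) v_struct" (structure)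
  assumes vhom_functor: "is_functor (prod_cat (op_cat S) S) V (vhom A)"
    and vcomp_hom: "vcomp A \<in> (\<Pi>\<^sub>E (X, Y, Z) \<in> Obj S \<times> Obj S \<times> Obj S.
      hom V (\<langle>Y, Z\<rangle> \<otimes>\<^bsub>V\<^esub> \<langle>X, Y\<rangle>) \<langle>X, Z\<rangle>)"
    and vname_maps: "vname A \<in> (\<Pi>\<^sub>E (X, Y) \<in> Obj S \<times> Obj S.
      hom S X Y \<rightarrow>\<^sub>E hom V (unit_ob V) \<langle>X, Y\<rangle>)"
    and vname_bij: "\<lbrakk>X \<in> Obj S; Y \<in> Obj S\<rbrakk>
      \<Longrightarrow> bij_betw (vname A (X, Y)) (hom S X Y) (hom V (unit_ob V) \<langle>X, Y\<rangle>)"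
    and vname_natural: "\<lbrakk>x \<in> hom S X' X; f \<in> hom S X Y; y \<in> hom S Y Y'\<rbrakk>
      \<Longrightarrow> vname A (X', Y') (y \<cdot>\<^bsub>S\<^esub> f \<cdot>\<^bsub>S\<^esub> x) = Far (vhom A) (x, y) \<cdot>\<^bsub>V\<^esub> vname A (X, Y) f"
    and vcomp_assoc: "\<lbrakk>W \<in> Obj S; X \<in> Obj S; Y \<in> Obj S; Z \<in> Obj S\<rbrakk>
      \<Longrightarrow> vcomp A (W, X, Z) \<cdot>\<^bsub>V\<^esub> (vcomp A (X, Y, Z) \<^bold>\<otimes>\<^bsub>V\<^esub> Id V \<langle>W, X\<rangle>) =
        vcomp A (W, Y, Z) \<cdot>\<^bsub>V\<^esub> (Id V \<langle>Y, Z\<rangle> \<^bold>\<otimes>\<^bsub>V\<^esub> vcomp A (W, X, Y))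
          \<cdot>\<^bsub>V\<^esub> assoc V (\<langle>Y, Z\<rangle>, \<langle>X, Y\<rangle>, \<langle>W, X\<rangle>)"
    and vhom_left: "\<lbrakk>f \<in> hom S X Y; Z \<in> Obj S\<rbrakk>
      \<Longrightarrow> Far (vhom A) (f, Id S Z) =
        vcomp A (X, Y, Z) \<cdot>\<^bsub>V\<^esub> (Id V \<langle>Y, Z\<rangle> \<^bold>\<otimes>\<^bsub>V\<^esub> vname A (X, Y) f)
          \<cdot>\<^bsub>V\<^esub> inv_arr V (runit V \<langle>Y, Z\<rangle>)"
    and vhom_right: "\<lbrakk>X \<in> Obj S; g \<in> hom S Y Z\<rbrakk>
      \<Longrightarrow> Far (vhom A) (Id S X, g) =
        vcomp A (X, Y, Z) \<cdot>\<^bsub>V\<^esub> (vname A (Y, Z) g \<^bold>\<otimes>\<^bsub>V\<^esub> Id V \<langle>X, Y\<rangle>)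
          \<cdot>\<^bsub>V\<^esub> inv_arr V (lunit V \<langle>X, Y\<rangle>)"

definition canonical_v_struct ::
    "('o, 'a, 'y) csm_category_scheme \<Rightarrow> ('s, 'b) category
      \<Rightarrow> ('o, 'a, 's, 'b, 'z) tc_module_scheme \<Rightarrow> ('o, 'a, 's, 'b) v_struct" where
  "canonical_v_struct V S M =
    (let H = (\<lambda>X Y. Fob (shom M) (X, Y)); \<epsilon> = adj_counit V S M in
    \<lparr>vhom = shom M,
     vcomp = (\<lambda>(X, Y, Z) \<in> Obj S \<times> Obj S \<times> Obj S.
       adj M (H Y Z \<otimes>\<^bsub>V\<^esub> H X Y, X, Z)
         (\<epsilon> Y Z \<cdot>\<^bsub>S\<^esub> (Id V (H Y Z) \<^bold>\<odot>\<^bsub>M\<^esub> \<epsilon> X Y) \<cdot>\<^bsub>S\<^esub> act_assoc M (H Y Z, H X Y, X))),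
     vname = (\<lambda>(X, Y) \<in> Obj S \<times> Obj S. \<lambda>f \<in> hom S X Y.
       adj M (unit_ob V, X, Y) (f \<cdot>\<^bsub>S\<^esub> act_unit M X))\<rparr>)"

definition op_v_struct ::
    "('o, 'a, 'y) csm_category_scheme \<Rightarrow> ('s, 'b) category
      \<Rightarrow> ('o, 'a, 's, 'b) v_struct \<Rightarrow> ('o, 'a, 's, 'b) v_struct" where
  "op_v_struct V S A =
    \<lparr>vhom = \<lparr>Fob = (\<lambda>(X, Y) \<in> Obj S \<times> Obj S. Fob (vhom A) (Y, X)),
             Far = (\<lambda>(f, g) \<in> Arr S \<times> Arr S. Far (vhom A) (g, f))\<rparr>,
     vcomp = (\<lambda>(X, Y, Z) \<in> Obj S \<times> Obj S \<times> Obj S.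
       vcomp A (Z, Y, X) \<cdot>\<^bsub>V\<^esub> braid V (\<langle>Z, Y\<rangle>\<^bsub>A\<^esub>, \<langle>Y, X\<rangle>\<^bsub>A\<^esub>)),
     vname = (\<lambda>(X, Y) \<in> Obj S \<times> Obj S. vname A (Y, X))\<rparr>"


section \<open>Closed bimodules\<close>

text \<open>\<open>bi_opmod\<close> is the module structure on \<open>\<S>\<^sup>o\<^sup>p\<close>: its tensor is \<open>\<pitchfork>\<close>, its associativity and
  unit isomorphisms are \<open>a\<^sup>o\<^sup>p\<close> and \<open>l\<^sup>o\<^sup>p\<close> (as arrows of \<open>\<S>\<^sup>o\<^sup>p\<close>), its adjunction is \<open>\<psi>\<close>.\<close>

record ('o, 'a, 's, 'b) cl_bimodule =
  bi_mod :: "('o, 'a, 's, 'b) tc_module"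
  bi_opmod :: "('o, 'a, 's, 'b) tc_module"

definition closed_bimodule ::
    "('o, 'a, 'y) csm_category_scheme \<Rightarrow> ('s, 'b) category \<Rightarrow> ('o, 'a, 's, 'b) cl_bimodule \<Rightarrow> bool"
  where
  "closed_bimodule V S B \<longleftrightarrow>
    tensor_closed_module V S (bi_mod B) \<and>
    tensor_closed_module V (op_cat S) (bi_opmod B) \<and>
    canonical_v_struct V (op_cat S) (bi_opmod B) = op_v_struct V S (canonical_v_struct V S (bi_mod B))"

definition extends_closed_module ::
    "('o, 'a, 's, 'b) cl_bimodule \<Rightarrow> ('o, 'a, 's, 'b) cl_module \<Rightarrow> bool" where
  "extends_closed_module B M \<longleftrightarrow>
    bi_mod B = tc_module.truncate M \<and> act (bi_opmod B) = cotensor M \<and> adj (bi_opmod B) = coadj M"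


section \<open>Cylinders and paths\<close>

record ('o, 'a, 's) cyl =
  cyl_ob :: "'o \<times> 's \<Rightarrow> 's"
  cyl_unit :: "'o \<times> 's \<Rightarrow> 'a"
  cyl_iso :: "'o \<times> 's \<times> 's \<Rightarrow> 'a"

locale cylinder =
  fixes V :: "('o, 'a, 'y) csm_category_scheme"
    and S :: "('s, 'b) category"
    and A :: "('o, 'a, 's, 'b) v_struct" (structure)
    and P :: "('o, 'a, 's) cyl"
  assumes cyl_ob: "cyl_ob P \<in> Obj V \<times> Obj S \<rightarrow>\<^sub>E Obj S"
    and cyl_unit: "cyl_unit P \<in> (\<Pi>\<^sub>E (K, X) \<in> Obj V \<times> Obj S. hom V K \<langle>X, cyl_ob P (K, X)\<rangle>)"
    and cyl_iso: "cyl_iso P \<in> (\<Pi>\<^sub>E (K, X, Y) \<in> Obj V \<times> Obj S \<times> Obj S.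
      iso_hom V \<langle>cyl_ob P (K, X), Y\<rangle> (Fob (ihom V K) \<langle>X, Y\<rangle>))"
    and cyl_eq: "\<lbrakk>K \<in> Obj V; X \<in> Obj S; Y \<in> Obj S\<rbrakk>
      \<Longrightarrow> ihom_counit V K \<langle>X, Y\<rangle> \<cdot>\<^bsub>V\<^esub> (cyl_iso P (K, X, Y) \<^bold>\<otimes>\<^bsub>V\<^esub> Id V K) =
        vcomp A (X, cyl_ob P (K, X), Y)
          \<cdot>\<^bsub>V\<^esub> (Id V \<langle>cyl_ob P (K, X), Y\<rangle> \<^bold>\<otimes>\<^bsub>V\<^esub> cyl_unit P (K, X))"

record ('o, 'a, 's, 'b) v_struct_cyl_path =
  vstr :: "('o, 'a, 's, 'b) v_struct"
  cyl :: "('o, 'a, 's) cyl"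
  path :: "('o, 'a, 's) cyl"

definition v_structure_cyl_path ::
    "('o, 'a, 'y) csm_category_scheme \<Rightarrow> ('s, 'b) category
      \<Rightarrow> ('o, 'a, 's, 'b) v_struct_cyl_path \<Rightarrow> bool" where
  "v_structure_cyl_path V S D \<longleftrightarrow>
    v_structure V S (vstr D) \<and>
    cylinder V S (vstr D) (cyl D) \<and>
    cylinder V (op_cat S) (op_v_struct V S (vstr D)) (path D)"

text \<open>The correspondence realised by the bijection: the \<open>\<V>\<close>-structure is the canonical one of the
  closed module, the objects \<open>K \<otimes> X\<close> and \<open>K \<pitchfork> X\<close> agree, and \<open>\<alpha>\<close> and \<open>\<beta>\<close> are the units of the
  adjunctions \<open>\<phi>\<close> and \<open>\<psi>\<close>. The isomorphisms of the cylinder and the path need no clause, being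
  determined by \<open>\<alpha>\<close> and \<open>\<beta>\<close> through \<open>cyl_eq\<close>.\<close>

definition corresponds ::
    "('o, 'a, 'y) csm_category_scheme \<Rightarrow> ('s, 'b) category
      \<Rightarrow> ('o, 'a, 's, 'b) v_struct_cyl_path \<Rightarrow> ('o, 'a, 's, 'b) cl_module \<Rightarrow> bool" where
  "corresponds V S D M \<longleftrightarrow>
    vstr D = canonical_v_struct V S M \<and>
    (\<forall>K\<in>Obj V. \<forall>X\<in>Obj S.
      cyl_ob (cyl D) (K, X) = K \<odot>\<^bsub>M\<^esub> X \<and>
      cyl_unit (cyl D) (K, X) = adj M (K, X, K \<odot>\<^bsub>M\<^esub> X) (Id S (K \<odot>\<^bsub>M\<^esub> X)) \<and>
      cyl_ob (path D) (K, X) = Fob (cotensor M) (K, X) \<and>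
      cyl_unit (path D) (K, X) =
        coadj M (K, X, Fob (cotensor M) (K, X)) (Id S (Fob (cotensor M) (K, X))))"

end

theory Submission
  imports Defs
begin

text \<open>
  Write \<open>g * h\<close> for the composite \<open>\<bullet> \<cdot> (g \<otimes> h)\<close> in a \<open>\<V>\<close>-structure and call \<open>\<alpha> : K \<rightarrow> \<langle>X, W\<rangle>\<close> universal
  if \<open>g \<mapsto> g * \<alpha>\<close> is a bijection \<open>\<V>(L, \<langle>W, Y\<rangle>) \<rightarrow> \<V>(L \<otimes> K, \<langle>X, Y\<rangle>)\<close> for all \<open>L\<close>, \<open>Y\<close>. By the Yoneda
  lemma a cylinder is the same thing as a choice of universal arrows. The units of a
  tensor-closed module are universal for its canonical \<open>\<V>\<close>-structure because \<open>a\<close> is invertible.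
  Conversely, universal arrows determine \<open>K \<otimes> X\<close> as a functor and \<open>\<phi>\<close>, and then \<open>a\<close> and \<open>l\<close> are
  the unique morphisms with \<open>\<phi>(a) = \<alpha> * \<alpha>\<close> and \<open>\<phi>(l)\<close> the name of the identity; coherence follows
  from associativity of \<open>*\<close>. So tensor-closed modules correspond to \<open>\<V>\<close>-structures with
  cylinder. For a closed module the units \<open>\<beta>\<close> of \<open>\<psi>\<close> are universal for the opposite structure: if
  \<open>g = \<phi>(f)\<close> with \<open>f : L \<otimes> Y \<rightarrow> K \<pitchfork> X\<close>, then \<open>\<beta> * g = \<psi>(f) * \<eta>\<close> with \<open>\<eta>\<close> the unit of \<open>\<phi>\<close>, and
  \<open>\<psi>\<close> and \<open>- * \<eta>\<close> are bijections.
\<close>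

section \<open>Categories\<close>

text \<open>A closed module comes without associativity and unit isomorphisms for
  \<open>\<pitchfork>\<close>, and a \<V>-structure with cylinder comes without those for
  \<open>\<otimes>\<close>. Both halves of the theorem thus face the same question: when does an
  adjunction determine coherent \<open>a\<close> and \<open>l\<close>? Hence adjunctions without
  \<open>a\<close> and \<open>l\<close> form a notion of their own (\<open>tensored\<close>), over
  an arbitrary category, and all results about them are used twice: at \<open>S\<close> with a
  structure \<open>A\<close>, and at \<open>op_cat S\<close> with \<open>op_v_struct V S A\<close>.
  For the second use the opposite structure must be a \<V>-structure, which rests on the hexagon and
  on the unit law of the symmetry.

  A \<V>-structure postulates only associativity of composition and that arrows of \<open>S\<close>
  act by composition with their names. Naturality of \<open>*\<close> in its three objects is
  therefore a theorem, and it needs the unit coherences that follow from the pentagon and the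
  triangle.

  The bijection itself is chosen from the relation \<open>corresponds\<close>, after this has been
  shown to be one-to-one in both directions.\<close>

lemma in_hom_iff [simp]: "f \<in> hom C X Y \<longleftrightarrow> f \<in> Arr C \<and> Dom C f = X \<and> Cod C f = Y"
  by (simp add: hom_def)

context category
begin

lemma obj_simps [simp]:
  "f \<in> Arr C \<Longrightarrow> Dom C f \<in> Obj C"
  "f \<in> Arr C \<Longrightarrow> Cod C f \<in> Obj C"
  by (auto simp: Dom_Obj Cod_Obj)

lemma id_simps [simp]:
  assumes "X \<in> Obj C"
  shows "Id C X \<in> Arr C" "Dom C (Id C X) = X" "Cod C (Id C X) = X"
  using Id_hom[OF assms] by auto

lemma comp_simps [simp]:
  assumes "f \<in> Arr C" "g \<in> Arr C" "Cod C f = Dom C g"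
  shows "g \<cdot> f \<in> Arr C" "Dom C (g \<cdot> f) = Dom C f" "Cod C (g \<cdot> f) = Cod C g"
  using Comp_hom[of f "Dom C f" "Cod C f" g "Cod C g"] assms by auto

lemma comp_id_simps [simp]:
  "\<lbrakk>f \<in> Arr C; Dom C f = X\<rbrakk> \<Longrightarrow> f \<cdot> Id C X = f"
  "\<lbrakk>f \<in> Arr C; Cod C f = X\<rbrakk> \<Longrightarrow> Id C X \<cdot> f = f"
  using Comp_Id Id_Comp by auto

lemma comp_assoc [simp]:
  assumes "f \<in> Arr C" "g \<in> Arr C" "h \<in> Arr C" "Cod C f = Dom C g" "Cod C g = Dom C h"
  shows "(h \<cdot> g) \<cdot> f = h \<cdot> (g \<cdot> f)"
  using Comp_assoc[of f "Dom C f" "Cod C f" g "Cod C g" h "Cod C h"] assms by auto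

lemma category_op: "category (op_cat C)"
  by unfold_locales (auto simp: op_cat_def)

lemma inverse_arrows_unique:
  assumes "inverse_arrows C f g" "inverse_arrows C f g'"
  shows "g = g'"
proof -
  have "g \<cdot> (f \<cdot> g') = (g \<cdot> f) \<cdot> g'"
    using assms by (intro comp_assoc[symmetric]) (auto simp: inverse_arrows_def)
  with assms show ?thesis by (simp add: inverse_arrows_def)
qed

lemma inverse_arrows_inv:
  assumes "f \<in> iso_hom C X Y"
  shows "inverse_arrows C f (inv_arr C f)"
proof -
  obtain g where "inverse_arrows C f g" using assms by (auto simp: iso_hom_def)
  then show ?thesis
    unfolding inv_arr_def using inverse_arrows_unique by (auto intro: theI2)
qed

lemma iso_homD:
  assumes "f \<in> iso_hom C X Y"
  shows "f \<in> Arr C" "Dom C f = X" "Cod C f = Y"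
  using assms by (auto simp: iso_hom_def)

lemma inv_arrD:
  assumes "f \<in> iso_hom C X Y"
  shows "inv_arr C f \<in> Arr C" "Dom C (inv_arr C f) = Y" "Cod C (inv_arr C f) = X"
    "f \<cdot> inv_arr C f = Id C Y" "inv_arr C f \<cdot> f = Id C X"
  using inverse_arrows_inv[OF assms] iso_homD[OF assms] by (auto simp: inverse_arrows_def)

lemma iso_homI:
  assumes "f \<in> hom C X Y" "g \<in> hom C Y X" "g \<cdot> f = Id C X" "f \<cdot> g = Id C Y"
  shows "f \<in> iso_hom C X Y"
  using assms by (auto simp: iso_hom_def inverse_arrows_def)

lemma iso_comp:
  assumes "f \<in> iso_hom C X Y" "g \<in> iso_hom C Y Z"
  shows "g \<cdot> f \<in> iso_hom C X Z"
proof -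
  note f = iso_homD[OF assms(1)] inv_arrD[OF assms(1)]
  note g = iso_homD[OF assms(2)] inv_arrD[OF assms(2)]
  have "(inv_arr C f \<cdot> inv_arr C g) \<cdot> (g \<cdot> f) = inv_arr C f \<cdot> (inv_arr C g \<cdot> g) \<cdot> f"
    and "(g \<cdot> f) \<cdot> (inv_arr C f \<cdot> inv_arr C g) = g \<cdot> (f \<cdot> inv_arr C f) \<cdot> inv_arr C g"
    using f(1-6) g(1-6) by simp_all
  then show ?thesis
    using f g by (intro iso_homI[of _ _ _ "inv_arr C f \<cdot> inv_arr C g"]) simp_all
qed

lemma iso_precomp_bij:
  assumes "a \<in> iso_hom C X Y"
  shows "bij_betw (\<lambda>f. f \<cdot> a) (hom C Y Z) (hom C X Z)"
  using iso_homD[OF assms] inv_arrD[OF assms]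
  by (intro bij_betw_byWitness[where f' = "\<lambda>f. f \<cdot> inv_arr C a"]) auto

lemma iso_postcomp_bij:
  assumes "a \<in> iso_hom C X Y"
  shows "bij_betw (\<lambda>f. a \<cdot> f) (hom C Z X) (hom C Z Y)"
proof -
  note [simp] = iso_homD[OF assms] inv_arrD[OF assms]
  have *: "a \<cdot> (inv_arr C a \<cdot> f) = f" if "f \<in> hom C Z Y" for f
    using that comp_assoc[of f "inv_arr C a" a] by (simp del: comp_assoc)
  have **: "inv_arr C a \<cdot> (a \<cdot> f) = f" if "f \<in> hom C Z X" for f
    using that comp_assoc[of f a "inv_arr C a"] by (simp del: comp_assoc)
  show ?thesis
    by (intro bij_betw_byWitness[where f' = "\<lambda>f. inv_arr C a \<cdot> f"]) (use * ** in auto)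
qed

lemma iso_cancel_right:
  assumes "a \<in> iso_hom C X Y" "f \<in> hom C Y Z" "g \<in> hom C Y Z" "f \<cdot> a = g \<cdot> a"
  shows "f = g"
  using iso_precomp_bij[OF assms(1)] assms(2-) by (auto simp: bij_betw_def inj_on_def)

lemma iso_cancel_left:
  assumes "a \<in> iso_hom C X Y" "f \<in> hom C Z X" "g \<in> hom C Z X" "a \<cdot> f = a \<cdot> g"
  shows "f = g"
  using iso_postcomp_bij[OF assms(1)] assms(2-) by (auto simp: bij_betw_def inj_on_def)

text \<open>Yoneda: surjectivity at \<open>Z = X\<close> gives a left inverse \<open>g\<close> of
  \<open>a\<close>, and injectivity at \<open>Z = Y\<close> makes it a right inverse, because
  \<open>a \<cdot> g\<close> and the identity agree after precomposition with
  \<open>a\<close>.\<close>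

lemma precomp_bij_iso:
  assumes a: "a \<in> hom C X Y"
    and bij: "\<And>Z. Z \<in> Obj C \<Longrightarrow> bij_betw (\<lambda>f. f \<cdot> a) (hom C Y Z) (hom C X Z)"
  shows "a \<in> iso_hom C X Y"
proof -
  have X: "X \<in> Obj C" and Y: "Y \<in> Obj C" using a by auto
  have "Id C X \<in> (\<lambda>f. f \<cdot> a) ` hom C Y X"
    using bij[OF X] X by (simp add: bij_betw_def)
  then obtain g where g: "g \<in> hom C Y X" "g \<cdot> a = Id C X" by auto
  have "inj_on (\<lambda>f. f \<cdot> a) (hom C Y Y)" using bij[OF Y] by (simp add: bij_betw_def)
  moreover have "(a \<cdot> g) \<cdot> a = Id C Y \<cdot> a" using g a X Y by simp
  ultimately have "a \<cdot> g = Id C Y" using g a Y unfolding inj_on_def by auto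
  then show ?thesis using iso_homI[OF a] g by auto
qed

text \<open>The covariant form of the Yoneda argument, needed for the isomorphisms of a
  cylinder.\<close>

lemma postcomp_bij_iso:
  assumes a: "a \<in> hom C X Y"
    and bij: "\<And>Z. Z \<in> Obj C \<Longrightarrow> bij_betw (\<lambda>f. a \<cdot> f) (hom C Z X) (hom C Z Y)"
  shows "a \<in> iso_hom C X Y"
proof -
  have X: "X \<in> Obj C" and Y: "Y \<in> Obj C" using a by auto
  have "Id C Y \<in> (\<lambda>f. a \<cdot> f) ` hom C Y X"
    using bij[OF Y] Y by (simp add: bij_betw_def)
  then obtain g where g: "g \<in> hom C Y X" "a \<cdot> g = Id C Y" by auto
  have "inj_on (\<lambda>f. a \<cdot> f) (hom C X X)" using bij[OF X] by (simp add: bij_betw_def)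
  moreover have "a \<cdot> (g \<cdot> a) = a \<cdot> Id C X"
    using g a X Y comp_assoc[of a g a] by (simp del: comp_assoc)
  ultimately have "g \<cdot> a = Id C X" using g a X unfolding inj_on_def by auto
  then show ?thesis using iso_homI[OF a] g by auto
qed

end

section \<open>Opposite categories, product categories and functors of two variables\<close>

lemma op_cat_simps [simp]:
  "Obj (op_cat C) = Obj C" "Arr (op_cat C) = Arr C" "Dom (op_cat C) = Cod C" "Cod (op_cat C) = Dom C"
  "Id (op_cat C) = Id C" "g \<cdot>\<^bsub>op_cat C\<^esub> f = f \<cdot>\<^bsub>C\<^esub> g"
  by (simp_all add: op_cat_def)

lemma hom_op_cat: "hom (op_cat C) X Y = hom C Y X"
  by auto

lemma prod_cat_simps [simp]:
  "Obj (prod_cat C D) = Obj C \<times> Obj D" "Arr (prod_cat C D) = Arr C \<times> Arr D"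
  "Dom (prod_cat C D) (f, h) = (Dom C f, Dom D h)" "Cod (prod_cat C D) (f, h) = (Cod C f, Cod D h)"
  "Id (prod_cat C D) (X, Y) = (Id C X, Id D Y)"
  "(g, k) \<cdot>\<^bsub>prod_cat C D\<^esub> (f, h) = (g \<cdot>\<^bsub>C\<^esub> f, k \<cdot>\<^bsub>D\<^esub> h)"
  by (simp_all add: prod_cat_def)

text \<open>One set of rules for the tensor of \<V>, for actions on \<open>S\<close> and, with
  \<open>C\<close> an opposite category, for hom functors.\<close>

locale bifunctor =
  fixes C :: "('o, 'a, 'x) category_scheme" and D :: "('p, 'b, 'y) category_scheme"
    and E :: "('q, 'c, 'z) category_scheme" and F
  assumes is_functor: "is_functor (prod_cat C D) E F"
begin

lemma bifunctor_Fob [simp]: "X \<in> Obj C \<Longrightarrow> Y \<in> Obj D \<Longrightarrow> Fob F (X, Y) \<in> Obj E"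
  using is_functor by (auto simp: is_functor_def PiE_def Pi_def)

lemma bifunctor_Far [simp]:
  assumes "f \<in> Arr C" "g \<in> Arr D"
  shows "Far F (f, g) \<in> Arr E" "Dom E (Far F (f, g)) = Fob F (Dom C f, Dom D g)"
    "Cod E (Far F (f, g)) = Fob F (Cod C f, Cod D g)"
proof -
  have "Far F \<in> (\<Pi>\<^sub>E f\<in>Arr (prod_cat C D).
      hom E (Fob F (Dom (prod_cat C D) f)) (Fob F (Cod (prod_cat C D) f)))"
    using is_functor by (simp add: is_functor_def)
  from PiE_mem[OF this, of "(f, g)"] show "Far F (f, g) \<in> Arr E"
    "Dom E (Far F (f, g)) = Fob F (Dom C f, Dom D g)"
    "Cod E (Far F (f, g)) = Fob F (Cod C f, Cod D g)"
    using assms by auto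
qed

lemma bifunctor_Id [simp]:
  "X \<in> Obj C \<Longrightarrow> Y \<in> Obj D \<Longrightarrow> Far F (Id C X, Id D Y) = Id E (Fob F (X, Y))"
  using is_functor by (fastforce simp: is_functor_def)

lemma bifunctor_comp [simp]:
  assumes "f \<in> Arr C" "f' \<in> Arr C" "Cod C f = Dom C f'"
    and "g \<in> Arr D" "g' \<in> Arr D" "Cod D g = Dom D g'"
  shows "Far F (f', g') \<cdot>\<^bsub>E\<^esub> Far F (f, g) = Far F (f' \<cdot>\<^bsub>C\<^esub> f, g' \<cdot>\<^bsub>D\<^esub> g)"
proof -
  have "\<forall>X Y Z. \<forall>p\<in>hom (prod_cat C D) X Y. \<forall>q\<in>hom (prod_cat C D) Y Z.
      Far F (q \<cdot>\<^bsub>prod_cat C D\<^esub> p) = Far F q \<cdot>\<^bsub>E\<^esub> Far F p"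
    using is_functor by (simp add: is_functor_def)
  from this[rule_format, of "(f, g)" _ _ "(f', g')"] assms show ?thesis by auto
qed

text \<open>\<open>bifunctor_comp\<close> for composites bracketed to the right, where the bracket
  separates the two values of \<open>F\<close>.\<close>

lemma bifunctor_comp_assoc [simp]:
  assumes "category E" "f \<in> Arr C" "f' \<in> Arr C" "Cod C f = Dom C f'"
    and "g \<in> Arr D" "g' \<in> Arr D" "Cod D g = Dom D g'"
    and "h \<in> Arr E" "Cod E h = Fob F (Dom C f, Dom D g)"
  shows "Far F (f', g') \<cdot>\<^bsub>E\<^esub> (Far F (f, g) \<cdot>\<^bsub>E\<^esub> h) = Far F (f' \<cdot>\<^bsub>C\<^esub> f, g' \<cdot>\<^bsub>D\<^esub> g) \<cdot>\<^bsub>E\<^esub> h"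
proof -
  interpret category E by fact
  show ?thesis
    using assms by (subst comp_assoc[symmetric]) auto
qed

lemma Fob_extensional: "Fob F \<in> extensional (Obj C \<times> Obj D)"
  and Far_extensional: "Far F \<in> extensional (Arr C \<times> Arr D)"
  using is_functor by (auto simp: is_functor_def PiE_def)

end

lemma is_functorI:
  assumes "Fob F \<in> extensional (Obj C \<times> Obj D)" "Far F \<in> extensional (Arr C \<times> Arr D)"
    and "\<And>X Y. X \<in> Obj C \<Longrightarrow> Y \<in> Obj D \<Longrightarrow> Fob F (X, Y) \<in> Obj E"
    and "\<And>f g. f \<in> Arr C \<Longrightarrow> g \<in> Arr D
      \<Longrightarrow> Far F (f, g) \<in> hom E (Fob F (Dom C f, Dom D g)) (Fob F (Cod C f, Cod D g))"
    and "\<And>X Y. X \<in> Obj C \<Longrightarrow> Y \<in> Obj D \<Longrightarrow> Far F (Id C X, Id D Y) = Id E (Fob F (X, Y))"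
    and "\<And>f f' g g'. \<lbrakk>f \<in> Arr C; f' \<in> Arr C; Cod C f = Dom C f';
      g \<in> Arr D; g' \<in> Arr D; Cod D g = Dom D g'\<rbrakk>
      \<Longrightarrow> Far F (f' \<cdot>\<^bsub>C\<^esub> f, g' \<cdot>\<^bsub>D\<^esub> g) = Far F (f', g') \<cdot>\<^bsub>E\<^esub> Far F (f, g)"
  shows "is_functor (prod_cat C D) E F"
  unfolding is_functor_def
  using assms by (auto simp: PiE_def)

section \<open>Actions of monoidal categories\<close>

sublocale monoidal_category \<subseteq> tensor: bifunctor V V V "tensor V"
  by unfold_locales (rule tensor_functor)

context monoidal_category
begin

lemmas [simp] = unit_ob

lemma tensor_comp_assoc [simp]:
  assumes "f \<in> Arr V" "f' \<in> Arr V" "Cod V f = Dom V f'"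
    and "g \<in> Arr V" "g' \<in> Arr V" "Cod V g = Dom V g'"
    and "h \<in> Arr V" "Cod V h = Dom V f \<otimes> Dom V g"
  shows "(f' \<^bold>\<otimes> g') \<cdot> ((f \<^bold>\<otimes> g) \<cdot> h) = ((f' \<cdot> f) \<^bold>\<otimes> (g' \<cdot> g)) \<cdot> h"
  using assms category_axioms by simp

lemma assoc_simps [simp]:
  assumes "X \<in> Obj V" "Y \<in> Obj V" "Z \<in> Obj V"
  shows "assoc V (X, Y, Z) \<in> Arr V" "Dom V (assoc V (X, Y, Z)) = (X \<otimes> Y) \<otimes> Z"
    "Cod V (assoc V (X, Y, Z)) = X \<otimes> (Y \<otimes> Z)"
  using iso_homD[OF assoc_iso[OF assms]] by auto

lemma unit_simps [simp]:
  assumes "X \<in> Obj V"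
  shows "lunit V X \<in> Arr V" "Dom V (lunit V X) = unit_ob V \<otimes> X" "Cod V (lunit V X) = X"
    "runit V X \<in> Arr V" "Dom V (runit V X) = X \<otimes> unit_ob V" "Cod V (runit V X) = X"
  using iso_homD[OF lunit_iso[OF assms]] iso_homD[OF runit_iso[OF assms]] by auto

lemma inv_unit_simps [simp]:
  assumes "X \<in> Obj V"
  shows "inv_arr V (lunit V X) \<in> Arr V" "Dom V (inv_arr V (lunit V X)) = X"
    "Cod V (inv_arr V (lunit V X)) = unit_ob V \<otimes> X"
    "lunit V X \<cdot> inv_arr V (lunit V X) = Id V X"
    "inv_arr V (lunit V X) \<cdot> lunit V X = Id V (unit_ob V \<otimes> X)"
    "inv_arr V (runit V X) \<in> Arr V" "Dom V (inv_arr V (runit V X)) = X"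
    "Cod V (inv_arr V (runit V X)) = X \<otimes> unit_ob V"
    "runit V X \<cdot> inv_arr V (runit V X) = Id V X"
    "inv_arr V (runit V X) \<cdot> runit V X = Id V (X \<otimes> unit_ob V)"
  using inv_arrD[OF lunit_iso[OF assms]] inv_arrD[OF runit_iso[OF assms]] by auto

end

text \<open>A module without adjunction and without extensionality of its data. In this sense a
  monoidal category acts on itself, so that a coherence law proved here holds for \<V> and for
  modules alike.\<close>

locale action = monoidal_category V + S: category S
  for V :: "('o, 'a, 'y) csm_category_scheme" (structure)
    and S :: "('s, 'b, 'z) category_scheme" +
  fixes T :: "('o \<times> 's, 'a \<times> 'b, 's, 'b) cat_map"
    and as :: "'o \<times> 'o \<times> 's \<Rightarrow> 'b" and un :: "'s \<Rightarrow> 'b"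
  assumes T_functor: "is_functor (prod_cat V S) S T"
    and as_iso: "\<lbrakk>K \<in> Obj V; L \<in> Obj V; X \<in> Obj S\<rbrakk>
      \<Longrightarrow> as (K, L, X) \<in> iso_hom S (Fob T (K \<otimes> L, X)) (Fob T (K, Fob T (L, X)))"
    and as_natural: "\<lbrakk>k \<in> hom V K K'; l \<in> hom V L L'; x \<in> hom S X X'\<rbrakk>
      \<Longrightarrow> as (K', L', X') \<cdot>\<^bsub>S\<^esub> Far T (k \<^bold>\<otimes> l, x) = Far T (k, Far T (l, x)) \<cdot>\<^bsub>S\<^esub> as (K, L, X)"
    and un_iso: "X \<in> Obj S \<Longrightarrow> un X \<in> iso_hom S (Fob T (unit_ob V, X)) X"
    and un_natural: "x \<in> hom S X X'
      \<Longrightarrow> un X' \<cdot>\<^bsub>S\<^esub> Far T (Id V (unit_ob V), x) = x \<cdot>\<^bsub>S\<^esub> un X"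
    and as_pentagon: "\<lbrakk>K \<in> Obj V; L \<in> Obj V; N \<in> Obj V; X \<in> Obj S\<rbrakk>
      \<Longrightarrow> as (K, L, Fob T (N, X)) \<cdot>\<^bsub>S\<^esub> as (K \<otimes> L, N, X) =
        Far T (Id V K, as (L, N, X)) \<cdot>\<^bsub>S\<^esub> as (K, L \<otimes> N, X)
          \<cdot>\<^bsub>S\<^esub> Far T (assoc V (K, L, N), Id S X)"
    and un_triangle: "\<lbrakk>K \<in> Obj V; X \<in> Obj S\<rbrakk>
      \<Longrightarrow> Far T (Id V K, un X) \<cdot>\<^bsub>S\<^esub> as (K, unit_ob V, X) = Far T (runit V K, Id S X)"

sublocale action \<subseteq> T: bifunctor V S S T
  by unfold_locales (rule T_functor)

context action
begin

lemma as_simps [simp]: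
  assumes "K \<in> Obj V" "L \<in> Obj V" "X \<in> Obj S"
  shows "as (K, L, X) \<in> Arr S" "Dom S (as (K, L, X)) = Fob T (K \<otimes> L, X)"
    "Cod S (as (K, L, X)) = Fob T (K, Fob T (L, X))"
  using S.iso_homD[OF as_iso[OF assms]] by auto

lemma un_simps [simp]:
  assumes "X \<in> Obj S"
  shows "un X \<in> Arr S" "Dom S (un X) = Fob T (unit_ob V, X)" "Cod S (un X) = X"
  using S.iso_homD[OF un_iso[OF assms]] by auto

text \<open>\<open>I \<otimes> -\<close> is faithful, being isomorphic to the identity functor
  through \<open>un\<close>.\<close>

lemma Far_unit_cancel:
  assumes x: "x \<in> hom S X Y" and x': "x' \<in> hom S X Y"
    and eq: "Far T (Id V (unit_ob V), x) = Far T (Id V (unit_ob V), x')"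
  shows "x = x'"
proof (rule S.iso_cancel_right[OF un_iso x x'])
  show "X \<in> Obj S" using x by auto
  show "x \<cdot>\<^bsub>S\<^esub> un X = x' \<cdot>\<^bsub>S\<^esub> un X"
    using un_natural[OF x] un_natural[OF x'] eq by simp
qed

text \<open>Kelly's argument: the two sides agree after applying \<open>I \<otimes> -\<close> and composing with
  isomorphisms.\<close>

lemma un_act:
  assumes K: "K \<in> Obj V" and X: "X \<in> Obj S"
  shows "un (Fob T (K, X)) \<cdot>\<^bsub>S\<^esub> as (unit_ob V, K, X) = Far T (lunit V K, Id S X)"
proof (rule Far_unit_cancel)
  let ?I = "unit_ob V"
  note [simp] = K X
  let ?e = "Far T (assoc V (?I, ?I, K), Id S X)"
  show "un (Fob T (K, X)) \<cdot>\<^bsub>S\<^esub> as (?I, K, X) \<in> hom S (Fob T (?I \<otimes> K, X)) (Fob T (K, X))"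
    and "Far T (lunit V K, Id S X) \<in> hom S (Fob T (?I \<otimes> K, X)) (Fob T (K, X))" by simp_all
  have "assoc V (?I, ?I, K) \<in> iso_hom V ((?I \<otimes> ?I) \<otimes> K) (?I \<otimes> (?I \<otimes> K))"
    by (rule assoc_iso) auto
  note [simp] = inv_arrD[OF this]
  have e: "?e \<in> iso_hom S (Fob T ((?I \<otimes> ?I) \<otimes> K, X)) (Fob T (?I \<otimes> (?I \<otimes> K), X))"
    by (rule S.iso_homI[of _ _ _ "Far T (inv_arr V (assoc V (?I, ?I, K)), Id S X)"]) auto
  have "Far T (Id V ?I, un (Fob T (K, X)) \<cdot>\<^bsub>S\<^esub> as (?I, K, X)) \<cdot>\<^bsub>S\<^esub> as (?I, ?I \<otimes> K, X) \<cdot>\<^bsub>S\<^esub> ?e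
      = Far T (Id V ?I, un (Fob T (K, X))) \<cdot>\<^bsub>S\<^esub>
        (Far T (Id V ?I, as (?I, K, X)) \<cdot>\<^bsub>S\<^esub> as (?I, ?I \<otimes> K, X) \<cdot>\<^bsub>S\<^esub> ?e)"
    using S.category_axioms by simp
  also have "\<dots> = Far T (Id V ?I, un (Fob T (K, X))) \<cdot>\<^bsub>S\<^esub>
      (as (?I, ?I, Fob T (K, X)) \<cdot>\<^bsub>S\<^esub> as (?I \<otimes> ?I, K, X))"
    by (subst as_pentagon) auto
  also have "\<dots> = (Far T (Id V ?I, un (Fob T (K, X))) \<cdot>\<^bsub>S\<^esub> as (?I, ?I, Fob T (K, X)))
      \<cdot>\<^bsub>S\<^esub> as (?I \<otimes> ?I, K, X)"
    by simp
  also have "\<dots> = Far T (runit V ?I, Far T (Id V K, Id S X)) \<cdot>\<^bsub>S\<^esub> as (?I \<otimes> ?I, K, X)"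
    by (subst un_triangle) auto
  also have "\<dots> = as (?I, K, X) \<cdot>\<^bsub>S\<^esub> Far T (runit V ?I \<^bold>\<otimes> Id V K, Id S X)"
    by (rule as_natural[symmetric]) auto
  also have "\<dots> = as (?I, K, X) \<cdot>\<^bsub>S\<^esub> (Far T (Id V ?I \<^bold>\<otimes> lunit V K, Id S X) \<cdot>\<^bsub>S\<^esub> ?e)"
    by (subst triangle[symmetric]) auto
  also have "\<dots> = (as (?I, K, X) \<cdot>\<^bsub>S\<^esub> Far T (Id V ?I \<^bold>\<otimes> lunit V K, Id S X)) \<cdot>\<^bsub>S\<^esub> ?e"
    by (rule S.comp_assoc[symmetric]) auto
  also have "\<dots> = (Far T (Id V ?I, Far T (lunit V K, Id S X)) \<cdot>\<^bsub>S\<^esub> as (?I, ?I \<otimes> K, X)) \<cdot>\<^bsub>S\<^esub> ?e"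
    by (subst as_natural[of _ ?I ?I _ "?I \<otimes> K" K _ X X]) auto
  finally have "Far T (Id V ?I, un (Fob T (K, X)) \<cdot>\<^bsub>S\<^esub> as (?I, K, X)) \<cdot>\<^bsub>S\<^esub> as (?I, ?I \<otimes> K, X)
      = Far T (Id V ?I, Far T (lunit V K, Id S X)) \<cdot>\<^bsub>S\<^esub> as (?I, ?I \<otimes> K, X)"
    by (rule S.iso_cancel_right[OF e, rotated 2]) auto
  then show "Far T (Id V ?I, un (Fob T (K, X)) \<cdot>\<^bsub>S\<^esub> as (?I, K, X))
      = Far T (Id V ?I, Far T (lunit V K, Id S X))"
    by (rule S.iso_cancel_right[OF as_iso, rotated -1]) auto
qed

end

text \<open>Turns \<open>un_act\<close> into the left unit coherence of \<V>:
  \<open>lunit V (K \<otimes> L) \<cdot> assoc V (unit_ob V, K, L)\<close> is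
  \<open>lunit V K\<close> tensored with the identity of \<open>L\<close>.\<close>

sublocale monoidal_category \<subseteq> self: action V V "tensor V" "assoc V" "lunit V"
  by unfold_locales
    (auto simp: tensor_functor assoc_iso lunit_iso pentagon triangle
      intro: assoc_natural lunit_natural)

section \<open>Right unit coherence of a monoidal category\<close>

context monoidal_category
begin

lemma tensor_unit_cancel:
  assumes x: "x \<in> hom V X Y" and x': "x' \<in> hom V X Y"
    and eq: "x \<^bold>\<otimes> Id V (unit_ob V) = x' \<^bold>\<otimes> Id V (unit_ob V)"
  shows "x = x'"
proof (rule iso_cancel_right[OF runit_iso x x'])
  show "X \<in> Obj V" using x by auto
  show "x \<cdot> runit V X = x' \<cdot> runit V X"
    using runit_natural[OF x] runit_natural[OF x'] eq by simp
qed

text \<open>The mirror image of \<open>un_act\<close>, but no instance of it, since actions are from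
  the left. The two sides are compared after applying \<open>- \<otimes> I\<close>, where the
  pentagon at \<open>(K, L, I, I)\<close> and two triangles are available.\<close>

lemma runit_tensor:
  assumes K: "K \<in> Obj V" and L: "L \<in> Obj V"
  shows "(Id V K \<^bold>\<otimes> runit V L) \<cdot> assoc V (K, L, unit_ob V) = runit V (K \<otimes> L)"
proof (rule tensor_unit_cancel)
  let ?I = "unit_ob V"
  note [simp] = K L
  let ?a = "assoc V (K, L, ?I)"
  show "(Id V K \<^bold>\<otimes> runit V L) \<cdot> ?a \<in> hom V ((K \<otimes> L) \<otimes> ?I) (K \<otimes> L)"
    and "runit V (K \<otimes> L) \<in> hom V ((K \<otimes> L) \<otimes> ?I) (K \<otimes> L)" by simp_all
  have "?a \<cdot> (runit V (K \<otimes> L) \<^bold>\<otimes> Id V ?I)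
      = ?a \<cdot> ((Id V (K \<otimes> L) \<^bold>\<otimes> lunit V ?I) \<cdot> assoc V (K \<otimes> L, ?I, ?I))"
    by (subst triangle) auto
  also have "\<dots> = (?a \<cdot> ((Id V K \<^bold>\<otimes> Id V L) \<^bold>\<otimes> lunit V ?I)) \<cdot> assoc V (K \<otimes> L, ?I, ?I)"
    by simp
  also have "\<dots> = ((Id V K \<^bold>\<otimes> (Id V L \<^bold>\<otimes> lunit V ?I)) \<cdot> assoc V (K, L, ?I \<otimes> ?I))
      \<cdot> assoc V (K \<otimes> L, ?I, ?I)"
    by (subst assoc_natural) auto
  also have "\<dots> = (Id V K \<^bold>\<otimes> (Id V L \<^bold>\<otimes> lunit V ?I))
      \<cdot> (assoc V (K, L, ?I \<otimes> ?I) \<cdot> assoc V (K \<otimes> L, ?I, ?I))"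
    by simp
  also have "\<dots> = (Id V K \<^bold>\<otimes> ((Id V L \<^bold>\<otimes> lunit V ?I) \<cdot> assoc V (L, ?I, ?I)))
      \<cdot> assoc V (K, L \<otimes> ?I, ?I) \<cdot> (?a \<^bold>\<otimes> Id V ?I)"
    by (subst pentagon) auto
  also have "\<dots> = ((Id V K \<^bold>\<otimes> (runit V L \<^bold>\<otimes> Id V ?I)) \<cdot> assoc V (K, L \<otimes> ?I, ?I)) \<cdot> (?a \<^bold>\<otimes> Id V ?I)"
    by (subst triangle) auto
  also have "\<dots> = (?a \<cdot> ((Id V K \<^bold>\<otimes> runit V L) \<^bold>\<otimes> Id V ?I)) \<cdot> (?a \<^bold>\<otimes> Id V ?I)"
    by (subst assoc_natural[of _ K K _ "L \<otimes> ?I" L _ ?I ?I]) auto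
  also have "\<dots> = ?a \<cdot> (((Id V K \<^bold>\<otimes> runit V L) \<cdot> ?a) \<^bold>\<otimes> Id V ?I)"
    by simp
  finally have eq: "?a \<cdot> (((Id V K \<^bold>\<otimes> runit V L) \<cdot> ?a) \<^bold>\<otimes> Id V ?I)
      = ?a \<cdot> (runit V (K \<otimes> L) \<^bold>\<otimes> Id V ?I)" ..
  show "((Id V K \<^bold>\<otimes> runit V L) \<cdot> ?a) \<^bold>\<otimes> Id V ?I = runit V (K \<otimes> L) \<^bold>\<otimes> Id V ?I"
    by (rule iso_cancel_left[OF assoc_iso[of K L ?I] _ _ eq]) auto
qed

end

section \<open>Coherence of the symmetry\<close>

context symmetric_monoidal_category
begin

lemma braid_simps [simp]:
  assumes "X \<in> Obj V" "Y \<in> Obj V"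
  shows "braid V (X, Y) \<in> Arr V" "Dom V (braid V (X, Y)) = X \<otimes> Y" "Cod V (braid V (X, Y)) = Y \<otimes> X"
    "braid V (X, Y) \<cdot> braid V (Y, X) = Id V (Y \<otimes> X)"
  using braid_hom[OF assms] braid_braid[OF assms(2,1)] by auto

lemma braid_iso:
  assumes "X \<in> Obj V" "Y \<in> Obj V"
  shows "braid V (X, Y) \<in> iso_hom V (X \<otimes> Y) (Y \<otimes> X)"
  using assms by (intro iso_homI[of _ _ _ "braid V (Y, X)"]) auto

lemma braid_unit': "X \<in> Obj V \<Longrightarrow> runit V X \<cdot> braid V (unit_ob V, X) = lunit V X"
  by (subst braid_unit[symmetric]) auto

text \<open>This and \<open>braid_inv_lunit\<close> exchange the laws \<open>vhom_left\<close> and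
  \<open>vhom_right\<close> on passing to the opposite structure: the braid that comes with the
  opposite composition turns the inverse of \<open>r\<close> into that of \<open>l\<close>, and
  conversely.\<close>

lemma braid_inv_runit: "X \<in> Obj V \<Longrightarrow> braid V (X, unit_ob V) \<cdot> inv_arr V (runit V X) = inv_arr V (lunit V X)"
proof (rule iso_cancel_left[OF lunit_iso])
  assume [simp]: "X \<in> Obj V"
  have "lunit V X \<cdot> braid V (X, unit_ob V) \<cdot> inv_arr V (runit V X) = Id V X"
    by (subst braid_unit) auto
  then show "lunit V X \<cdot> (braid V (X, unit_ob V) \<cdot> inv_arr V (runit V X))
      = lunit V X \<cdot> inv_arr V (lunit V X)" by simp
qed auto

lemma braid_inv_lunit: "X \<in> Obj V \<Longrightarrow> braid V (unit_ob V, X) \<cdot> inv_arr V (lunit V X) = inv_arr V (runit V X)"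
proof (rule iso_cancel_left[OF runit_iso])
  assume [simp]: "X \<in> Obj V"
  have "runit V X \<cdot> braid V (unit_ob V, X) \<cdot> inv_arr V (lunit V X) = Id V X"
    by (subst braid_unit') auto
  then show "runit V X \<cdot> (braid V (unit_ob V, X) \<cdot> inv_arr V (lunit V X))
      = runit V X \<cdot> inv_arr V (runit V X)" by simp
qed auto

text \<open>By naturality of the symmetry this is the second hexagon; \<open>?h\<close> below is part of the first
  hexagon at \<open>(N, L, K)\<close> and inverts it.\<close>

lemma braid_assoc:
  assumes [simp]: "K \<in> Obj V" "L \<in> Obj V" "N \<in> Obj V"
  shows "(Id V N \<^bold>\<otimes> braid V (K, L)) \<cdot> braid V (K \<otimes> L, N)
    = assoc V (N, L, K) \<cdot> (braid V (L, N) \<^bold>\<otimes> Id V K) \<cdot> braid V (K, L \<otimes> N) \<cdot> assoc V (K, L, N)"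
proof -
  let ?p = "assoc V (L, K, N) \<cdot> (braid V (K, L) \<^bold>\<otimes> Id V N)"
  let ?m = "(Id V L \<^bold>\<otimes> braid V (K, N)) \<cdot> ?p"
  have hex: "assoc V (L, N, K) \<cdot> braid V (K, L \<otimes> N) \<cdot> assoc V (K, L, N) = ?m"
    by (subst hexagon) auto
  have hex': "(Id V L \<^bold>\<otimes> braid V (N, K)) \<cdot> assoc V (L, N, K) \<cdot> (braid V (N, L) \<^bold>\<otimes> Id V K)
      = assoc V (L, K, N) \<cdot> braid V (N, L \<otimes> K) \<cdot> assoc V (N, L, K)"
    by (subst hexagon) auto
  let ?lhs = "(Id V N \<^bold>\<otimes> braid V (K, L)) \<cdot> braid V (K \<otimes> L, N)"
  let ?rhs = "assoc V (N, L, K) \<cdot> (braid V (L, N) \<^bold>\<otimes> Id V K) \<cdot> braid V (K, L \<otimes> N) \<cdot> assoc V (K, L, N)"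
  let ?h = "assoc V (L, K, N) \<cdot> braid V (N, L \<otimes> K)"
  have h: "?h \<in> iso_hom V (N \<otimes> (L \<otimes> K)) (L \<otimes> (K \<otimes> N))"
    by (rule iso_comp[OF braid_iso assoc_iso]) auto
  have "?h \<cdot> ?lhs = assoc V (L, K, N) \<cdot> braid V (N, L \<otimes> K) \<cdot> (braid V (L \<otimes> K, N) \<cdot> (braid V (K, L) \<^bold>\<otimes> Id V N))"
    by (subst braid_natural) auto
  also have "\<dots> = assoc V (L, K, N) \<cdot> (braid V (N, L \<otimes> K) \<cdot> braid V (L \<otimes> K, N)) \<cdot> (braid V (K, L) \<^bold>\<otimes> Id V N)"
    by (simp del: braid_simps(4))
  also have "\<dots> = ?p" by simp
  finally have "?h \<cdot> ?lhs = ?p" .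
  moreover have "?h \<cdot> ?rhs = (?h \<cdot> assoc V (N, L, K)) \<cdot> (braid V (L, N) \<^bold>\<otimes> Id V K) \<cdot> braid V (K, L \<otimes> N) \<cdot> assoc V (K, L, N)"
    by simp
  moreover have "\<dots> = ((Id V L \<^bold>\<otimes> braid V (N, K)) \<cdot> assoc V (L, N, K) \<cdot> (braid V (N, L) \<^bold>\<otimes> Id V K))
      \<cdot> (braid V (L, N) \<^bold>\<otimes> Id V K) \<cdot> braid V (K, L \<otimes> N) \<cdot> assoc V (K, L, N)"
    using hex' by simp
  moreover have "\<dots> = (Id V L \<^bold>\<otimes> braid V (N, K)) \<cdot> (assoc V (L, N, K) \<cdot> braid V (K, L \<otimes> N) \<cdot> assoc V (K, L, N))"
    by simp
  moreover have "\<dots> = ?p" unfolding hex by simp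
  ultimately have "?h \<cdot> ?lhs = ?h \<cdot> ?rhs" by (simp only:)
  then show ?thesis
    by (rule iso_cancel_left[OF h, rotated -1]) auto
qed

end

section \<open>Calculus of \<open>\<V>\<close>-structures\<close>

locale v_cat = monoidal_category V + S: category S + v_structure V S A
  for V :: "('o, 'a, 'y) csm_category_scheme" (structure)
    and S :: "('s, 'b) category"
    and A :: "('o, 'a, 's, 'b) v_struct"

sublocale v_cat \<subseteq> vhom: bifunctor "op_cat S" S V "vhom A"
  by unfold_locales (rule vhom_functor)

context v_cat
begin

lemma vcomp_simps [simp]:
  assumes "X \<in> Obj S" "Y \<in> Obj S" "Z \<in> Obj S"
  shows "vcomp A (X, Y, Z) \<in> Arr V" "Dom V (vcomp A (X, Y, Z)) = \<langle>Y, Z\<rangle>\<^bsub>A\<^esub> \<otimes> \<langle>X, Y\<rangle>\<^bsub>A\<^esub>"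
    "Cod V (vcomp A (X, Y, Z)) = \<langle>X, Z\<rangle>\<^bsub>A\<^esub>"
  using PiE_mem[OF vcomp_hom, of "(X, Y, Z)"] assms by auto

lemma vname_simps [simp]:
  assumes "x \<in> Arr S" "Dom S x = X" "Cod S x = Y"
  shows "vname A (X, Y) x \<in> Arr V" "Dom V (vname A (X, Y) x) = unit_ob V"
    "Cod V (vname A (X, Y) x) = \<langle>X, Y\<rangle>\<^bsub>A\<^esub>"
proof -
  have "(X, Y) \<in> Obj S \<times> Obj S" using assms by auto
  from PiE_mem[OF vname_maps this] have "vname A (X, Y) \<in> hom S X Y \<rightarrow>\<^sub>E hom V (unit_ob V) \<langle>X, Y\<rangle>\<^bsub>A\<^esub>"
    by simp
  from PiE_mem[OF this, of x] show "vname A (X, Y) x \<in> Arr V" "Dom V (vname A (X, Y) x) = unit_ob V"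
    "Cod V (vname A (X, Y) x) = \<langle>X, Y\<rangle>\<^bsub>A\<^esub>" using assms by auto
qed

text \<open>The objects are arguments because an arrow into \<open>\<langle>X, Y\<rangle>\<close>
  does not determine \<open>X\<close> and \<open>Y\<close>.\<close>

definition star :: "'s \<Rightarrow> 's \<Rightarrow> 's \<Rightarrow> 'a \<Rightarrow> 'a \<Rightarrow> 'a" where
  "star X Y Z g h = vcomp A (X, Y, Z) \<cdot> (g \<^bold>\<otimes> h)"

lemma star_simps [simp]:
  assumes "X \<in> Obj S" "Y \<in> Obj S" "Z \<in> Obj S" "g \<in> Arr V" "h \<in> Arr V"
    "Cod V g = \<langle>Y, Z\<rangle>\<^bsub>A\<^esub>" "Cod V h = \<langle>X, Y\<rangle>\<^bsub>A\<^esub>"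
  shows "star X Y Z g h \<in> Arr V" "Dom V (star X Y Z g h) = Dom V g \<otimes> Dom V h"
    "Cod V (star X Y Z g h) = \<langle>X, Z\<rangle>\<^bsub>A\<^esub>"
  using assms by (auto simp: star_def)

lemma star_comp:
  assumes "X \<in> Obj S" "Y \<in> Obj S" "Z \<in> Obj S" "g \<in> Arr V" "h \<in> Arr V"
    "Cod V g = \<langle>Y, Z\<rangle>\<^bsub>A\<^esub>" "Cod V h = \<langle>X, Y\<rangle>\<^bsub>A\<^esub>"
    "p \<in> Arr V" "q \<in> Arr V" "Cod V p = Dom V g" "Cod V q = Dom V h"
  shows "star X Y Z g h \<cdot> (p \<^bold>\<otimes> q) = star X Y Z (g \<cdot> p) (h \<cdot> q)"
  using assms by (auto simp: star_def)

lemma star_assoc: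
  assumes "W \<in> Obj S" "X \<in> Obj S" "Y \<in> Obj S" "Z \<in> Obj S" "g \<in> Arr V" "h \<in> Arr V" "k \<in> Arr V"
    "Cod V g = \<langle>Y, Z\<rangle>\<^bsub>A\<^esub>" "Cod V h = \<langle>X, Y\<rangle>\<^bsub>A\<^esub>" "Cod V k = \<langle>W, X\<rangle>\<^bsub>A\<^esub>"
  shows "star W X Z (star X Y Z g h) k
    = star W Y Z g (star W X Y h k) \<cdot> assoc V (Dom V g, Dom V h, Dom V k)"
proof -
  note [simp] = assms
  have "star W X Z (star X Y Z g h) k
      = (vcomp A (W, X, Z) \<cdot> (vcomp A (X, Y, Z) \<^bold>\<otimes> Id V \<langle>W, X\<rangle>\<^bsub>A\<^esub>)) \<cdot> ((g \<^bold>\<otimes> h) \<^bold>\<otimes> k)"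
    by (simp add: star_def)
  also have "\<dots> = (vcomp A (W, Y, Z) \<cdot> (Id V \<langle>Y, Z\<rangle>\<^bsub>A\<^esub> \<^bold>\<otimes> vcomp A (W, X, Y)))
      \<cdot> (assoc V (\<langle>Y, Z\<rangle>\<^bsub>A\<^esub>, \<langle>X, Y\<rangle>\<^bsub>A\<^esub>, \<langle>W, X\<rangle>\<^bsub>A\<^esub>) \<cdot> ((g \<^bold>\<otimes> h) \<^bold>\<otimes> k))"
    by (subst vcomp_assoc) auto
  also have "\<dots> = (vcomp A (W, Y, Z) \<cdot> (Id V \<langle>Y, Z\<rangle>\<^bsub>A\<^esub> \<^bold>\<otimes> vcomp A (W, X, Y)))
      \<cdot> ((g \<^bold>\<otimes> (h \<^bold>\<otimes> k)) \<cdot> assoc V (Dom V g, Dom V h, Dom V k))"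
    by (subst assoc_natural) auto
  also have "\<dots> = star W Y Z g (star W X Y h k) \<cdot> assoc V (Dom V g, Dom V h, Dom V k)"
    by (simp add: star_def)
  finally show ?thesis .
qed

text \<open>\<open>vhom_right\<close> is the case of an identity \<open>h\<close>; naturality of
  \<open>lunit\<close> carries it over to all \<open>h\<close>. With \<open>star_name\<close>, this
  replaces the action of an arrow of \<open>S\<close> by a product with its name, to which
  \<open>star_assoc\<close> applies.\<close>

lemma name_star:
  assumes "X \<in> Obj S" "y \<in> Arr S" "Dom S y = Y" "Cod S y = Z" "h \<in> Arr V" "Cod V h = \<langle>X, Y\<rangle>\<^bsub>A\<^esub>"
  shows "star X Y Z (vname A (Y, Z) y) h = Far (vhom A) (Id S X, y) \<cdot> h \<cdot> lunit V (Dom V h)"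
proof -
  note [simp] = assms(1-2,5-6)
  have [simp]: "Y = Dom S y" "Z = Cod S y" using assms by auto
  have "Far (vhom A) (Id S X, y) \<cdot> h \<cdot> lunit V (Dom V h)
      = Far (vhom A) (Id S X, y) \<cdot> (h \<cdot> lunit V (Dom V h))" by simp
  also have "\<dots> = Far (vhom A) (Id S X, y) \<cdot> (lunit V \<langle>X, Y\<rangle>\<^bsub>A\<^esub> \<cdot> (Id V (unit_ob V) \<^bold>\<otimes> h))"
    by (subst lunit_natural) auto
  also have "\<dots> = vcomp A (X, Y, Z) \<cdot> (vname A (Y, Z) y \<^bold>\<otimes> Id V \<langle>X, Y\<rangle>\<^bsub>A\<^esub>)
      \<cdot> (inv_arr V (lunit V \<langle>X, Y\<rangle>\<^bsub>A\<^esub>) \<cdot> lunit V \<langle>X, Y\<rangle>\<^bsub>A\<^esub>) \<cdot> (Id V (unit_ob V) \<^bold>\<otimes> h)"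
    by (subst vhom_right[of _ _ Y Z]) (auto simp del: inv_unit_simps(5))
  also have "\<dots> = star X Y Z (vname A (Y, Z) y) h"
    by (simp add: star_def)
  finally show ?thesis by simp
qed

lemma star_name:
  assumes "Z \<in> Obj S" "x \<in> Arr S" "Dom S x = X" "Cod S x = Y" "g \<in> Arr V" "Cod V g = \<langle>Y, Z\<rangle>\<^bsub>A\<^esub>"
  shows "star X Y Z g (vname A (X, Y) x) = Far (vhom A) (x, Id S Z) \<cdot> g \<cdot> runit V (Dom V g)"
proof -
  note [simp] = assms(1-2,5-6)
  have [simp]: "X = Dom S x" "Y = Cod S x" using assms by auto
  have "Far (vhom A) (x, Id S Z) \<cdot> g \<cdot> runit V (Dom V g)
      = Far (vhom A) (x, Id S Z) \<cdot> (g \<cdot> runit V (Dom V g))" by simp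
  also have "\<dots> = Far (vhom A) (x, Id S Z) \<cdot> (runit V \<langle>Y, Z\<rangle>\<^bsub>A\<^esub> \<cdot> (g \<^bold>\<otimes> Id V (unit_ob V)))"
    by (subst runit_natural) auto
  also have "\<dots> = vcomp A (X, Y, Z) \<cdot> (Id V \<langle>Y, Z\<rangle>\<^bsub>A\<^esub> \<^bold>\<otimes> vname A (X, Y) x)
      \<cdot> (inv_arr V (runit V \<langle>Y, Z\<rangle>\<^bsub>A\<^esub>) \<cdot> runit V \<langle>Y, Z\<rangle>\<^bsub>A\<^esub>) \<cdot> (g \<^bold>\<otimes> Id V (unit_ob V))"
    by (subst vhom_left[of _ X Y]) (auto simp del: inv_unit_simps(10))
  also have "\<dots> = star X Y Z g (vname A (X, Y) x)"
    by (simp add: star_def)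
  finally show ?thesis by simp
qed

text \<open>Acting by \<open>z\<close> is multiplying by its name, so naturality is associativity of
  \<open>*\<close> for the name, \<open>g\<close> and \<open>h\<close>. The unit isomorphisms on the
  two sides match by the left unit coherence and are cancelled at the end.\<close>

lemma star_left:
  assumes "X \<in> Obj S" "Y \<in> Obj S" "z \<in> Arr S" "Dom S z = Z" "Cod S z = Z'" "g \<in> Arr V" "h \<in> Arr V"
    "Cod V g = \<langle>Y, Z\<rangle>\<^bsub>A\<^esub>" "Cod V h = \<langle>X, Y\<rangle>\<^bsub>A\<^esub>"
  shows "Far (vhom A) (Id S X, z) \<cdot> star X Y Z g h
    = star X Y Z' (Far (vhom A) (Id S Y, z) \<cdot> g) h"
proof -
  note [simp] = assms(1-3,6-7) assms(4,5)[symmetric]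
  have g [simp]: "Cod V g = \<langle>Y, Dom S z\<rangle>\<^bsub>A\<^esub>" and [simp]: "Cod V h = \<langle>X, Y\<rangle>\<^bsub>A\<^esub>" using assms by auto
  let ?K = "Dom V g" and ?L = "Dom V h" and ?I = "unit_ob V"
  let ?n = "vname A (Z, Z') z"
  let ?e = "lunit V ?K \<^bold>\<otimes> Id V ?L"
  have e: "?e \<in> iso_hom V ((?I \<otimes> ?K) \<otimes> ?L) (?K \<otimes> ?L)"
    by (rule iso_homI[of _ _ _ "inv_arr V (lunit V ?K) \<^bold>\<otimes> Id V ?L"]) auto
  have "star X Y Z' (Far (vhom A) (Id S Y, z) \<cdot> g) h \<cdot> ?e
      = star X Y Z' (Far (vhom A) (Id S Y, z) \<cdot> g \<cdot> lunit V ?K) h"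
    by (simp add: star_comp)
  also have "\<dots> = star X Y Z' (star Y Z Z' ?n g) h"
    by (subst name_star[of Y z Z Z']) auto
  also have "\<dots> = star X Z Z' ?n (star X Y Z g h) \<cdot> assoc V (?I, ?K, ?L)"
    by (subst star_assoc) auto
  also have "\<dots> = Far (vhom A) (Id S X, z) \<cdot> star X Y Z g h \<cdot> (lunit V (?K \<otimes> ?L) \<cdot> assoc V (?I, ?K, ?L))"
    by (subst name_star) auto
  also have "\<dots> = (Far (vhom A) (Id S X, z) \<cdot> star X Y Z g h) \<cdot> ?e"
    by (subst self.un_act) auto
  finally show ?thesis
    by (rule iso_cancel_right[OF e, of _ "\<langle>X, Z'\<rangle>\<^bsub>A\<^esub>", symmetric, rotated -1]) auto
qed

text \<open>The argument of \<open>star_left\<close> with the name as last factor; the units match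
  by \<open>runit_tensor\<close>.\<close>

lemma star_right:
  assumes "x \<in> Arr S" "Dom S x = X'" "Cod S x = X" "Y \<in> Obj S" "Z \<in> Obj S" "g \<in> Arr V" "h \<in> Arr V"
    "Cod V g = \<langle>Y, Z\<rangle>\<^bsub>A\<^esub>" "Cod V h = \<langle>X, Y\<rangle>\<^bsub>A\<^esub>"
  shows "Far (vhom A) (x, Id S Z) \<cdot> star X Y Z g h
    = star X' Y Z g (Far (vhom A) (x, Id S Y) \<cdot> h)"
proof -
  note [simp] = assms(1,4-7) assms(2,3)[symmetric]
  have [simp]: "Cod V g = \<langle>Y, Z\<rangle>\<^bsub>A\<^esub>" and [simp]: "Cod V h = \<langle>Cod S x, Y\<rangle>\<^bsub>A\<^esub>" using assms by auto
  let ?K = "Dom V g" and ?L = "Dom V h" and ?I = "unit_ob V"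
  let ?n = "vname A (X', X) x"
  have "(Far (vhom A) (x, Id S Z) \<cdot> star X Y Z g h) \<cdot> runit V (?K \<otimes> ?L)
      = star X' X Z (star X Y Z g h) ?n"
    by (subst star_name) auto
  also have "\<dots> = star X' Y Z g (star X' X Y h ?n) \<cdot> assoc V (?K, ?L, ?I)"
    by (subst star_assoc) auto
  also have "\<dots> = star X' Y Z g ((Far (vhom A) (x, Id S Y) \<cdot> h) \<cdot> runit V ?L) \<cdot> assoc V (?K, ?L, ?I)"
    by (subst star_name) auto
  also have "\<dots> = star X' Y Z g (Far (vhom A) (x, Id S Y) \<cdot> h) \<cdot> ((Id V ?K \<^bold>\<otimes> runit V ?L) \<cdot> assoc V (?K, ?L, ?I))"
    by (subst comp_assoc[symmetric]) (auto simp: star_comp)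
  also have "\<dots> = star X' Y Z g (Far (vhom A) (x, Id S Y) \<cdot> h) \<cdot> runit V (?K \<otimes> ?L)"
    by (subst runit_tensor) auto
  finally show ?thesis
    by (rule iso_cancel_right[OF runit_iso[of "?K \<otimes> ?L"], of _ "\<langle>X', Z\<rangle>\<^bsub>A\<^esub>", rotated -1]) auto
qed

text \<open>Dinaturality in the middle object: the name of \<open>y\<close> stands between
  \<open>g\<close> and \<open>h\<close>, associativity moves it from one to the other, and the units
  match by the triangle. This is the tool for moving arrows of \<open>S\<close> between
  factors.\<close>

lemma star_middle:
  assumes "X \<in> Obj S" "y \<in> Arr S" "Dom S y = Y" "Cod S y = Y'" "Z \<in> Obj S" "g \<in> Arr V" "h \<in> Arr V"
    "Cod V g = \<langle>Y', Z\<rangle>\<^bsub>A\<^esub>" "Cod V h = \<langle>X, Y\<rangle>\<^bsub>A\<^esub>"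
  shows "star X Y Z (Far (vhom A) (y, Id S Z) \<cdot> g) h
    = star X Y' Z g (Far (vhom A) (Id S X, y) \<cdot> h)"
proof -
  note [simp] = assms(1,2,5-7) assms(3,4)[symmetric]
  have [simp]: "Cod V g = \<langle>Cod S y, Z\<rangle>\<^bsub>A\<^esub>" and [simp]: "Cod V h = \<langle>X, Dom S y\<rangle>\<^bsub>A\<^esub>" using assms by auto
  let ?K = "Dom V g" and ?L = "Dom V h" and ?I = "unit_ob V"
  let ?n = "vname A (Y, Y') y"
  let ?e = "runit V ?K \<^bold>\<otimes> Id V ?L"
  have e: "?e \<in> iso_hom V ((?K \<otimes> ?I) \<otimes> ?L) (?K \<otimes> ?L)"
    by (rule iso_homI[of _ _ _ "inv_arr V (runit V ?K) \<^bold>\<otimes> Id V ?L"]) auto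
  have "star X Y Z (Far (vhom A) (y, Id S Z) \<cdot> g) h \<cdot> ?e
      = star X Y Z (Far (vhom A) (y, Id S Z) \<cdot> g \<cdot> runit V ?K) h"
    by (simp add: star_comp)
  also have "\<dots> = star X Y Z (star Y Y' Z g ?n) h"
    by (subst star_name[of Z y Y Y']) auto
  also have "\<dots> = star X Y' Z g (star X Y Y' ?n h) \<cdot> assoc V (?K, ?I, ?L)"
    by (subst star_assoc) auto
  also have "\<dots> = star X Y' Z g ((Far (vhom A) (Id S X, y) \<cdot> h) \<cdot> lunit V ?L) \<cdot> assoc V (?K, ?I, ?L)"
    by (subst name_star) auto
  also have "\<dots> = star X Y' Z g (Far (vhom A) (Id S X, y) \<cdot> h) \<cdot> ((Id V ?K \<^bold>\<otimes> lunit V ?L) \<cdot> assoc V (?K, ?I, ?L))"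
    by (subst comp_assoc[symmetric]) (auto simp: star_comp)
  also have "\<dots> = star X Y' Z g (Far (vhom A) (Id S X, y) \<cdot> h) \<cdot> ?e"
    by (subst triangle) auto
  finally show ?thesis
    by (rule iso_cancel_right[OF e, of _ "\<langle>X, Z\<rangle>\<^bsub>A\<^esub>", rotated -1]) auto
qed

lemma vname_comp:
  assumes "x \<in> Arr S" "y \<in> Arr S" "Dom S y = Cod S x" "Dom S x = X" "Cod S y = Z" "Cod S x = Y"
  shows "Far (vhom A) (Id S X, y) \<cdot> vname A (X, Y) x = vname A (X, Z) (y \<cdot>\<^bsub>S\<^esub> x)"
    "Far (vhom A) (x, Id S Z) \<cdot> vname A (Y, Z) y = vname A (X, Z) (y \<cdot>\<^bsub>S\<^esub> x)"
  using vname_natural[of "Id S X" X X x Y y Z] vname_natural[of x X Y y Z "Id S Z" Z] assms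
  by auto

lemma star_id_right:
  assumes "X \<in> Obj S" "Y \<in> Obj S" "g \<in> Arr V" "Cod V g = \<langle>X, Y\<rangle>\<^bsub>A\<^esub>"
  shows "star X X Y g (vname A (X, X) (Id S X)) = g \<cdot> runit V (Dom V g)"
  using assms star_name[of Y "Id S X" X X g] vhom.bifunctor_Id[of X Y] by simp

end

section \<open>The opposite \<open>\<V>\<close>-structure\<close>

lemma op_v_struct_simps [simp]:
  "\<lbrakk>X \<in> Obj S; Y \<in> Obj S\<rbrakk> \<Longrightarrow> \<langle>X, Y\<rangle>\<^bsub>op_v_struct V S A\<^esub> = \<langle>Y, X\<rangle>\<^bsub>A\<^esub>"
  "\<lbrakk>f \<in> Arr S; g \<in> Arr S\<rbrakk> \<Longrightarrow> Far (vhom (op_v_struct V S A)) (f, g) = Far (vhom A) (g, f)"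
  "\<lbrakk>X \<in> Obj S; Y \<in> Obj S; Z \<in> Obj S\<rbrakk> \<Longrightarrow> vcomp (op_v_struct V S A) (X, Y, Z) =
    vcomp A (Z, Y, X) \<cdot>\<^bsub>V\<^esub> braid V (\<langle>Z, Y\<rangle>\<^bsub>A\<^esub>, \<langle>Y, X\<rangle>\<^bsub>A\<^esub>)"
  "\<lbrakk>X \<in> Obj S; Y \<in> Obj S\<rbrakk> \<Longrightarrow> vname (op_v_struct V S A) (X, Y) = vname A (Y, X)"
  by (simp_all add: op_v_struct_def)

locale symmetric_v_cat = symmetric_monoidal_category V + v_cat V S A
  for V :: "('o, 'a, 'y) csm_category_scheme" (structure)
    and S :: "('s, 'b) category"
    and A :: "('o, 'a, 's, 'b) v_struct"
begin

lemma op_vcomp: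
  assumes "X \<in> Obj S" "Y \<in> Obj S" "Z \<in> Obj S" "g \<in> Arr V" "h \<in> Arr V"
    "Cod V g = \<langle>Z, Y\<rangle>\<^bsub>A\<^esub>" "Cod V h = \<langle>Y, X\<rangle>\<^bsub>A\<^esub>"
  shows "vcomp (op_v_struct V S A) (X, Y, Z) \<cdot> (g \<^bold>\<otimes> h)
    = star Z Y X h g \<cdot> braid V (Dom V g, Dom V h)"
proof -
  note [simp] = assms
  have "vcomp (op_v_struct V S A) (X, Y, Z) \<cdot> (g \<^bold>\<otimes> h)
      = vcomp A (Z, Y, X) \<cdot> (braid V (\<langle>Z, Y\<rangle>\<^bsub>A\<^esub>, \<langle>Y, X\<rangle>\<^bsub>A\<^esub>) \<cdot> (g \<^bold>\<otimes> h))"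
    by simp
  also have "\<dots> = vcomp A (Z, Y, X) \<cdot> ((h \<^bold>\<otimes> g) \<cdot> braid V (Dom V g, Dom V h))"
    by (subst braid_natural) auto
  finally show ?thesis by (simp add: star_def)
qed

text \<open>By \<open>op_vcomp\<close> both sides are the triple product in reversed order,
  precomposed with two ways of reversing \<open>P \<otimes> Q \<otimes> R\<close> by braids.
  \<open>braid_assoc\<close> says that the two ways agree.\<close>

lemma op_vcomp_assoc:
  assumes [simp]: "W \<in> Obj S" "X \<in> Obj S" "Y \<in> Obj S" "Z \<in> Obj S"
  defines "m \<equiv> vcomp (op_v_struct V S A)"
  shows "m (W, X, Z) \<cdot> (m (X, Y, Z) \<^bold>\<otimes> Id V \<langle>X, W\<rangle>\<^bsub>A\<^esub>)
    = m (W, Y, Z) \<cdot> (Id V \<langle>Z, Y\<rangle>\<^bsub>A\<^esub> \<^bold>\<otimes> m (W, X, Y)) \<cdot> assoc V (\<langle>Z, Y\<rangle>\<^bsub>A\<^esub>, \<langle>Y, X\<rangle>\<^bsub>A\<^esub>, \<langle>X, W\<rangle>\<^bsub>A\<^esub>)"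
proof -
  let ?P = "\<langle>Z, Y\<rangle>\<^bsub>A\<^esub>" and ?Q = "\<langle>Y, X\<rangle>\<^bsub>A\<^esub>" and ?R = "\<langle>X, W\<rangle>\<^bsub>A\<^esub>"
  have m: "m (X, Y, Z) = vcomp A (Z, Y, X) \<cdot> braid V (\<langle>Z, Y\<rangle>\<^bsub>A\<^esub>, \<langle>Y, X\<rangle>\<^bsub>A\<^esub>)"
    if "X \<in> Obj S" "Y \<in> Obj S" "Z \<in> Obj S" for X Y Z
    using that by (simp add: m_def)
  let ?t = "star Z X W (Id V ?R) (star Z Y X (Id V ?Q) (Id V ?P))"
  have v: "star X Y Z (Id V \<langle>Y, Z\<rangle>\<^bsub>A\<^esub>) (Id V \<langle>X, Y\<rangle>\<^bsub>A\<^esub>) = vcomp A (X, Y, Z)"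
    if "X \<in> Obj S" "Y \<in> Obj S" "Z \<in> Obj S" for X Y Z
    using that by (simp add: star_def)
  have "m (W, X, Z) \<cdot> (m (X, Y, Z) \<^bold>\<otimes> Id V ?R)
      = star Z X W (Id V ?R) (m (X, Y, Z)) \<cdot> braid V (?P \<otimes> ?Q, ?R)"
    unfolding m_def by (subst op_vcomp) auto
  also have "\<dots> = ?t \<cdot> ((Id V ?R \<^bold>\<otimes> braid V (?P, ?Q)) \<cdot> braid V (?P \<otimes> ?Q, ?R))"
    by (subst comp_assoc[symmetric]) (auto simp: star_comp m v)
  also have "\<dots> = ?t \<cdot> (assoc V (?R, ?Q, ?P) \<cdot> (braid V (?Q, ?R) \<^bold>\<otimes> Id V ?P)
      \<cdot> braid V (?P, ?Q \<otimes> ?R) \<cdot> assoc V (?P, ?Q, ?R))"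
    by (subst braid_assoc) auto
  also have "\<dots> = (?t \<cdot> assoc V (?R, ?Q, ?P)) \<cdot> ((braid V (?Q, ?R) \<^bold>\<otimes> Id V ?P)
      \<cdot> braid V (?P, ?Q \<otimes> ?R) \<cdot> assoc V (?P, ?Q, ?R))"
    by simp
  also have "?t \<cdot> assoc V (?R, ?Q, ?P) = star Z Y W (star Y X W (Id V ?R) (Id V ?Q)) (Id V ?P)"
    by (subst star_assoc) auto
  also have "\<dots> \<cdot> ((braid V (?Q, ?R) \<^bold>\<otimes> Id V ?P) \<cdot> braid V (?P, ?Q \<otimes> ?R) \<cdot> assoc V (?P, ?Q, ?R))
      = (\<dots> \<cdot> (braid V (?Q, ?R) \<^bold>\<otimes> Id V ?P)) \<cdot> braid V (?P, ?Q \<otimes> ?R) \<cdot> assoc V (?P, ?Q, ?R)"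
    by simp
  also have "\<dots> = (star Z Y W (m (W, X, Y)) (Id V ?P) \<cdot> braid V (?P, ?Q \<otimes> ?R)) \<cdot> assoc V (?P, ?Q, ?R)"
    by (subst star_comp) (auto simp: m v)
  also have "\<dots> = (m (W, Y, Z) \<cdot> (Id V ?P \<^bold>\<otimes> m (W, X, Y))) \<cdot> assoc V (?P, ?Q, ?R)"
    unfolding m_def by (subst op_vcomp) auto
  finally show ?thesis .
qed

lemma op_v_structure: "v_structure V (op_cat S) (op_v_struct V S A)"
proof
  have Id: "Far (vhom A) (Id S X, Id S Y) = Id V \<langle>X, Y\<rangle>\<^bsub>A\<^esub>" if "X \<in> Obj S" "Y \<in> Obj S" for X Y
    using vhom.bifunctor_Id[of X Y] that by simp
  show "is_functor (prod_cat (op_cat (op_cat S)) (op_cat S)) V (vhom (op_v_struct V S A))"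
  proof (rule is_functorI)
    show "Fob (vhom (op_v_struct V S A)) \<in> extensional (Obj (op_cat (op_cat S)) \<times> Obj (op_cat S))"
      and "Far (vhom (op_v_struct V S A)) \<in> extensional (Arr (op_cat (op_cat S)) \<times> Arr (op_cat S))"
      by (simp_all add: op_v_struct_def)
  qed (auto simp: Id)
  show "vcomp (op_v_struct V S A) \<in> (\<Pi>\<^sub>E (X, Y, Z)\<in>Obj (op_cat S) \<times> Obj (op_cat S) \<times> Obj (op_cat S).
      hom V (\<langle>Y, Z\<rangle>\<^bsub>op_v_struct V S A\<^esub> \<otimes> \<langle>X, Y\<rangle>\<^bsub>op_v_struct V S A\<^esub>) \<langle>X, Z\<rangle>\<^bsub>op_v_struct V S A\<^esub>)"
  proof (rule PiE_I)
    fix p assume "p \<notin> Obj (op_cat S) \<times> Obj (op_cat S) \<times> Obj (op_cat S)"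
    then show "vcomp (op_v_struct V S A) p = undefined" by (simp add: op_v_struct_def)
  qed auto
  show "vname (op_v_struct V S A) \<in> (\<Pi>\<^sub>E (X, Y)\<in>Obj (op_cat S) \<times> Obj (op_cat S).
      hom (op_cat S) X Y \<rightarrow>\<^sub>E hom V (unit_ob V) \<langle>X, Y\<rangle>\<^bsub>op_v_struct V S A\<^esub>)"
  proof (rule PiE_I)
    fix p assume "p \<in> Obj (op_cat S) \<times> Obj (op_cat S)"
    then obtain X Y where p: "p = (X, Y)" "X \<in> Obj S" "Y \<in> Obj S" by auto
    then show "vname (op_v_struct V S A) p \<in> (case p of (X, Y) \<Rightarrow>
        hom (op_cat S) X Y \<rightarrow>\<^sub>E hom V (unit_ob V) \<langle>X, Y\<rangle>\<^bsub>op_v_struct V S A\<^esub>)"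
      using PiE_mem[OF vname_maps, of "(Y, X)"] by (simp add: hom_op_cat)
  next
    fix p assume "p \<notin> Obj (op_cat S) \<times> Obj (op_cat S)"
    then show "vname (op_v_struct V S A) p = undefined" by (simp add: op_v_struct_def)
  qed
  show "bij_betw (vname (op_v_struct V S A) (X, Y)) (hom (op_cat S) X Y)
      (hom V (unit_ob V) \<langle>X, Y\<rangle>\<^bsub>op_v_struct V S A\<^esub>)"
    if "X \<in> Obj (op_cat S)" "Y \<in> Obj (op_cat S)" for X Y
    using that vname_bij[of Y X] by (simp add: hom_op_cat)
  show "vname (op_v_struct V S A) (X', Y') (y \<cdot>\<^bsub>op_cat S\<^esub> f \<cdot>\<^bsub>op_cat S\<^esub> x)
      = Far (vhom (op_v_struct V S A)) (x, y) \<cdot> vname (op_v_struct V S A) (X, Y) f"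
    if "x \<in> hom (op_cat S) X' X" "f \<in> hom (op_cat S) X Y" "y \<in> hom (op_cat S) Y Y'" for x X' X f Y y Y'
    using that vname_natural[of y Y' Y f X x X'] by auto
  show "vcomp (op_v_struct V S A) (W, X, Z)
        \<cdot> (vcomp (op_v_struct V S A) (X, Y, Z) \<^bold>\<otimes> Id V \<langle>W, X\<rangle>\<^bsub>op_v_struct V S A\<^esub>)
      = vcomp (op_v_struct V S A) (W, Y, Z)
        \<cdot> (Id V \<langle>Y, Z\<rangle>\<^bsub>op_v_struct V S A\<^esub> \<^bold>\<otimes> vcomp (op_v_struct V S A) (W, X, Y))
        \<cdot> assoc V (\<langle>Y, Z\<rangle>\<^bsub>op_v_struct V S A\<^esub>, \<langle>X, Y\<rangle>\<^bsub>op_v_struct V S A\<^esub>, \<langle>W, X\<rangle>\<^bsub>op_v_struct V S A\<^esub>)"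
    if "W \<in> Obj (op_cat S)" "X \<in> Obj (op_cat S)" "Y \<in> Obj (op_cat S)" "Z \<in> Obj (op_cat S)" for W X Y Z
    using that op_vcomp_assoc[of W X Y Z] by (simp only: op_cat_simps op_v_struct_simps(1))
  show "Far (vhom (op_v_struct V S A)) (f, Id (op_cat S) Z)
      = vcomp (op_v_struct V S A) (X, Y, Z)
        \<cdot> (Id V \<langle>Y, Z\<rangle>\<^bsub>op_v_struct V S A\<^esub> \<^bold>\<otimes> vname (op_v_struct V S A) (X, Y) f)
        \<cdot> inv_arr V (runit V \<langle>Y, Z\<rangle>\<^bsub>op_v_struct V S A\<^esub>)"
    if "f \<in> hom (op_cat S) X Y" "Z \<in> Obj (op_cat S)" for f X Y Z
  proof -
    have [simp]: "f \<in> Arr S" "Y = Dom S f" "X = Cod S f" "Z \<in> Obj S" using that by auto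
    show ?thesis
      by (subst op_vcomp)
        (auto simp: vhom_right[of Z f Y X] star_def braid_inv_runit)
  qed
  show "Far (vhom (op_v_struct V S A)) (Id (op_cat S) X, g)
      = vcomp (op_v_struct V S A) (X, Y, Z)
        \<cdot> (vname (op_v_struct V S A) (Y, Z) g \<^bold>\<otimes> Id V \<langle>X, Y\<rangle>\<^bsub>op_v_struct V S A\<^esub>)
        \<cdot> inv_arr V (lunit V \<langle>X, Y\<rangle>\<^bsub>op_v_struct V S A\<^esub>)"
    if "X \<in> Obj (op_cat S)" "g \<in> hom (op_cat S) Y Z" for g X Y Z
  proof -
    have [simp]: "g \<in> Arr S" "Z = Dom S g" "Y = Cod S g" "X \<in> Obj S" using that by auto
    show ?thesis
      by (subst op_vcomp)
        (auto simp: vhom_left[of g Z Y X] star_def braid_inv_lunit)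
  qed
qed

end

section \<open>Tensor-hom adjunctions and their units\<close>

text \<open>A tensor-closed module without associativity and unit isomorphisms. This is the part
  that \<open>cotensor\<close> and \<open>coadj\<close> of a closed module supply on
  \<open>op_cat S\<close>.\<close>

locale tensored = monoidal_category V + S: category S
  for V :: "('o, 'a, 'y) csm_category_scheme" (structure)
    and S :: "('s, 'b) category" +
  fixes T :: "('o \<times> 's, 'a \<times> 'b, 's, 'b) cat_map"
    and H :: "('s \<times> 's, 'b \<times> 'b, 'o, 'a) cat_map"
    and phi :: "'o \<times> 's \<times> 's \<Rightarrow> 'b \<Rightarrow> 'a"
  assumes T_functor: "is_functor (prod_cat V S) S T"
    and H_functor: "is_functor (prod_cat (op_cat S) S) V H"
    and phi_maps: "phi \<in> (\<Pi>\<^sub>E (K, X, Y) \<in> Obj V \<times> Obj S \<times> Obj S.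
      hom S (Fob T (K, X)) Y \<rightarrow>\<^sub>E hom V K (Fob H (X, Y)))"
    and phi_bij: "\<lbrakk>K \<in> Obj V; X \<in> Obj S; Y \<in> Obj S\<rbrakk>
      \<Longrightarrow> bij_betw (phi (K, X, Y)) (hom S (Fob T (K, X)) Y) (hom V K (Fob H (X, Y)))"
    and phi_natural: "\<lbrakk>k \<in> hom V K' K; x \<in> hom S X' X; y \<in> hom S Y Y'; f \<in> hom S (Fob T (K, X)) Y\<rbrakk>
      \<Longrightarrow> phi (K', X', Y') (y \<cdot>\<^bsub>S\<^esub> f \<cdot>\<^bsub>S\<^esub> Far T (k, x)) = Far H (x, y) \<cdot> phi (K, X, Y) f \<cdot> k"

sublocale tensored \<subseteq> T: bifunctor V S S T
  by unfold_locales (rule T_functor)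

sublocale tensored \<subseteq> H: bifunctor "op_cat S" S V H
  by unfold_locales (rule H_functor)

context tensored
begin

lemma H_Id [simp]: "X \<in> Obj S \<Longrightarrow> Y \<in> Obj S \<Longrightarrow> Far H (Id S X, Id S Y) = Id V (Fob H (X, Y))"
  using H.bifunctor_Id[of X Y] by simp

lemma phi_simps [simp]:
  assumes "f \<in> Arr S" "Dom S f = Fob T (K, X)" "Cod S f = Y" "K \<in> Obj V" "X \<in> Obj S"
  shows "phi (K, X, Y) f \<in> Arr V" "Dom V (phi (K, X, Y) f) = K" "Cod V (phi (K, X, Y) f) = Fob H (X, Y)"
proof -
  have "Y \<in> Obj S" using assms by auto
  from phi_bij[OF assms(4,5) this] have "phi (K, X, Y) f \<in> hom V K (Fob H (X, Y))"
    by (rule bij_betw_apply) (use assms in simp)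
  then show "phi (K, X, Y) f \<in> Arr V" "Dom V (phi (K, X, Y) f) = K"
    "Cod V (phi (K, X, Y) f) = Fob H (X, Y)" by auto
qed

lemma phi_inj:
  assumes "K \<in> Obj V" "X \<in> Obj S" "f \<in> hom S (Fob T (K, X)) Y" "f' \<in> hom S (Fob T (K, X)) Y"
    "phi (K, X, Y) f = phi (K, X, Y) f'"
  shows "f = f'"
proof -
  have "Y \<in> Obj S" using assms by auto
  from phi_bij[OF assms(1,2) this] show ?thesis
    using assms by (auto simp: bij_betw_def inj_on_def)
qed

lemma phi_post:
  assumes "f \<in> Arr S" "Dom S f = Fob T (K, X)" "Cod S f = Y" "K \<in> Obj V" "X \<in> Obj S"
    "y \<in> Arr S" "Dom S y = Y" "Cod S y = Z"
  shows "phi (K, X, Z) (y \<cdot>\<^bsub>S\<^esub> f) = Far H (Id S X, y) \<cdot> phi (K, X, Y) f"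
  using phi_natural[of "Id V K" K K "Id S X" X X y Y Z f] assms by auto

lemma phi_pre:
  assumes "f \<in> Arr S" "Dom S f = Fob T (K, X)" "Cod S f = Y"
    "k \<in> Arr V" "Dom V k = K'" "Cod V k = K" "x \<in> Arr S" "Dom S x = X'" "Cod S x = X"
  shows "phi (K', X', Y) (f \<cdot>\<^bsub>S\<^esub> Far T (k, x)) = Far H (x, Id S Y) \<cdot> phi (K, X, Y) f \<cdot> k"
  using phi_natural[of k K' K x X' X "Id S Y" Y Y f] assms by auto

definition eta :: "'o \<Rightarrow> 's \<Rightarrow> 'a" where
  "eta K X = phi (K, X, Fob T (K, X)) (Id S (Fob T (K, X)))"

lemma eta_simps [simp]:
  assumes "K \<in> Obj V" "X \<in> Obj S"
  shows "eta K X \<in> Arr V" "Dom V (eta K X) = K" "Cod V (eta K X) = Fob H (X, Fob T (K, X))"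
  using assms by (auto simp: eta_def)

lemma phi_eta:
  assumes "f \<in> Arr S" "Dom S f = Fob T (K, X)" "Cod S f = Y" "K \<in> Obj V" "X \<in> Obj S"
  shows "phi (K, X, Y) f = Far H (Id S X, f) \<cdot> eta K X"
  using phi_post[of "Id S (Fob T (K, X))" K X "Fob T (K, X)" f Y] assms by (auto simp: eta_def)

lemma phi_Far:
  assumes "k \<in> Arr V" "Dom V k = K" "Cod V k = K'" "x \<in> Arr S" "Dom S x = X" "Cod S x = X'"
  shows "phi (K, X, Fob T (K', X')) (Far T (k, x)) = Far H (x, Id S (Fob T (K', X'))) \<cdot> eta K' X' \<cdot> k"
  using phi_pre[of "Id S (Fob T (K', X'))" K' X' "Fob T (K', X')" k K x X] assms by (auto simp: eta_def)

text \<open>The formula of \<open>adj_counit\<close>, here available from the adjunction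
  alone.\<close>

definition eps :: "'s \<Rightarrow> 's \<Rightarrow> 'b" where
  "eps X Y = inv_into (hom S (Fob T (Fob H (X, Y), X)) Y) (phi (Fob H (X, Y), X, Y)) (Id V (Fob H (X, Y)))"

lemma eps_simps [simp]:
  assumes "X \<in> Obj S" "Y \<in> Obj S"
  shows "eps X Y \<in> Arr S" "Dom S (eps X Y) = Fob T (Fob H (X, Y), X)" "Cod S (eps X Y) = Y"
    "phi (Fob H (X, Y), X, Y) (eps X Y) = Id V (Fob H (X, Y))"
proof -
  have O: "Fob H (X, Y) \<in> Obj V" using assms by auto
  have *: "Id V (Fob H (X, Y)) \<in> phi (Fob H (X, Y), X, Y) ` hom S (Fob T (Fob H (X, Y), X)) Y"
    using phi_bij[OF O assms] O by (simp add: bij_betw_def)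
  from inv_into_into[OF *] f_inv_into_f[OF *]
  show "eps X Y \<in> Arr S" "Dom S (eps X Y) = Fob T (Fob H (X, Y), X)" "Cod S (eps X Y) = Y"
    "phi (Fob H (X, Y), X, Y) (eps X Y) = Id V (Fob H (X, Y))"
    by (auto simp: eps_def)
qed

lemma eps_phi:
  assumes "f \<in> Arr S" "Dom S f = Fob T (K, X)" "Cod S f = Y" "K \<in> Obj V" "X \<in> Obj S"
  shows "eps X Y \<cdot>\<^bsub>S\<^esub> Far T (phi (K, X, Y) f, Id S X) = f"
proof (rule phi_inj[of K X _ Y])
  have [simp]: "Y \<in> Obj S" using assms by auto
  show "phi (K, X, Y) (eps X Y \<cdot>\<^bsub>S\<^esub> Far T (phi (K, X, Y) f, Id S X)) = phi (K, X, Y) f"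
    using assms(1,2,4,5) assms(3)[symmetric] by (subst phi_pre) auto
qed (use assms in auto)

text \<open>By \<open>phi_eta\<close> the units determine \<open>phi\<close>, and then
  \<open>phi_Far\<close> determines the tensor of two arrows. Outside the domains extensionality
  decides.\<close>

lemma tensored_unique:
  assumes T': "tensored V S T' H phi'"
    and ob: "\<And>K X. K \<in> Obj V \<Longrightarrow> X \<in> Obj S \<Longrightarrow> Fob T' (K, X) = Fob T (K, X)"
    and un: "\<And>K X. K \<in> Obj V \<Longrightarrow> X \<in> Obj S
      \<Longrightarrow> phi' (K, X, Fob T (K, X)) (Id S (Fob T (K, X))) = eta K X"
  shows "T' = T" "phi' = phi"
proof -
  interpret T': tensored V S T' H phi' by fact
  have eta [simp]: "T'.eta K X = eta K X" if "K \<in> Obj V" "X \<in> Obj S" for K X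
    using that by (simp add: T'.eta_def un ob)
  show phi: "phi' = phi"
  proof (rule extensionalityI)
    show "phi' \<in> extensional (Obj V \<times> Obj S \<times> Obj S)" "phi \<in> extensional (Obj V \<times> Obj S \<times> Obj S)"
      using phi_maps T'.phi_maps by (auto simp: PiE_def)
    fix p assume "p \<in> Obj V \<times> Obj S \<times> Obj S"
    then obtain K X Y where p: "p = (K, X, Y)" and [simp]: "K \<in> Obj V" "X \<in> Obj S" "Y \<in> Obj S"
      by auto
    show "phi' p = phi p"
    proof (rule extensionalityI)
      show "phi' p \<in> extensional (hom S (Fob T (K, X)) Y)" "phi p \<in> extensional (hom S (Fob T (K, X)) Y)"
        using PiE_mem[OF phi_maps, of p] PiE_mem[OF T'.phi_maps, of p] by (auto simp: p PiE_def ob)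
      fix f assume "f \<in> hom S (Fob T (K, X)) Y"
      then show "phi' p f = phi p f"
        by (auto simp: p phi_eta[of f K X Y] T'.phi_eta[of f K X Y] ob)
    qed
  qed
  have "Far T' = Far T"
  proof (rule extensionalityI)
    show "Far T' \<in> extensional (Arr V \<times> Arr S)" "Far T \<in> extensional (Arr V \<times> Arr S)"
      by (rule T'.T.Far_extensional T.Far_extensional)+
    fix p assume "p \<in> Arr V \<times> Arr S"
    then obtain k x where p: "p = (k, x)" and [simp]: "k \<in> Arr V" "x \<in> Arr S" by auto
    show "Far T' p = Far T p" unfolding p
    proof (rule phi_inj[of "Dom V k" "Dom S x" _ "Fob T (Cod V k, Cod S x)"])
      let ?Y = "Fob T (Cod V k, Cod S x)"
      have "phi' (Dom V k, Dom S x, ?Y) (Far T' (k, x)) = Far H (x, Id S ?Y) \<cdot> eta (Cod V k) (Cod S x) \<cdot> k"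
        using T'.phi_Far[of k "Dom V k" "Cod V k" x "Dom S x" "Cod S x"] by (simp add: ob)
      then show "phi (Dom V k, Dom S x, ?Y) (Far T' (k, x)) = phi (Dom V k, Dom S x, ?Y) (Far T (k, x))"
        using phi_Far[of k "Dom V k" "Cod V k" x "Dom S x" "Cod S x"] phi by simp
    qed (auto simp: ob)
  qed
  moreover have "Fob T' = Fob T"
  proof (rule extensionalityI)
    show "Fob T' \<in> extensional (Obj V \<times> Obj S)" "Fob T \<in> extensional (Obj V \<times> Obj S)"
      by (rule T'.T.Fob_extensional T.Fob_extensional)+
  qed (auto simp: ob)
  ultimately show "T' = T" by simp
qed

end

section \<open>The canonical \<open>\<V>\<close>-structure of a module\<close>

text \<open>By Yoneda, bijectivity for all \<open>L\<close> makes
  \<open>\<langle>W, Y\<rangle>\<close> an internal hom from \<open>K\<close> to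
  \<open>\<langle>X, Y\<rangle>\<close> without reference to a chosen one. The product is spelled
  out because \<open>star\<close> is available only for an \<open>A\<close> already known to be a
  \<V>-structure.\<close>

definition universal ::
    "('o, 'a, 'y) csm_category_scheme \<Rightarrow> ('s, 'b) category \<Rightarrow> ('o, 'a, 's, 'b) v_struct
      \<Rightarrow> 'o \<Rightarrow> 's \<Rightarrow> 's \<Rightarrow> 'a \<Rightarrow> bool" where
  "universal V S A K X W \<alpha> \<longleftrightarrow> W \<in> Obj S \<and> \<alpha> \<in> hom V K \<langle>X, W\<rangle>\<^bsub>A\<^esub> \<and>
    (\<forall>L\<in>Obj V. \<forall>Y\<in>Obj S. bij_betw (\<lambda>g. vcomp A (X, W, Y) \<cdot>\<^bsub>V\<^esub> (g \<^bold>\<otimes>\<^bsub>V\<^esub> \<alpha>))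
      (hom V L \<langle>W, Y\<rangle>\<^bsub>A\<^esub>) (hom V (L \<otimes>\<^bsub>V\<^esub> K) \<langle>X, Y\<rangle>\<^bsub>A\<^esub>))"

locale module_cat = monoidal_category V + S: category S + tensor_closed_module V S M
  for V :: "('o, 'a, 'y) csm_category_scheme" (structure)
    and S :: "('s, 'b) category"
    and M :: "('o, 'a, 's, 'b, 'z) tc_module_scheme"

sublocale module_cat \<subseteq> tensored V S "act M" "shom M" "adj M"
  by unfold_locales (auto simp: act_functor shom_functor adj_maps adj_bij intro: adj_natural)

sublocale module_cat \<subseteq> action: action V S "act M" "act_assoc M" "act_unit M"
proof unfold_locales
  show "act_assoc M (K, L, X) \<in> iso_hom S ((K \<otimes> L) \<odot>\<^bsub>M\<^esub> X) (K \<odot>\<^bsub>M\<^esub> (L \<odot>\<^bsub>M\<^esub> X))"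
    if "K \<in> Obj V" "L \<in> Obj V" "X \<in> Obj S" for K L X
    using PiE_mem[OF act_assoc_iso, of "(K, L, X)"] that by simp
  show "act_unit M X \<in> iso_hom S (unit_ob V \<odot>\<^bsub>M\<^esub> X) X" if "X \<in> Obj S" for X
    using PiE_mem[OF act_unit_iso that] .
qed (fact act_functor act_assoc_natural act_unit_natural act_pentagon act_triangle)+

context module_cat
begin

abbreviation can :: "('o, 'a, 's, 'b) v_struct" where
  "can \<equiv> canonical_v_struct V S M"

lemma vhom_can [simp]: "vhom can = shom M"
  by (simp add: canonical_v_struct_def Let_def)

lemma vcomp_can:
  assumes "X \<in> Obj S" "Y \<in> Obj S" "Z \<in> Obj S"
  shows "vcomp can (X, Y, Z) = adj M (Fob (shom M) (Y, Z) \<otimes> Fob (shom M) (X, Y), X, Z)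
    (eps Y Z \<cdot>\<^bsub>S\<^esub> (Id V (Fob (shom M) (Y, Z)) \<^bold>\<odot>\<^bsub>M\<^esub> eps X Y)
      \<cdot>\<^bsub>S\<^esub> act_assoc M (Fob (shom M) (Y, Z), Fob (shom M) (X, Y), X))"
  using assms by (simp add: canonical_v_struct_def Let_def eps_def adj_counit_def)

lemma vname_can:
  assumes "f \<in> Arr S" "Dom S f = X" "Cod S f = Y"
  shows "vname can (X, Y) f = adj M (unit_ob V, X, Y) (f \<cdot>\<^bsub>S\<^esub> act_unit M X)"
proof -
  have "X \<in> Obj S" "Y \<in> Obj S" using assms by auto
  with assms show ?thesis by (simp add: canonical_v_struct_def Let_def)
qed

text \<open>Naturality of \<open>a\<close> moves the two transposes past it, and there each meets
  its counit (\<open>eps_phi\<close>). As identities on hom objects are transposes of counits, this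
  reduces the laws of a \<V>-structure to computations in \<open>S\<close>.\<close>

lemma vcomp_can_adj:
  assumes "K \<in> Obj V" "L \<in> Obj V" "X \<in> Obj S" "Y \<in> Obj S" "Z \<in> Obj S"
    "f \<in> Arr S" "Dom S f = K \<odot>\<^bsub>M\<^esub> Y" "Cod S f = Z" "h \<in> Arr S" "Dom S h = L \<odot>\<^bsub>M\<^esub> X" "Cod S h = Y"
  shows "vcomp can (X, Y, Z) \<cdot> (adj M (K, Y, Z) f \<^bold>\<otimes> adj M (L, X, Y) h)
    = adj M (K \<otimes> L, X, Z) (f \<cdot>\<^bsub>S\<^esub> (Id V K \<^bold>\<odot>\<^bsub>M\<^esub> h) \<cdot>\<^bsub>S\<^esub> act_assoc M (K, L, X))"
proof -
  note [simp] = assms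
  let ?f = "adj M (K, Y, Z) f" and ?h = "adj M (L, X, Y) h"
  let ?P = "Fob (shom M) (Y, Z)" and ?Q = "Fob (shom M) (X, Y)"
  let ?m = "eps Y Z \<cdot>\<^bsub>S\<^esub> (Id V ?P \<^bold>\<odot>\<^bsub>M\<^esub> eps X Y) \<cdot>\<^bsub>S\<^esub> act_assoc M (?P, ?Q, X)"
  have "vcomp can (X, Y, Z) \<cdot> (?f \<^bold>\<otimes> ?h) = adj M (K \<otimes> L, X, Z) (?m \<cdot>\<^bsub>S\<^esub> ((?f \<^bold>\<otimes> ?h) \<^bold>\<odot>\<^bsub>M\<^esub> Id S X))"
    by (subst phi_pre[of _ "?P \<otimes> ?Q" X]) (auto simp: vcomp_can)
  also have "?m \<cdot>\<^bsub>S\<^esub> ((?f \<^bold>\<otimes> ?h) \<^bold>\<odot>\<^bsub>M\<^esub> Id S X) = eps Y Z \<cdot>\<^bsub>S\<^esub> (Id V ?P \<^bold>\<odot>\<^bsub>M\<^esub> eps X Y)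
      \<cdot>\<^bsub>S\<^esub> (act_assoc M (?P, ?Q, X) \<cdot>\<^bsub>S\<^esub> ((?f \<^bold>\<otimes> ?h) \<^bold>\<odot>\<^bsub>M\<^esub> Id S X))"
    by simp
  also have "\<dots> = eps Y Z \<cdot>\<^bsub>S\<^esub> (Id V ?P \<^bold>\<odot>\<^bsub>M\<^esub> eps X Y)
      \<cdot>\<^bsub>S\<^esub> ((?f \<^bold>\<odot>\<^bsub>M\<^esub> (?h \<^bold>\<odot>\<^bsub>M\<^esub> Id S X)) \<cdot>\<^bsub>S\<^esub> act_assoc M (K, L, X))"
    by (subst act_assoc_natural[of _ K _ _ L _ _ X]) auto
  also have "\<dots> = eps Y Z \<cdot>\<^bsub>S\<^esub> (?f \<^bold>\<odot>\<^bsub>M\<^esub> (eps X Y \<cdot>\<^bsub>S\<^esub> (?h \<^bold>\<odot>\<^bsub>M\<^esub> Id S X))) \<cdot>\<^bsub>S\<^esub> act_assoc M (K, L, X)"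
    using S.category_axioms by simp
  also have "\<dots> = eps Y Z \<cdot>\<^bsub>S\<^esub> (?f \<^bold>\<odot>\<^bsub>M\<^esub> h) \<cdot>\<^bsub>S\<^esub> act_assoc M (K, L, X)"
    by (subst eps_phi[of h L]) auto
  also have "\<dots> = (eps Y Z \<cdot>\<^bsub>S\<^esub> (?f \<^bold>\<odot>\<^bsub>M\<^esub> Id S Y)) \<cdot>\<^bsub>S\<^esub> (Id V K \<^bold>\<odot>\<^bsub>M\<^esub> h) \<cdot>\<^bsub>S\<^esub> act_assoc M (K, L, X)"
    using S.category_axioms by simp
  also have "\<dots> = f \<cdot>\<^bsub>S\<^esub> (Id V K \<^bold>\<odot>\<^bsub>M\<^esub> h) \<cdot>\<^bsub>S\<^esub> act_assoc M (K, L, X)"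
    by (subst eps_phi[of f K]) auto
  finally show ?thesis .
qed

text \<open>With the identities written as transposes of counits, both sides become transposes of
  composites of three counits with associativities, which the module pentagon identifies.\<close>

lemma vcomp_can_assoc:
  assumes [simp]: "W \<in> Obj S" "X \<in> Obj S" "Y \<in> Obj S" "Z \<in> Obj S"
  defines "H \<equiv> \<lambda>X Y. Fob (shom M) (X, Y)"
  shows "vcomp can (W, X, Z) \<cdot> (vcomp can (X, Y, Z) \<^bold>\<otimes> Id V (H W X))
    = vcomp can (W, Y, Z) \<cdot> (Id V (H Y Z) \<^bold>\<otimes> vcomp can (W, X, Y)) \<cdot> assoc V (H Y Z, H X Y, H W X)"
proof -
  let ?P = "H Y Z" and ?Q = "H X Y" and ?R = "H W X"
  let ?a = "act_assoc M"
  let ?n = "eps X Y \<cdot>\<^bsub>S\<^esub> (Id V ?Q \<^bold>\<odot>\<^bsub>M\<^esub> eps W X) \<cdot>\<^bsub>S\<^esub> ?a (?Q, ?R, W)"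
  let ?m = "eps Y Z \<cdot>\<^bsub>S\<^esub> (Id V ?P \<^bold>\<odot>\<^bsub>M\<^esub> eps X Y) \<cdot>\<^bsub>S\<^esub> ?a (?P, ?Q, X)"
  have [simp]: "H X Y \<in> Obj V" if "X \<in> Obj S" "Y \<in> Obj S" for X Y using that by (simp add: H_def)
  note [simp del] = eps_simps
  have e [simp]: "eps X Y \<in> Arr S" "Dom S (eps X Y) = H X Y \<odot>\<^bsub>M\<^esub> X" "Cod S (eps X Y) = Y"
      "adj M (H X Y, X, Y) (eps X Y) = Id V (H X Y)"
    if "X \<in> Obj S" "Y \<in> Obj S" for X Y
    using that by (simp_all add: H_def eps_simps)
  have c: "vcomp can (X, Y, Z) = adj M (H Y Z \<otimes> H X Y, X, Z)
      (eps Y Z \<cdot>\<^bsub>S\<^esub> (Id V (H Y Z) \<^bold>\<odot>\<^bsub>M\<^esub> eps X Y) \<cdot>\<^bsub>S\<^esub> ?a (H Y Z, H X Y, X))"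
    if "X \<in> Obj S" "Y \<in> Obj S" "Z \<in> Obj S" for X Y Z
    using that by (simp add: vcomp_can H_def)
  have "vcomp can (W, X, Z) \<cdot> (vcomp can (X, Y, Z) \<^bold>\<otimes> Id V ?R)
      = vcomp can (W, X, Z) \<cdot> (adj M (?P \<otimes> ?Q, X, Z) ?m \<^bold>\<otimes> adj M (?R, W, X) (eps W X))"
    by (simp add: c)
  also have "\<dots> = adj M ((?P \<otimes> ?Q) \<otimes> ?R, W, Z)
      (?m \<cdot>\<^bsub>S\<^esub> (Id V (?P \<otimes> ?Q) \<^bold>\<odot>\<^bsub>M\<^esub> eps W X) \<cdot>\<^bsub>S\<^esub> ?a (?P \<otimes> ?Q, ?R, W))"
    by (subst vcomp_can_adj) auto
  also have "?m \<cdot>\<^bsub>S\<^esub> (Id V (?P \<otimes> ?Q) \<^bold>\<odot>\<^bsub>M\<^esub> eps W X) \<cdot>\<^bsub>S\<^esub> ?a (?P \<otimes> ?Q, ?R, W)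
      = eps Y Z \<cdot>\<^bsub>S\<^esub> (Id V ?P \<^bold>\<odot>\<^bsub>M\<^esub> eps X Y)
        \<cdot>\<^bsub>S\<^esub> (?a (?P, ?Q, X) \<cdot>\<^bsub>S\<^esub> ((Id V ?P \<^bold>\<otimes> Id V ?Q) \<^bold>\<odot>\<^bsub>M\<^esub> eps W X)) \<cdot>\<^bsub>S\<^esub> ?a (?P \<otimes> ?Q, ?R, W)"
    by simp
  also have "\<dots> = eps Y Z \<cdot>\<^bsub>S\<^esub> (Id V ?P \<^bold>\<odot>\<^bsub>M\<^esub> eps X Y) \<cdot>\<^bsub>S\<^esub> ((Id V ?P \<^bold>\<odot>\<^bsub>M\<^esub> (Id V ?Q \<^bold>\<odot>\<^bsub>M\<^esub> eps W X))
        \<cdot>\<^bsub>S\<^esub> ?a (?P, ?Q, ?R \<odot>\<^bsub>M\<^esub> W)) \<cdot>\<^bsub>S\<^esub> ?a (?P \<otimes> ?Q, ?R, W)"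
    by (subst act_assoc_natural[of _ ?P _ _ ?Q _ _ "?R \<odot>\<^bsub>M\<^esub> W"]) auto
  also have "\<dots> = eps Y Z \<cdot>\<^bsub>S\<^esub> (Id V ?P \<^bold>\<odot>\<^bsub>M\<^esub> eps X Y) \<cdot>\<^bsub>S\<^esub> (Id V ?P \<^bold>\<odot>\<^bsub>M\<^esub> (Id V ?Q \<^bold>\<odot>\<^bsub>M\<^esub> eps W X))
        \<cdot>\<^bsub>S\<^esub> (?a (?P, ?Q, ?R \<odot>\<^bsub>M\<^esub> W) \<cdot>\<^bsub>S\<^esub> ?a (?P \<otimes> ?Q, ?R, W))"
    by (simp del: T.bifunctor_comp_assoc T.bifunctor_comp)
  also have "\<dots> = eps Y Z \<cdot>\<^bsub>S\<^esub> (Id V ?P \<^bold>\<odot>\<^bsub>M\<^esub> eps X Y) \<cdot>\<^bsub>S\<^esub> (Id V ?P \<^bold>\<odot>\<^bsub>M\<^esub> (Id V ?Q \<^bold>\<odot>\<^bsub>M\<^esub> eps W X))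
        \<cdot>\<^bsub>S\<^esub> ((Id V ?P \<^bold>\<odot>\<^bsub>M\<^esub> ?a (?Q, ?R, W)) \<cdot>\<^bsub>S\<^esub> ?a (?P, ?Q \<otimes> ?R, W) \<cdot>\<^bsub>S\<^esub> (assoc V (?P, ?Q, ?R) \<^bold>\<odot>\<^bsub>M\<^esub> Id S W))"
    by (subst act_pentagon) auto
  also have "\<dots> = (eps Y Z \<cdot>\<^bsub>S\<^esub> (Id V ?P \<^bold>\<odot>\<^bsub>M\<^esub> ?n) \<cdot>\<^bsub>S\<^esub> ?a (?P, ?Q \<otimes> ?R, W)) \<cdot>\<^bsub>S\<^esub> (assoc V (?P, ?Q, ?R) \<^bold>\<odot>\<^bsub>M\<^esub> Id S W)"
    using S.category_axioms by simp
  also have "adj M ((?P \<otimes> ?Q) \<otimes> ?R, W, Z) \<dots>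
      = adj M (?P \<otimes> (?Q \<otimes> ?R), W, Z) (eps Y Z \<cdot>\<^bsub>S\<^esub> (Id V ?P \<^bold>\<odot>\<^bsub>M\<^esub> ?n) \<cdot>\<^bsub>S\<^esub> ?a (?P, ?Q \<otimes> ?R, W)) \<cdot> assoc V (?P, ?Q, ?R)"
    by (subst phi_pre) auto
  also have "\<dots> = (vcomp can (W, Y, Z) \<cdot> (adj M (?P, Y, Z) (eps Y Z) \<^bold>\<otimes> adj M (?Q \<otimes> ?R, W, Y) ?n)) \<cdot> assoc V (?P, ?Q, ?R)"
    by (subst vcomp_can_adj) auto
  finally show ?thesis by (simp add: c)
qed

lemma canonical_v_structure: "v_structure V S can"
proof
  show "is_functor (prod_cat (op_cat S) S) V (vhom can)" by (simp add: shom_functor)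
  show "vcomp can \<in> (\<Pi>\<^sub>E (X, Y, Z)\<in>Obj S \<times> Obj S \<times> Obj S.
      hom V (\<langle>Y, Z\<rangle>\<^bsub>can\<^esub> \<otimes> \<langle>X, Y\<rangle>\<^bsub>can\<^esub>) \<langle>X, Z\<rangle>\<^bsub>can\<^esub>)"
  proof (rule PiE_I)
    fix p assume "p \<notin> Obj S \<times> Obj S \<times> Obj S"
    then show "vcomp can p = undefined" by (simp add: canonical_v_struct_def Let_def)
  qed (auto simp: vcomp_can)
  have name: "vname can (X, Y) \<in> extensional (hom S X Y)" if "X \<in> Obj S" "Y \<in> Obj S" for X Y
    using that by (simp add: canonical_v_struct_def Let_def)
  show "vname can \<in> (\<Pi>\<^sub>E (X, Y)\<in>Obj S \<times> Obj S. hom S X Y \<rightarrow>\<^sub>E hom V (unit_ob V) \<langle>X, Y\<rangle>\<^bsub>can\<^esub>)"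
  proof (rule PiE_I)
    fix p assume "p \<in> Obj S \<times> Obj S"
    then obtain X Y where p: "p = (X, Y)" "X \<in> Obj S" "Y \<in> Obj S" by auto
    then show "vname can p \<in> (case p of (X, Y) \<Rightarrow> hom S X Y \<rightarrow>\<^sub>E hom V (unit_ob V) \<langle>X, Y\<rangle>\<^bsub>can\<^esub>)"
      using name[of X Y] by (auto simp: PiE_def vname_can)
  next
    fix p assume "p \<notin> Obj S \<times> Obj S"
    then show "vname can p = undefined" by (simp add: canonical_v_struct_def Let_def)
  qed
  show "bij_betw (vname can (X, Y)) (hom S X Y) (hom V (unit_ob V) \<langle>X, Y\<rangle>\<^bsub>can\<^esub>)"
    if [simp]: "X \<in> Obj S" "Y \<in> Obj S" for X Y
  proof -
    have "bij_betw (adj M (unit_ob V, X, Y) \<circ> (\<lambda>f. f \<cdot>\<^bsub>S\<^esub> act_unit M X)) (hom S X Y)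
        (hom V (unit_ob V) (Fob (shom M) (X, Y)))"
      by (rule bij_betw_trans[OF S.iso_precomp_bij phi_bij]) (auto simp: action.un_iso)
    then show ?thesis
      by (subst bij_betw_cong[where g = "adj M (unit_ob V, X, Y) \<circ> (\<lambda>f. f \<cdot>\<^bsub>S\<^esub> act_unit M X)"])
        (auto simp: vname_can)
  qed
  show "vname can (X', Y') (y \<cdot>\<^bsub>S\<^esub> f \<cdot>\<^bsub>S\<^esub> x) = Far (vhom can) (x, y) \<cdot> vname can (X, Y) f"
    if "x \<in> hom S X' X" "f \<in> hom S X Y" "y \<in> hom S Y Y'" for x X' X f Y y Y'
  proof -
    have [simp]: "x \<in> Arr S" "f \<in> Arr S" "y \<in> Arr S" "X' = Dom S x" "X = Cod S x" "Dom S f = Cod S x"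
      "Y = Cod S f" "Dom S y = Cod S f" "Y' = Cod S y" using that by auto
    have "(y \<cdot>\<^bsub>S\<^esub> f \<cdot>\<^bsub>S\<^esub> x) \<cdot>\<^bsub>S\<^esub> act_unit M X' = y \<cdot>\<^bsub>S\<^esub> f \<cdot>\<^bsub>S\<^esub> (x \<cdot>\<^bsub>S\<^esub> act_unit M X')" by simp
    also have "\<dots> = y \<cdot>\<^bsub>S\<^esub> f \<cdot>\<^bsub>S\<^esub> (act_unit M X \<cdot>\<^bsub>S\<^esub> (Id V (unit_ob V) \<^bold>\<odot>\<^bsub>M\<^esub> x))"
      by (subst act_unit_natural) auto
    also have "\<dots> = y \<cdot>\<^bsub>S\<^esub> (f \<cdot>\<^bsub>S\<^esub> act_unit M X) \<cdot>\<^bsub>S\<^esub> (Id V (unit_ob V) \<^bold>\<odot>\<^bsub>M\<^esub> x)" by simp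
    finally have "vname can (X', Y') (y \<cdot>\<^bsub>S\<^esub> f \<cdot>\<^bsub>S\<^esub> x)
        = adj M (unit_ob V, X', Y') (y \<cdot>\<^bsub>S\<^esub> (f \<cdot>\<^bsub>S\<^esub> act_unit M X) \<cdot>\<^bsub>S\<^esub> (Id V (unit_ob V) \<^bold>\<odot>\<^bsub>M\<^esub> x))"
      by (subst vname_can) auto
    also have "\<dots> = Far (shom M) (x, y) \<cdot> adj M (unit_ob V, X, Y) (f \<cdot>\<^bsub>S\<^esub> act_unit M X) \<cdot> Id V (unit_ob V)"
      by (rule adj_natural) auto
    finally show ?thesis by (simp add: vname_can)
  qed
  show "vcomp can (W, X, Z) \<cdot> (vcomp can (X, Y, Z) \<^bold>\<otimes> Id V \<langle>W, X\<rangle>\<^bsub>can\<^esub>)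
      = vcomp can (W, Y, Z) \<cdot> (Id V \<langle>Y, Z\<rangle>\<^bsub>can\<^esub> \<^bold>\<otimes> vcomp can (W, X, Y))
        \<cdot> assoc V (\<langle>Y, Z\<rangle>\<^bsub>can\<^esub>, \<langle>X, Y\<rangle>\<^bsub>can\<^esub>, \<langle>W, X\<rangle>\<^bsub>can\<^esub>)"
    if "W \<in> Obj S" "X \<in> Obj S" "Y \<in> Obj S" "Z \<in> Obj S" for W X Y Z
    unfolding vhom_can by (rule vcomp_can_assoc) (fact that)+
  show "Far (vhom can) (f, Id S Z) = vcomp can (X, Y, Z) \<cdot> (Id V \<langle>Y, Z\<rangle>\<^bsub>can\<^esub> \<^bold>\<otimes> vname can (X, Y) f)
      \<cdot> inv_arr V (runit V \<langle>Y, Z\<rangle>\<^bsub>can\<^esub>)"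
    if "f \<in> hom S X Y" "Z \<in> Obj S" for f X Y Z
  proof -
    have [simp]: "f \<in> Arr S" "X = Dom S f" "Y = Cod S f" "Z \<in> Obj S" using that by auto
    let ?P = "Fob (shom M) (Y, Z)" and ?I = "unit_ob V"
    \<comment> \<open>The identity is the transpose of a counit, which puts the product into the
      form of \<open>vcomp_can_adj\<close>; the triangle then replaces \<open>a\<close> by
      \<open>r\<close>.\<close>
    have "vcomp can (X, Y, Z) \<cdot> (Id V ?P \<^bold>\<otimes> vname can (X, Y) f)
        = vcomp can (X, Y, Z) \<cdot> (adj M (?P, Y, Z) (eps Y Z) \<^bold>\<otimes> adj M (?I, X, Y) (f \<cdot>\<^bsub>S\<^esub> act_unit M X))"
      by (simp add: vname_can)
    also have "\<dots> = adj M (?P \<otimes> ?I, X, Z)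
        (eps Y Z \<cdot>\<^bsub>S\<^esub> (Id V ?P \<^bold>\<odot>\<^bsub>M\<^esub> (f \<cdot>\<^bsub>S\<^esub> act_unit M X)) \<cdot>\<^bsub>S\<^esub> act_assoc M (?P, ?I, X))"
      by (subst vcomp_can_adj) auto
    also have "eps Y Z \<cdot>\<^bsub>S\<^esub> (Id V ?P \<^bold>\<odot>\<^bsub>M\<^esub> (f \<cdot>\<^bsub>S\<^esub> act_unit M X)) \<cdot>\<^bsub>S\<^esub> act_assoc M (?P, ?I, X)
       = eps Y Z \<cdot>\<^bsub>S\<^esub> (Id V ?P \<^bold>\<odot>\<^bsub>M\<^esub> f) \<cdot>\<^bsub>S\<^esub> ((Id V ?P \<^bold>\<odot>\<^bsub>M\<^esub> act_unit M X) \<cdot>\<^bsub>S\<^esub> act_assoc M (?P, ?I, X))"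
      using S.category_axioms by simp
    also have "\<dots> = eps Y Z \<cdot>\<^bsub>S\<^esub> (Id V ?P \<^bold>\<odot>\<^bsub>M\<^esub> f) \<cdot>\<^bsub>S\<^esub> (runit V ?P \<^bold>\<odot>\<^bsub>M\<^esub> Id S X)"
      by (subst act_triangle) auto
    also have "\<dots> = eps Y Z \<cdot>\<^bsub>S\<^esub> (runit V ?P \<^bold>\<odot>\<^bsub>M\<^esub> f)"
      by simp
    also have "adj M (?P \<otimes> ?I, X, Z) \<dots> = Far (shom M) (f, Id S Z) \<cdot> runit V ?P"
      by (subst phi_pre[of _ ?P Y]) auto
    finally have eq: "vcomp can (X, Y, Z) \<cdot> (Id V ?P \<^bold>\<otimes> vname can (X, Y) f)
        = Far (shom M) (f, Id S Z) \<cdot> runit V ?P" .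
    have "vcomp can (X, Y, Z) \<cdot> (Id V ?P \<^bold>\<otimes> vname can (X, Y) f) \<cdot> inv_arr V (runit V ?P)
        = Far (shom M) (f, Id S Z) \<cdot> runit V ?P \<cdot> inv_arr V (runit V ?P)"
      unfolding eq ..
    then show ?thesis by simp
  qed
  show "Far (vhom can) (Id S X, g) = vcomp can (X, Y, Z) \<cdot> (vname can (Y, Z) g \<^bold>\<otimes> Id V \<langle>X, Y\<rangle>\<^bsub>can\<^esub>)
      \<cdot> inv_arr V (lunit V \<langle>X, Y\<rangle>\<^bsub>can\<^esub>)"
    if "X \<in> Obj S" "g \<in> hom S Y Z" for g X Y Z
  proof -
    have [simp]: "g \<in> Arr S" "Y = Dom S g" "Z = Cod S g" "X \<in> Obj S" using that by auto
    let ?P = "Fob (shom M) (X, Y)" and ?I = "unit_ob V"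
    have "vcomp can (X, Y, Z) \<cdot> (vname can (Y, Z) g \<^bold>\<otimes> Id V ?P)
        = vcomp can (X, Y, Z) \<cdot> (adj M (?I, Y, Z) (g \<cdot>\<^bsub>S\<^esub> act_unit M Y) \<^bold>\<otimes> adj M (?P, X, Y) (eps X Y))"
      by (simp add: vname_can)
    also have "\<dots> = adj M (?I \<otimes> ?P, X, Z)
        ((g \<cdot>\<^bsub>S\<^esub> act_unit M Y) \<cdot>\<^bsub>S\<^esub> (Id V ?I \<^bold>\<odot>\<^bsub>M\<^esub> eps X Y) \<cdot>\<^bsub>S\<^esub> act_assoc M (?I, ?P, X))"
      by (subst vcomp_can_adj) auto
    also have "(g \<cdot>\<^bsub>S\<^esub> act_unit M Y) \<cdot>\<^bsub>S\<^esub> (Id V ?I \<^bold>\<odot>\<^bsub>M\<^esub> eps X Y) \<cdot>\<^bsub>S\<^esub> act_assoc M (?I, ?P, X)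
       = g \<cdot>\<^bsub>S\<^esub> (act_unit M Y \<cdot>\<^bsub>S\<^esub> (Id V ?I \<^bold>\<odot>\<^bsub>M\<^esub> eps X Y)) \<cdot>\<^bsub>S\<^esub> act_assoc M (?I, ?P, X)"
      by simp
    also have "\<dots> = g \<cdot>\<^bsub>S\<^esub> (eps X Y \<cdot>\<^bsub>S\<^esub> act_unit M (?P \<odot>\<^bsub>M\<^esub> X)) \<cdot>\<^bsub>S\<^esub> act_assoc M (?I, ?P, X)"
      by (subst act_unit_natural) auto
    also have "\<dots> = g \<cdot>\<^bsub>S\<^esub> eps X Y \<cdot>\<^bsub>S\<^esub> (act_unit M (?P \<odot>\<^bsub>M\<^esub> X) \<cdot>\<^bsub>S\<^esub> act_assoc M (?I, ?P, X))"
      by simp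
    \<comment> \<open>The module axioms state only the triangle with the unit in the middle; the law
      with the unit on the left is \<open>un_act\<close>.\<close>
    also have "\<dots> = g \<cdot>\<^bsub>S\<^esub> eps X Y \<cdot>\<^bsub>S\<^esub> (lunit V ?P \<^bold>\<odot>\<^bsub>M\<^esub> Id S X)"
      by (subst action.un_act) auto
    also have "adj M (?I \<otimes> ?P, X, Z) \<dots> = Far (shom M) (Id S X, g) \<cdot> adj M (?P, X, Y) (eps X Y) \<cdot> lunit V ?P"
      by (rule adj_natural) auto
    finally have eq: "vcomp can (X, Y, Z) \<cdot> (vname can (Y, Z) g \<^bold>\<otimes> Id V ?P)
        = Far (shom M) (Id S X, g) \<cdot> lunit V ?P" by simp
    have "vcomp can (X, Y, Z) \<cdot> (vname can (Y, Z) g \<^bold>\<otimes> Id V ?P) \<cdot> inv_arr V (lunit V ?P)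
        = Far (shom M) (Id S X, g) \<cdot> lunit V ?P \<cdot> inv_arr V (lunit V ?P)"
      unfolding eq ..
    then show ?thesis by simp
  qed
qed

text \<open>For general \<open>f\<close> this relates universality of the unit to invertibility of
  \<open>a\<close>; for \<open>f\<close> an identity it computes the transpose of
  \<open>a\<close>.\<close>

lemma vcomp_can_eta:
  assumes "K \<in> Obj V" "L \<in> Obj V" "X \<in> Obj S" "Y \<in> Obj S" "f \<in> hom S (K \<odot>\<^bsub>M\<^esub> (L \<odot>\<^bsub>M\<^esub> X)) Y"
  shows "vcomp can (X, L \<odot>\<^bsub>M\<^esub> X, Y) \<cdot> (adj M (K, L \<odot>\<^bsub>M\<^esub> X, Y) f \<^bold>\<otimes> eta L X)
    = adj M (K \<otimes> L, X, Y) (f \<cdot>\<^bsub>S\<^esub> act_assoc M (K, L, X))"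
  unfolding eta_def using assms by (subst vcomp_can_adj) auto

text \<open>By \<open>vcomp_can_eta\<close>, \<open>adj\<close> followed by \<open>- * eta\<close>
  equals precomposition with \<open>a\<close> followed by \<open>adj\<close>. Three of these four
  maps are bijections, hence so is \<open>- * eta\<close>.\<close>

lemma universal_eta:
  assumes [simp]: "K \<in> Obj V" "X \<in> Obj S"
  shows "universal V S can K X (K \<odot>\<^bsub>M\<^esub> X) (eta K X)"
  unfolding universal_def
proof (intro conjI ballI)
  fix L Y assume [simp]: "L \<in> Obj V" "Y \<in> Obj S"
  let ?c = "\<lambda>g. vcomp can (X, K \<odot>\<^bsub>M\<^esub> X, Y) \<cdot> (g \<^bold>\<otimes> eta K X)"
  let ?\<phi> = "adj M (L, K \<odot>\<^bsub>M\<^esub> X, Y)"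
  let ?D = "hom S (L \<odot>\<^bsub>M\<^esub> (K \<odot>\<^bsub>M\<^esub> X)) Y"
  have "bij_betw (adj M (L \<otimes> K, X, Y) \<circ> (\<lambda>f. f \<cdot>\<^bsub>S\<^esub> act_assoc M (L, K, X))) ?D
      (hom V (L \<otimes> K) (Fob (shom M) (X, Y)))"
    by (rule bij_betw_trans[OF S.iso_precomp_bij phi_bij]) (auto simp: action.as_iso)
  then have "bij_betw (?c \<circ> ?\<phi>) ?D (hom V (L \<otimes> K) (Fob (shom M) (X, Y)))"
    by (subst bij_betw_cong[where g = "adj M (L \<otimes> K, X, Y) \<circ> (\<lambda>f. f \<cdot>\<^bsub>S\<^esub> act_assoc M (L, K, X))"])
      (auto simp: vcomp_can_eta)
  moreover have "bij_betw ?\<phi> ?D (hom V L (Fob (shom M) (K \<odot>\<^bsub>M\<^esub> X, Y)))"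
    by (rule phi_bij) auto
  ultimately show "bij_betw ?c (hom V L \<langle>K \<odot>\<^bsub>M\<^esub> X, Y\<rangle>\<^bsub>can\<^esub>) (hom V (L \<otimes> K) \<langle>X, Y\<rangle>\<^bsub>can\<^esub>)"
    using bij_betw_comp_iff by fastforce
qed auto

end

section \<open>Modules from universal arrows\<close>

text \<open>The common ground of modules and cylinders: both give such data, and such data extend in
  exactly one way to a tensor-closed module with canonical structure \<open>A\<close>.\<close>

locale tensored_v_cat = v_cat V S A + tensored V S T "vhom A" phi
  for V :: "('o, 'a, 'y) csm_category_scheme" (structure)
    and S :: "('s, 'b) category"
    and A :: "('o, 'a, 's, 'b) v_struct"
    and T :: "('o \<times> 's, 'a \<times> 'b, 's, 'b) cat_map"
    and phi :: "'o \<times> 's \<times> 's \<Rightarrow> 'b \<Rightarrow> 'a" +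
  assumes eta_universal: "K \<in> Obj V \<Longrightarrow> X \<in> Obj S \<Longrightarrow> universal V S A K X (Fob T (K, X)) (eta K X)"
begin

lemma star_eta_bij:
  assumes "K \<in> Obj V" "X \<in> Obj S" "L \<in> Obj V" "Y \<in> Obj S"
  shows "bij_betw (\<lambda>g. star X (Fob T (K, X)) Y g (eta K X))
    (hom V L \<langle>Fob T (K, X), Y\<rangle>\<^bsub>A\<^esub>) (hom V (L \<otimes> K) \<langle>X, Y\<rangle>\<^bsub>A\<^esub>)"
  using eta_universal[of K X] assms by (simp add: universal_def star_def)

text \<open>There is no choice: in any module with canonical structure \<open>A\<close>,
  \<open>vcomp_can_eta\<close> at an identity prescribes this transpose.\<close>

definition as :: "'o \<times> 'o \<times> 's \<Rightarrow> 'b" where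
  "as = (\<lambda>(K, L, X) \<in> Obj V \<times> Obj V \<times> Obj S. let W = Fob T (L, X); U = Fob T (K, W) in
    inv_into (hom S (Fob T (K \<otimes> L, X)) U) (phi (K \<otimes> L, X, U)) (star X W U (eta K W) (eta L X)))"

definition un :: "'s \<Rightarrow> 'b" where
  "un = (\<lambda>X \<in> Obj S. inv_into (hom S (Fob T (unit_ob V, X)) X) (phi (unit_ob V, X, X))
    (vname A (X, X) (Id S X)))"

lemma as_simps:
  assumes [simp]: "K \<in> Obj V" "L \<in> Obj V" "X \<in> Obj S"
  defines "W \<equiv> Fob T (L, X)"
  defines "U \<equiv> Fob T (K, W)"
  shows "as (K, L, X) \<in> Arr S" "Dom S (as (K, L, X)) = Fob T (K \<otimes> L, X)" "Cod S (as (K, L, X)) = U"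
    "phi (K \<otimes> L, X, U) (as (K, L, X)) = star X W U (eta K W) (eta L X)"
proof -
  have [simp]: "W \<in> Obj S" "U \<in> Obj S" by (simp_all add: W_def U_def)
  have "star X W U (eta K W) (eta L X) \<in> hom V (K \<otimes> L) \<langle>X, U\<rangle>\<^bsub>A\<^esub>"
    by (simp add: W_def U_def)
  moreover have "bij_betw (phi (K \<otimes> L, X, U)) (hom S (Fob T (K \<otimes> L, X)) U) (hom V (K \<otimes> L) \<langle>X, U\<rangle>\<^bsub>A\<^esub>)"
    by (rule phi_bij) auto
  ultimately have *: "star X W U (eta K W) (eta L X) \<in> phi (K \<otimes> L, X, U) ` hom S (Fob T (K \<otimes> L, X)) U"
    by (simp add: bij_betw_def)
  have "as (K, L, X) = inv_into (hom S (Fob T (K \<otimes> L, X)) U) (phi (K \<otimes> L, X, U)) (star X W U (eta K W) (eta L X))"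
    by (simp add: as_def Let_def W_def U_def)
  with inv_into_into[OF *] f_inv_into_f[OF *]
  show "as (K, L, X) \<in> Arr S" "Dom S (as (K, L, X)) = Fob T (K \<otimes> L, X)" "Cod S (as (K, L, X)) = U"
    "phi (K \<otimes> L, X, U) (as (K, L, X)) = star X W U (eta K W) (eta L X)"
    by simp_all
qed

lemmas [simp] = as_simps(1-3)

lemma un_simps:
  assumes [simp]: "X \<in> Obj S"
  shows "un X \<in> Arr S" "Dom S (un X) = Fob T (unit_ob V, X)" "Cod S (un X) = X"
    "phi (unit_ob V, X, X) (un X) = vname A (X, X) (Id S X)"
proof -
  have "vname A (X, X) (Id S X) \<in> hom V (unit_ob V) \<langle>X, X\<rangle>\<^bsub>A\<^esub>" by simp
  moreover have "bij_betw (phi (unit_ob V, X, X)) (hom S (Fob T (unit_ob V, X)) X) (hom V (unit_ob V) \<langle>X, X\<rangle>\<^bsub>A\<^esub>)"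
    by (rule phi_bij) auto
  ultimately have *: "vname A (X, X) (Id S X) \<in> phi (unit_ob V, X, X) ` hom S (Fob T (unit_ob V, X)) X"
    by (simp add: bij_betw_def)
  from inv_into_into[OF *] f_inv_into_f[OF *]
  show "un X \<in> Arr S" "Dom S (un X) = Fob T (unit_ob V, X)" "Cod S (un X) = X"
    "phi (unit_ob V, X, X) (un X) = vname A (X, X) (Id S X)"
    by (simp_all add: un_def)
qed

lemmas [simp] = un_simps(1-3)

text \<open>The case of an identity \<open>f\<close> defines \<open>as\<close>; a general
  \<open>f\<close> acts on the product from outside, and \<open>star_left\<close> lets it act on the
  first factor. Under \<open>phi\<close>, precomposition with \<open>as\<close> thus becomes
  \<open>- * eta\<close>.\<close>

lemma phi_as:
  assumes "K \<in> Obj V" "L \<in> Obj V" "X \<in> Obj S" "f \<in> Arr S" "Dom S f = Fob T (K, Fob T (L, X))" "Cod S f = Y"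
  shows "phi (K \<otimes> L, X, Y) (f \<cdot>\<^bsub>S\<^esub> as (K, L, X))
    = star X (Fob T (L, X)) Y (phi (K, Fob T (L, X), Y) f) (eta L X)"
proof -
  note [simp] = assms(1-5) assms(6)[symmetric]
  show ?thesis
    by (simp add: phi_post[of "as (K, L, X)" "K \<otimes> L" X "Fob T (K, Fob T (L, X))" f] as_simps(4) star_left
        phi_eta[of f K "Fob T (L, X)"])
qed

text \<open>The counterpart of \<open>phi_as\<close> for the unit: under \<open>phi\<close>,
  precomposition with \<open>un\<close> becomes naming.\<close>

lemma phi_un:
  assumes "f \<in> Arr S" "Dom S f = X" "Cod S f = Y"
  shows "phi (unit_ob V, X, Y) (f \<cdot>\<^bsub>S\<^esub> un X) = vname A (X, Y) f"
proof -
  note [simp] = assms(1) assms(2,3)[symmetric]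
  show ?thesis by (simp add: phi_post[of "un (Dom S f)" "unit_ob V" "Dom S f" "Dom S f" f] un_simps(4) vname_comp)
qed

text \<open>In the square of \<open>phi_as\<close> the two instances of \<open>phi\<close> and the
  map \<open>- * eta\<close> are bijections, so precomposition with \<open>as\<close> is one for
  every target \<open>Y\<close>. Yoneda then inverts \<open>as\<close>.\<close>

lemma as_iso:
  assumes [simp]: "K \<in> Obj V" "L \<in> Obj V" "X \<in> Obj S"
  shows "as (K, L, X) \<in> iso_hom S (Fob T (K \<otimes> L, X)) (Fob T (K, Fob T (L, X)))"
proof (rule S.precomp_bij_iso)
  fix Y assume [simp]: "Y \<in> Obj S"
  let ?W = "Fob T (L, X)"
  let ?D = "hom S (Fob T (K, ?W)) Y"
  have "bij_betw ((\<lambda>g. star X ?W Y g (eta L X)) \<circ> phi (K, ?W, Y)) ?D (hom V (K \<otimes> L) \<langle>X, Y\<rangle>\<^bsub>A\<^esub>)"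
    by (rule bij_betw_trans[OF phi_bij star_eta_bij]) auto
  then have "bij_betw (phi (K \<otimes> L, X, Y) \<circ> (\<lambda>f. f \<cdot>\<^bsub>S\<^esub> as (K, L, X))) ?D (hom V (K \<otimes> L) \<langle>X, Y\<rangle>\<^bsub>A\<^esub>)"
    by (subst bij_betw_cong[where g = "(\<lambda>g. star X ?W Y g (eta L X)) \<circ> phi (K, ?W, Y)"])
      (auto simp: phi_as)
  then show "bij_betw (\<lambda>f. f \<cdot>\<^bsub>S\<^esub> as (K, L, X)) ?D (hom S (Fob T (K \<otimes> L, X)) Y)"
    by (subst bij_betw_comp_iff2[OF phi_bij]) auto
qed simp

text \<open>As for \<open>as_iso\<close>, with the naming bijection in place of
  \<open>- * eta\<close>.\<close>

lemma un_iso: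
  assumes [simp]: "X \<in> Obj S"
  shows "un X \<in> iso_hom S (Fob T (unit_ob V, X)) X"
proof (rule S.precomp_bij_iso)
  fix Y assume [simp]: "Y \<in> Obj S"
  have "bij_betw (vname A (X, Y)) (hom S X Y) (hom V (unit_ob V) \<langle>X, Y\<rangle>\<^bsub>A\<^esub>)"
    by (rule vname_bij) auto
  then have "bij_betw (phi (unit_ob V, X, Y) \<circ> (\<lambda>f. f \<cdot>\<^bsub>S\<^esub> un X)) (hom S X Y) (hom V (unit_ob V) \<langle>X, Y\<rangle>\<^bsub>A\<^esub>)"
    by (subst bij_betw_cong[where g = "vname A (X, Y)"]) (auto simp: phi_un)
  then show "bij_betw (\<lambda>f. f \<cdot>\<^bsub>S\<^esub> un X) (hom S X Y) (hom S (Fob T (unit_ob V, X)) Y)"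
    by (subst bij_betw_comp_iff2[OF phi_bij]) auto
qed simp

text \<open>Compared under \<open>phi\<close>: \<open>star_right\<close> brings \<open>x\<close> to
  the second factor, where it joins \<open>l\<close> to form the transpose of
  \<open>Far T (l, x)\<close>; \<open>star_middle\<close> then moves this arrow to the first factor,
  where it joins \<open>k\<close>.\<close>

lemma as_natural:
  assumes "k \<in> hom V K K'" "l \<in> hom V L L'" "x \<in> hom S X X'"
  shows "as (K', L', X') \<cdot>\<^bsub>S\<^esub> Far T (k \<^bold>\<otimes> l, x) = Far T (k, Far T (l, x)) \<cdot>\<^bsub>S\<^esub> as (K, L, X)"
proof -
  have [simp]: "k \<in> Arr V" "l \<in> Arr V" "x \<in> Arr S"
    "K = Dom V k" "K' = Cod V k" "L = Dom V l" "L' = Cod V l" "X = Dom S x" "X' = Cod S x"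
    using assms by auto
  let ?W = "Fob T (L, X)" and ?W' = "Fob T (L', X')"
  let ?U = "Fob T (K', ?W')"
  have "phi (K \<otimes> L, X, ?U) (as (K', L', X') \<cdot>\<^bsub>S\<^esub> Far T (k \<^bold>\<otimes> l, x))
      = (Far (vhom A) (x, Id S ?U) \<cdot> star X' ?W' ?U (eta K' ?W') (eta L' X')) \<cdot> (k \<^bold>\<otimes> l)"
    by (subst phi_pre[of _ "K' \<otimes> L'" X']) (auto simp: as_simps(4))
  also have "\<dots> = star X ?W' ?U (eta K' ?W' \<cdot> k) (Far (vhom A) (x, Id S ?W') \<cdot> eta L' X' \<cdot> l)"
    by (simp add: star_right star_comp)
  also have "\<dots> = star X ?W' ?U (eta K' ?W' \<cdot> k) (phi (L, X, ?W') (Far T (l, x)))"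
    by (subst phi_Far[of l]) auto
  also have "\<dots> = star X ?W' ?U (eta K' ?W' \<cdot> k) (Far (vhom A) (Id S X, Far T (l, x)) \<cdot> eta L X)"
    by (subst phi_eta[of "Far T (l, x)"]) auto
  also have "\<dots> = star X ?W ?U (Far (vhom A) (Far T (l, x), Id S ?U) \<cdot> eta K' ?W' \<cdot> k) (eta L X)"
    by (subst star_middle[of X "Far T (l, x)" ?W ?W', symmetric]) auto
  also have "\<dots> = star X ?W ?U (phi (K, ?W, ?U) (Far T (k, Far T (l, x)))) (eta L X)"
    by (subst phi_Far[of k]) auto
  also have "\<dots> = phi (K \<otimes> L, X, ?U) (Far T (k, Far T (l, x)) \<cdot>\<^bsub>S\<^esub> as (K, L, X))"
    by (subst phi_as) auto
  finally show ?thesis by (rule phi_inj[rotated -1]) auto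
qed

lemma un_natural:
  assumes "x \<in> hom S X X'"
  shows "un X' \<cdot>\<^bsub>S\<^esub> Far T (Id V (unit_ob V), x) = x \<cdot>\<^bsub>S\<^esub> un X"
proof -
  have [simp]: "x \<in> Arr S" "X = Dom S x" "X' = Cod S x" using assms by auto
  have "phi (unit_ob V, X, X') (un X' \<cdot>\<^bsub>S\<^esub> Far T (Id V (unit_ob V), x)) = vname A (X, X') x"
    by (subst phi_pre[of _ "unit_ob V" X']) (auto simp: un_simps(4) vname_comp)
  also have "\<dots> = phi (unit_ob V, X, X') (x \<cdot>\<^bsub>S\<^esub> un X)"
    by (subst phi_un) auto
  finally show ?thesis by (rule phi_inj[rotated -1]) auto
qed

text \<open>Under \<open>phi\<close> the two sides become the two bracketings of the product of
  three units, so the pentagon is \<open>star_assoc\<close>.\<close>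

lemma as_pentagon:
  assumes [simp]: "K \<in> Obj V" "L \<in> Obj V" "N \<in> Obj V" "X \<in> Obj S"
  shows "as (K, L, Fob T (N, X)) \<cdot>\<^bsub>S\<^esub> as (K \<otimes> L, N, X) =
    Far T (Id V K, as (L, N, X)) \<cdot>\<^bsub>S\<^esub> as (K, L \<otimes> N, X) \<cdot>\<^bsub>S\<^esub> Far T (assoc V (K, L, N), Id S X)"
proof -
  let ?X1 = "Fob T (N, X)" and ?X2 = "Fob T (L \<otimes> N, X)"
  let ?Y = "Fob T (L, ?X1)"
  let ?Z = "Fob T (K, ?Y)"
  let ?e = "eta K ?Y" and ?b = "as (L, N, X)"
  have "phi (K \<otimes> (L \<otimes> N), X, ?Z) (Far T (Id V K, ?b) \<cdot>\<^bsub>S\<^esub> as (K, L \<otimes> N, X))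
      = star X ?X2 ?Z (Far (vhom A) (?b, Id S ?Z) \<cdot> ?e) (eta (L \<otimes> N) X)"
    by (simp add: phi_as phi_Far[where K' = K and K = K])
  also have "\<dots> = star X ?Y ?Z ?e (Far (vhom A) (Id S X, ?b) \<cdot> eta (L \<otimes> N) X)"
    by (subst star_middle[of X ?b ?X2 ?Y]) auto
  also have "\<dots> = star X ?Y ?Z ?e (phi (L \<otimes> N, X, ?Y) ?b)"
    by (subst phi_eta[of ?b]) auto
  also have "\<dots> = star X ?Y ?Z ?e (star X ?X1 ?Y (eta L ?X1) (eta N X))"
    by (simp add: as_simps(4))
  finally have eq: "phi (K \<otimes> (L \<otimes> N), X, ?Z) (Far T (Id V K, ?b) \<cdot>\<^bsub>S\<^esub> as (K, L \<otimes> N, X)) = \<dots>" .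
  have "phi ((K \<otimes> L) \<otimes> N, X, ?Z) (as (K, L, ?X1) \<cdot>\<^bsub>S\<^esub> as (K \<otimes> L, N, X))
      = star X ?X1 ?Z (star ?X1 ?Y ?Z ?e (eta L ?X1)) (eta N X)"
    by (simp add: phi_as as_simps(4))
  also have "\<dots> = phi (K \<otimes> (L \<otimes> N), X, ?Z) (Far T (Id V K, ?b) \<cdot>\<^bsub>S\<^esub> as (K, L \<otimes> N, X)) \<cdot> assoc V (K, L, N)"
    unfolding eq by (subst star_assoc) auto
  also have "\<dots> = phi ((K \<otimes> L) \<otimes> N, X, ?Z)
      ((Far T (Id V K, ?b) \<cdot>\<^bsub>S\<^esub> as (K, L \<otimes> N, X)) \<cdot>\<^bsub>S\<^esub> Far T (assoc V (K, L, N), Id S X))"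
    by (subst phi_pre[of _ "K \<otimes> (L \<otimes> N)" X]) auto
  finally show ?thesis by (rule phi_inj[rotated -1]) auto
qed

text \<open>Under \<open>phi\<close>, \<open>un\<close> becomes the name of an identity, which is a
  right unit for \<open>*\<close> up to \<open>r\<close>; both sides transpose to
  \<open>eta K X \<cdot> runit V K\<close>.\<close>

lemma un_triangle:
  assumes [simp]: "K \<in> Obj V" "X \<in> Obj S"
  shows "Far T (Id V K, un X) \<cdot>\<^bsub>S\<^esub> as (K, unit_ob V, X) = Far T (runit V K, Id S X)"
proof -
  let ?I = "unit_ob V"
  let ?X1 = "Fob T (?I, X)" and ?Z = "Fob T (K, X)"
  have "phi (K \<otimes> ?I, X, ?Z) (Far T (Id V K, un X) \<cdot>\<^bsub>S\<^esub> as (K, ?I, X))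
      = star X ?X1 ?Z (Far (vhom A) (un X, Id S ?Z) \<cdot> eta K X) (eta ?I X)"
    by (simp add: phi_as phi_Far[where K' = K and K = K])
  also have "\<dots> = star X X ?Z (eta K X) (Far (vhom A) (Id S X, un X) \<cdot> eta ?I X)"
    by (subst star_middle[of X "un X" ?X1 X]) auto
  also have "\<dots> = star X X ?Z (eta K X) (phi (?I, X, X) (un X))"
    by (subst phi_eta[of "un X"]) auto
  also have "\<dots> = eta K X \<cdot> runit V K"
    by (simp add: un_simps(4) star_id_right)
  also have "\<dots> = phi (K \<otimes> ?I, X, ?Z) (Far T (runit V K, Id S X))"
    by (subst phi_Far[of _ _ K]) auto
  finally show ?thesis by (rule phi_inj[rotated -1]) auto
qed

section \<open>The module and its uniqueness\<close>

definition "module = \<lparr>act = T, act_assoc = as, act_unit = un, shom = vhom A, adj = phi\<rparr>"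

lemma module_simps [simp]:
  "act module = T" "act_assoc module = as" "act_unit module = un" "shom module = vhom A" "adj module = phi"
  by (simp_all add: module_def)

lemma tensor_closed_module: "tensor_closed_module V S module"
proof
  show "act_assoc module \<in> (\<Pi>\<^sub>E (K, L, X)\<in>Obj V \<times> Obj V \<times> Obj S.
      iso_hom S ((K \<otimes> L) \<odot>\<^bsub>module\<^esub> X) (K \<odot>\<^bsub>module\<^esub> (L \<odot>\<^bsub>module\<^esub> X)))"
  proof (rule PiE_I)
    fix p assume "p \<notin> Obj V \<times> Obj V \<times> Obj S"
    then show "act_assoc module p = undefined" by (simp add: as_def)
  qed (auto simp: as_iso)
  show "act_unit module \<in> (\<Pi>\<^sub>E X\<in>Obj S. iso_hom S (unit_ob V \<odot>\<^bsub>module\<^esub> X) X)"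
  proof (rule PiE_I)
    fix p assume "p \<notin> Obj S"
    then show "act_unit module p = undefined" by (simp add: un_def)
  qed (auto simp: un_iso)
qed (unfold module_simps; fact T_functor as_natural un_natural as_pentagon un_triangle
  vhom_functor phi_maps phi_bij phi_natural)+

text \<open>The canonical composition is the transpose of two counits and \<open>as\<close>. By
  \<open>phi_as\<close> and \<open>star_middle\<close> each counit can be brought to its own factor,
  where it transposes to an identity, and what remains is \<open>vcomp A\<close>. For names the
  claim is \<open>phi_un\<close>.\<close>

lemma canonical_module: "canonical_v_struct V S module = A"
proof -
  interpret N: tensor_closed_module V S module by (rule tensor_closed_module)
  interpret N: module_cat V S module ..
  have eta [simp]: "N.eta = eta" by (intro ext) (simp add: N.eta_def eta_def)
  have eps [simp]: "N.eps = eps" by (intro ext) (simp add: N.eps_def eps_def)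
  have "vcomp N.can = vcomp A"
  proof (rule extensionalityI)
    show "vcomp N.can \<in> extensional (Obj S \<times> Obj S \<times> Obj S)"
      by (simp add: canonical_v_struct_def Let_def)
    show "vcomp A \<in> extensional (Obj S \<times> Obj S \<times> Obj S)"
      using vcomp_hom by (auto simp: PiE_def)
    fix p assume "p \<in> Obj S \<times> Obj S \<times> Obj S"
    then obtain X Y Z where p: "p = (X, Y, Z)" and [simp]: "X \<in> Obj S" "Y \<in> Obj S" "Z \<in> Obj S"
      by auto
    let ?P = "\<langle>Y, Z\<rangle>\<^bsub>A\<^esub>" and ?Q = "\<langle>X, Y\<rangle>\<^bsub>A\<^esub>"
    let ?W = "Fob T (?Q, X)"
    have "vcomp N.can p = phi (?P \<otimes> ?Q, X, Z) ((eps Y Z \<cdot>\<^bsub>S\<^esub> Far T (Id V ?P, eps X Y)) \<cdot>\<^bsub>S\<^esub> as (?P, ?Q, X))"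
      by (simp add: p N.vcomp_can)
    also have "\<dots> = star X ?W Z (phi (?P, ?W, Z) (eps Y Z \<cdot>\<^bsub>S\<^esub> Far T (Id V ?P, eps X Y))) (eta ?Q X)"
      by (subst phi_as) auto
    also have "\<dots> = star X ?W Z (Far (vhom A) (eps X Y, Id S Z) \<cdot> Id V ?P) (eta ?Q X)"
      by (subst phi_pre[of _ ?P Y]) auto
    also have "\<dots> = star X Y Z (Id V ?P) (Far (vhom A) (Id S X, eps X Y) \<cdot> eta ?Q X)"
      by (subst star_middle[of X "eps X Y" ?W Y]) auto
    also have "\<dots> = star X Y Z (Id V ?P) (phi (?Q, X, Y) (eps X Y))"
      by (subst phi_eta[of "eps X Y"]) auto
    also have "\<dots> = vcomp A p"
      by (simp add: star_def p)
    finally show "vcomp N.can p = vcomp A p" .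
  qed
  moreover have "vname N.can = vname A"
  proof (rule extensionalityI)
    show "vname N.can \<in> extensional (Obj S \<times> Obj S)"
      by (simp add: canonical_v_struct_def Let_def)
    show "vname A \<in> extensional (Obj S \<times> Obj S)"
      using vname_maps by (auto simp: PiE_def)
    fix p assume "p \<in> Obj S \<times> Obj S"
    then obtain X Y where p: "p = (X, Y)" and [simp]: "X \<in> Obj S" "Y \<in> Obj S"
      by auto
    show "vname N.can p = vname A p"
    proof (rule extensionalityI)
      show "vname N.can p \<in> extensional (hom S X Y)"
        by (simp add: canonical_v_struct_def Let_def p)
      show "vname A p \<in> extensional (hom S X Y)"
        using PiE_mem[OF vname_maps, of p] by (auto simp: p PiE_def)
      fix f assume "f \<in> hom S X Y"
      then show "vname N.can p f = vname A p f"
        by (auto simp: p N.vname_can phi_un)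
    qed
  qed
  ultimately show ?thesis by (simp add: N.vhom_can)
qed

text \<open>In \<open>N\<close> the transpose of \<open>a\<close> is a product of units by
  \<open>vcomp_can_eta\<close>, and that of \<open>l\<close> is the name of an identity by
  \<open>vname_can\<close>. Both depend only on \<open>A\<close>, \<open>T\<close> and
  \<open>phi\<close>, which is injective.\<close>

lemma module_unique:
  assumes N: "tensor_closed_module V S N" and can: "canonical_v_struct V S N = A"
    and act: "act N = T" and adj: "adj N = phi"
  shows "N = module"
proof -
  interpret N: tensor_closed_module V S N by fact
  interpret N: module_cat V S N ..
  have shom: "shom N = vhom A" using N.vhom_can by (simp add: can)
  have eta [simp]: "N.eta = eta" by (intro ext) (simp add: N.eta_def eta_def act adj)
  have "act_assoc N = as"
  proof (rule extensionalityI)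
    show "act_assoc N \<in> extensional (Obj V \<times> Obj V \<times> Obj S)"
      using N.act_assoc_iso by (auto simp: PiE_def)
    show "as \<in> extensional (Obj V \<times> Obj V \<times> Obj S)" by (simp add: as_def)
    fix p assume "p \<in> Obj V \<times> Obj V \<times> Obj S"
    then obtain K L X where p: "p = (K, L, X)" and [simp]: "K \<in> Obj V" "L \<in> Obj V" "X \<in> Obj S"
      by auto
    have [simp]: "act_assoc N (K, L, X) \<in> Arr S" "Dom S (act_assoc N (K, L, X)) = Fob T (K \<otimes> L, X)"
      "Cod S (act_assoc N (K, L, X)) = Fob T (K, Fob T (L, X))"
      using N.action.as_simps[of K L X] by (simp_all add: act)
    let ?W = "Fob T (L, X)"
    let ?U = "Fob T (K, ?W)"
    have "phi (K \<otimes> L, X, ?U) (act_assoc N p) = vcomp A (X, ?W, ?U) \<cdot> (phi (K, ?W, ?U) (Id S ?U) \<^bold>\<otimes> eta L X)"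
      using N.vcomp_can_eta[of K L X ?U "Id S ?U"] by (simp add: can act adj p)
    also have "\<dots> = phi (K \<otimes> L, X, ?U) (as p)"
      by (simp add: p as_simps(4) star_def eta_def)
    finally show "act_assoc N p = as p" unfolding p by (rule phi_inj[rotated -1]) auto
  qed
  moreover have "act_unit N = un"
  proof (rule extensionalityI)
    show "act_unit N \<in> extensional (Obj S)"
      using N.act_unit_iso by (auto simp: PiE_def)
    show "un \<in> extensional (Obj S)" by (simp add: un_def)
    fix X assume [simp]: "X \<in> Obj S"
    have [simp]: "act_unit N X \<in> Arr S" "Dom S (act_unit N X) = Fob T (unit_ob V, X)" "Cod S (act_unit N X) = X"
      using N.action.un_simps[of X] by (simp_all add: act)
    have "phi (unit_ob V, X, X) (act_unit N X) = phi (unit_ob V, X, X) (un X)"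
      using N.vname_can[of "Id S X" X X] by (simp add: can adj un_simps(4))
    then show "act_unit N X = un X" by (rule phi_inj[rotated -1]) auto
  qed
  ultimately show ?thesis by (simp add: module_def act adj shom)
qed

end

section \<open>Adjunctions from universal arrows\<close>

locale universal_v_cat = v_cat V S A
  for V :: "('o, 'a, 'y) csm_category_scheme" (structure)
    and S :: "('s, 'b) category"
    and A :: "('o, 'a, 's, 'b) v_struct" +
  fixes W :: "'o \<times> 's \<Rightarrow> 's" and \<alpha> :: "'o \<times> 's \<Rightarrow> 'a"
  assumes W_extensional: "W \<in> extensional (Obj V \<times> Obj S)"
    and universal: "K \<in> Obj V \<Longrightarrow> X \<in> Obj S \<Longrightarrow> universal V S A K X (W (K, X)) (\<alpha> (K, X))"
begin

lemma universal_simps [simp]: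
  assumes "K \<in> Obj V" "X \<in> Obj S"
  shows "W (K, X) \<in> Obj S" "\<alpha> (K, X) \<in> Arr V" "Dom V (\<alpha> (K, X)) = K" "Cod V (\<alpha> (K, X)) = \<langle>X, W (K, X)\<rangle>\<^bsub>A\<^esub>"
  using universal[OF assms] by (auto simp: universal_def)

text \<open>Forced by \<open>phi_eta\<close> once \<open>\<alpha>\<close> is to be the unit.\<close>

definition phi :: "'o \<times> 's \<times> 's \<Rightarrow> 'b \<Rightarrow> 'a" where
  "phi = (\<lambda>(K, X, Y) \<in> Obj V \<times> Obj S \<times> Obj S. \<lambda>f \<in> hom S (W (K, X)) Y.
    Far (vhom A) (Id S X, f) \<cdot> \<alpha> (K, X))"

lemma phi_apply:
  assumes "K \<in> Obj V" "X \<in> Obj S" "f \<in> Arr S" "Dom S f = W (K, X)" "Cod S f = Y"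
  shows "phi (K, X, Y) f = Far (vhom A) (Id S X, f) \<cdot> \<alpha> (K, X)"
  using assms by (auto simp: phi_def)

lemma vhom_Id [simp]: "X \<in> Obj S \<Longrightarrow> Y \<in> Obj S \<Longrightarrow> Far (vhom A) (Id S X, Id S Y) = Id V \<langle>X, Y\<rangle>\<^bsub>A\<^esub>"
  using vhom.bifunctor_Id[of X Y] by simp

text \<open>Up to \<open>l\<close>, the map \<open>\<phi>\<close> is the naming bijection followed by the universal bijection at
  \<open>L = I\<close>.\<close>

lemma phi_bij:
  assumes [simp]: "K \<in> Obj V" "X \<in> Obj S" "Y \<in> Obj S"
  shows "bij_betw (phi (K, X, Y)) (hom S (W (K, X)) Y) (hom V K \<langle>X, Y\<rangle>\<^bsub>A\<^esub>)"
proof -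
  let ?I = "unit_ob V"
  let ?D = "hom S (W (K, X)) Y" and ?E = "hom V (?I \<otimes> K) \<langle>X, Y\<rangle>\<^bsub>A\<^esub>"
  let ?s = "\<lambda>g. star X (W (K, X)) Y g (\<alpha> (K, X))"
  have s: "bij_betw ?s (hom V ?I \<langle>W (K, X), Y\<rangle>\<^bsub>A\<^esub>) ?E"
    using universal[of K X] by (simp add: universal_def star_def)
  have "bij_betw (?s \<circ> vname A (W (K, X), Y)) ?D ?E"
    by (rule bij_betw_trans[OF vname_bij s]) auto
  then have "bij_betw ((\<lambda>g. g \<cdot> lunit V K) \<circ> phi (K, X, Y)) ?D ?E"
    by (subst bij_betw_cong[where g = "?s \<circ> vname A (W (K, X), Y)"]) (auto simp: name_star phi_apply)
  then show ?thesis
    by (subst bij_betw_comp_iff2[OF iso_precomp_bij[OF lunit_iso]]) (auto simp: phi_apply)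
qed

text \<open>Forced by \<open>phi_Far\<close>: the arrow with the transpose prescribed there.\<close>

definition far :: "'a \<times> 'b \<Rightarrow> 'b" where
  "far = (\<lambda>(k, x) \<in> Arr V \<times> Arr S. let X = Dom S x; Y = W (Cod V k, Cod S x) in
    inv_into (hom S (W (Dom V k, X)) Y) (phi (Dom V k, X, Y))
      (Far (vhom A) (x, Id S Y) \<cdot> \<alpha> (Cod V k, Cod S x) \<cdot> k))"

lemma far_simps:
  assumes [simp]: "k \<in> Arr V" "x \<in> Arr S"
  shows "far (k, x) \<in> Arr S" "Dom S (far (k, x)) = W (Dom V k, Dom S x)"
    "Cod S (far (k, x)) = W (Cod V k, Cod S x)"
    "phi (Dom V k, Dom S x, W (Cod V k, Cod S x)) (far (k, x))
      = Far (vhom A) (x, Id S (W (Cod V k, Cod S x))) \<cdot> \<alpha> (Cod V k, Cod S x) \<cdot> k"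
proof -
  let ?Y = "W (Cod V k, Cod S x)"
  let ?g = "Far (vhom A) (x, Id S ?Y) \<cdot> \<alpha> (Cod V k, Cod S x) \<cdot> k"
  have "bij_betw (phi (Dom V k, Dom S x, ?Y)) (hom S (W (Dom V k, Dom S x)) ?Y) (hom V (Dom V k) \<langle>Dom S x, ?Y\<rangle>\<^bsub>A\<^esub>)"
    by (rule phi_bij) auto
  then have *: "?g \<in> phi (Dom V k, Dom S x, ?Y) ` hom S (W (Dom V k, Dom S x)) ?Y"
    by (simp add: bij_betw_def)
  from inv_into_into[OF *] f_inv_into_f[OF *]
  show "far (k, x) \<in> Arr S" "Dom S (far (k, x)) = W (Dom V k, Dom S x)"
    "Cod S (far (k, x)) = W (Cod V k, Cod S x)"
    "phi (Dom V k, Dom S x, W (Cod V k, Cod S x)) (far (k, x))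
      = Far (vhom A) (x, Id S (W (Cod V k, Cod S x))) \<cdot> \<alpha> (Cod V k, Cod S x) \<cdot> k"
    by (simp_all add: far_def Let_def)
qed

lemmas [simp] = far_simps(1-3)

lemma phi_inj:
  assumes "K \<in> Obj V" "X \<in> Obj S" "f \<in> hom S (W (K, X)) Y" "f' \<in> hom S (W (K, X)) Y"
    "phi (K, X, Y) f = phi (K, X, Y) f'"
  shows "f = f'"
proof -
  have "Y \<in> Obj S" using assms by auto
  from phi_bij[OF assms(1,2) this] show ?thesis
    using assms by (auto simp: bij_betw_def inj_on_def)
qed

text \<open>Naturality of \<open>phi\<close> in all variables, obtained before \<open>far\<close> is
  known to be functorial: functoriality is read off from the case where \<open>f\<close> is itself a
  value of \<open>far\<close>.\<close>

lemma phi_post_far: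
  assumes k: "k \<in> hom V K' K" and x: "x \<in> hom S X' X" and y: "y \<in> hom S Y Y'" and f: "f \<in> hom S (W (K, X)) Y"
  shows "phi (K', X', Y') (y \<cdot>\<^bsub>S\<^esub> f \<cdot>\<^bsub>S\<^esub> far (k, x)) = Far (vhom A) (x, y) \<cdot> phi (K, X, Y) f \<cdot> k"
proof -
  have [simp]: "k \<in> Arr V" "K' = Dom V k" "K = Cod V k" "x \<in> Arr S" "X' = Dom S x" "X = Cod S x"
    "y \<in> Arr S" "Y = Dom S y" "Y' = Cod S y" "f \<in> Arr S" "Dom S f = W (Cod V k, Cod S x)" "Cod S f = Dom S y"
    using k x y f by auto
  let ?U = "W (K, X)"
  have "phi (K', X', Y') (y \<cdot>\<^bsub>S\<^esub> f \<cdot>\<^bsub>S\<^esub> far (k, x))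
      = Far (vhom A) (Id S X', y \<cdot>\<^bsub>S\<^esub> f) \<cdot> (Far (vhom A) (Id S X', far (k, x)) \<cdot> \<alpha> (K', X'))"
    using category_axioms by (subst phi_apply) auto
  also have "\<dots> = Far (vhom A) (Id S X', y \<cdot>\<^bsub>S\<^esub> f) \<cdot> (Far (vhom A) (x, Id S ?U) \<cdot> \<alpha> (K, X) \<cdot> k)"
    using far_simps(4)[of k x] by (simp add: phi_apply)
  also have "\<dots> = Far (vhom A) (x, y) \<cdot> (Far (vhom A) (Id S X, f) \<cdot> \<alpha> (K, X)) \<cdot> k"
    using category_axioms by simp
  finally show ?thesis by (simp add: phi_apply)
qed

definition "ten = \<lparr>Fob = W, Far = far\<rparr>"

lemma ten_simps [simp]: "Fob ten = W" "Far ten = far"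
  by (simp_all add: ten_def)

lemma tensored: "tensored V S ten (vhom A) phi"
proof
  show "is_functor (prod_cat V S) S ten"
  proof (rule is_functorI)
    show "Fob ten \<in> extensional (Obj V \<times> Obj S)" by (simp add: W_extensional)
    show "Far ten \<in> extensional (Arr V \<times> Arr S)" by (simp add: far_def)
    fix K X assume [simp]: "K \<in> Obj V" "X \<in> Obj S"
    have "phi (K, X, W (K, X)) (far (Id V K, Id S X)) = phi (K, X, W (K, X)) (Id S (W (K, X)))"
      using far_simps(4)[of "Id V K" "Id S X"] by (simp add: phi_apply)
    then have "far (Id V K, Id S X) = Id S (W (K, X))"
      by (rule phi_inj[rotated -1]) auto
    then show "Far ten (Id V K, Id S X) = Id S (Fob ten (K, X))" by simp
  next
    fix k k' x x' assume [simp]: "k \<in> Arr V" "k' \<in> Arr V" "Cod V k = Dom V k'"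
      "x \<in> Arr S" "x' \<in> Arr S" "Cod S x = Dom S x'"
    let ?Y = "W (Cod V k', Cod S x')"
    have "phi (Dom V k, Dom S x, ?Y) (Id S ?Y \<cdot>\<^bsub>S\<^esub> far (k', x') \<cdot>\<^bsub>S\<^esub> far (k, x))
        = Far (vhom A) (x, Id S ?Y) \<cdot> phi (Dom V k', Dom S x', ?Y) (far (k', x')) \<cdot> k"
      by (rule phi_post_far) auto
    also have "\<dots> = phi (Dom V k, Dom S x, ?Y) (far (k' \<cdot> k, x' \<cdot>\<^bsub>S\<^esub> x))"
      using far_simps(4)[of "k' \<cdot> k" "x' \<cdot>\<^bsub>S\<^esub> x"] category_axioms by (simp add: far_simps(4))
    finally have "far (k', x') \<cdot>\<^bsub>S\<^esub> far (k, x) = far (k' \<cdot> k, x' \<cdot>\<^bsub>S\<^esub> x)"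
      by (intro phi_inj[of "Dom V k" "Dom S x" _ ?Y]) auto
    then show "Far ten (k' \<cdot> k, x' \<cdot>\<^bsub>S\<^esub> x) = Far ten (k', x') \<cdot>\<^bsub>S\<^esub> Far ten (k, x)" by simp
  qed auto
  show "phi \<in> (\<Pi>\<^sub>E (K, X, Y)\<in>Obj V \<times> Obj S \<times> Obj S. hom S (Fob ten (K, X)) Y \<rightarrow>\<^sub>E hom V K \<langle>X, Y\<rangle>\<^bsub>A\<^esub>)"
  proof (rule PiE_I)
    fix p assume "p \<in> Obj V \<times> Obj S \<times> Obj S"
    then obtain K X Y where p: "p = (K, X, Y)" "K \<in> Obj V" "X \<in> Obj S" "Y \<in> Obj S" by auto
    then have "phi p \<in> extensional (hom S (W (K, X)) Y)" by (simp add: phi_def)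
    moreover have "phi p \<in> hom S (W (K, X)) Y \<rightarrow> hom V K \<langle>X, Y\<rangle>\<^bsub>A\<^esub>"
      unfolding p(1) by (rule bij_betw_imp_funcset[OF phi_bij]) (use p in auto)
    ultimately show "phi p \<in> (case p of (K, X, Y) \<Rightarrow> hom S (Fob ten (K, X)) Y \<rightarrow>\<^sub>E hom V K \<langle>X, Y\<rangle>\<^bsub>A\<^esub>)"
      by (simp add: PiE_def p)
  next
    fix p assume "p \<notin> Obj V \<times> Obj S \<times> Obj S"
    then show "phi p = undefined" by (auto simp: phi_def)
  qed
  show "is_functor (prod_cat (op_cat S) S) V (vhom A)" by (rule vhom_functor)
qed (unfold ten_simps, rule phi_bij, assumption+, rule phi_post_far)

lemma tensored_v_cat: "tensored_v_cat V S A ten phi"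
proof -
  interpret ten: tensored V S ten "vhom A" phi by (rule tensored)
  have "ten.eta K X = \<alpha> (K, X)" if "K \<in> Obj V" "X \<in> Obj S" for K X
    using that by (simp add: ten.eta_def phi_apply)
  then show ?thesis
    by unfold_locales (simp add: universal)
qed

end

section \<open>Cylinders and universal arrows\<close>

context closed_symmetric_monoidal_category
begin

lemma ihom_ob [simp]: "K \<in> Obj V \<Longrightarrow> Z \<in> Obj V \<Longrightarrow> Fob (ihom V K) Z \<in> Obj V"
  using ihom_functor[of K] by (auto simp: is_functor_def PiE_def Pi_def)

lemma ihom_counit_simps [simp]:
  assumes [simp]: "K \<in> Obj V" "Z \<in> Obj V"
  shows "ihom_counit V K Z \<in> Arr V" "Dom V (ihom_counit V K Z) = Fob (ihom V K) Z \<otimes> K"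
    "Cod V (ihom_counit V K Z) = Z"
    "transp V (Fob (ihom V K) Z, K, Z) (ihom_counit V K Z) = Id V (Fob (ihom V K) Z)"
proof -
  let ?E = "Fob (ihom V K) Z"
  have "bij_betw (transp V (?E, K, Z)) (hom V (?E \<otimes> K) Z) (hom V ?E ?E)"
    by (rule transp_bij) auto
  then have *: "Id V ?E \<in> transp V (?E, K, Z) ` hom V (?E \<otimes> K) Z"
    by (simp add: bij_betw_def)
  from inv_into_into[OF *] f_inv_into_f[OF *]
  show "ihom_counit V K Z \<in> Arr V" "Dom V (ihom_counit V K Z) = Fob (ihom V K) Z \<otimes> K"
    "Cod V (ihom_counit V K Z) = Z"
    "transp V (Fob (ihom V K) Z, K, Z) (ihom_counit V K Z) = Id V (Fob (ihom V K) Z)"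
    by (simp_all add: ihom_counit_def)
qed

text \<open>Naturality of \<open>transp\<close> shows that \<open>transp\<close> after this map is
  the identity; since \<open>transp\<close> is bijective, so is the map.\<close>

lemma ihom_counit_bij:
  assumes [simp]: "K \<in> Obj V" "L \<in> Obj V" "Z \<in> Obj V"
  shows "bij_betw (\<lambda>g. ihom_counit V K Z \<cdot> (g \<^bold>\<otimes> Id V K))
    (hom V L (Fob (ihom V K) Z)) (hom V (L \<otimes> K) Z)"
proof -
  let ?E = "Fob (ihom V K) Z"
  have "transp V (L, K, Z) (ihom_counit V K Z \<cdot> (g \<^bold>\<otimes> Id V K)) = g" if "g \<in> hom V L ?E" for g
  proof -
    have "Far (ihom V K) (Id V Z) = Id V ?E"
      using ihom_functor[of K] by (simp add: is_functor_def)
    then show ?thesis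
      using transp_natural[of g L ?E K "Id V Z" Z Z "ihom_counit V K Z"] that by auto
  qed
  then have "bij_betw (transp V (L, K, Z) \<circ> (\<lambda>g. ihom_counit V K Z \<cdot> (g \<^bold>\<otimes> Id V K)))
      (hom V L ?E) (hom V L ?E)"
    by (subst bij_betw_cong[where g = id]) auto
  then show ?thesis
    by (subst bij_betw_comp_iff2[OF transp_bij]) auto
qed

end

locale closed_v_cat = closed_symmetric_monoidal_category V + symmetric_v_cat V S A
  for V :: "('o, 'a, 'y) csm_category_scheme" (structure)
    and S :: "('s, 'b) category"
    and A :: "('o, 'a, 's, 'b) v_struct"
begin

lemma cylinder_simps:
  assumes P: "cylinder V S A P" and [simp]: "K \<in> Obj V" "X \<in> Obj S"
  shows "cyl_ob P (K, X) \<in> Obj S"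
    "cyl_unit P (K, X) \<in> Arr V" "Dom V (cyl_unit P (K, X)) = K"
    "Cod V (cyl_unit P (K, X)) = \<langle>X, cyl_ob P (K, X)\<rangle>\<^bsub>A\<^esub>"
    "Y \<in> Obj S \<Longrightarrow> cyl_iso P (K, X, Y) \<in> iso_hom V \<langle>cyl_ob P (K, X), Y\<rangle>\<^bsub>A\<^esub> (Fob (ihom V K) \<langle>X, Y\<rangle>\<^bsub>A\<^esub>)"
proof -
  interpret P: cylinder V S A P by fact
  show "cyl_ob P (K, X) \<in> Obj S" using PiE_mem[OF P.cyl_ob, of "(K, X)"] by simp
  show "cyl_unit P (K, X) \<in> Arr V" "Dom V (cyl_unit P (K, X)) = K"
    "Cod V (cyl_unit P (K, X)) = \<langle>X, cyl_ob P (K, X)\<rangle>\<^bsub>A\<^esub>"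
    using PiE_mem[OF P.cyl_unit, of "(K, X)"] by simp_all
  show "cyl_iso P (K, X, Y) \<in> iso_hom V \<langle>cyl_ob P (K, X), Y\<rangle>\<^bsub>A\<^esub> (Fob (ihom V K) \<langle>X, Y\<rangle>\<^bsub>A\<^esub>)"
    if "Y \<in> Obj S"
    using PiE_mem[OF P.cyl_iso, of "(K, X, Y)"] that by simp
qed

text \<open>Precomposing \<open>cyl_eq\<close> with \<open>g\<close> in the first factor exhibits
  \<open>g * \<alpha>\<close> as the image of \<open>g\<close> under postcomposition with
  \<open>cyl_iso\<close> followed by the counit bijection.\<close>

lemma cylinder_universal:
  assumes P: "cylinder V S A P" and [simp]: "K \<in> Obj V" "X \<in> Obj S"
  shows "universal V S A K X (cyl_ob P (K, X)) (cyl_unit P (K, X))"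
  unfolding universal_def
proof (intro conjI ballI)
  note [simp] = cylinder_simps(1-4)[OF P assms(2,3)]
  let ?W = "cyl_ob P (K, X)"
  show "?W \<in> Obj S" "cyl_unit P (K, X) \<in> hom V K \<langle>X, ?W\<rangle>\<^bsub>A\<^esub>" by simp_all
  fix L Y assume [simp]: "L \<in> Obj V" "Y \<in> Obj S"
  let ?i = "cyl_iso P (K, X, Y)" and ?e = "ihom_counit V K \<langle>X, Y\<rangle>\<^bsub>A\<^esub>"
  have i: "?i \<in> iso_hom V \<langle>?W, Y\<rangle>\<^bsub>A\<^esub> (Fob (ihom V K) \<langle>X, Y\<rangle>\<^bsub>A\<^esub>)"
    using cylinder_simps(5)[OF P] by simp
  note [simp] = iso_homD[OF i]
  have "?e \<cdot> ((?i \<cdot> g) \<^bold>\<otimes> Id V K) = vcomp A (X, ?W, Y) \<cdot> (g \<^bold>\<otimes> cyl_unit P (K, X))"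
    if "g \<in> hom V L \<langle>?W, Y\<rangle>\<^bsub>A\<^esub>" for g
  proof -
    have "?e \<cdot> ((?i \<cdot> g) \<^bold>\<otimes> Id V K) = (?e \<cdot> (?i \<^bold>\<otimes> Id V K)) \<cdot> (g \<^bold>\<otimes> Id V K)"
      using that by simp
    also have "\<dots> = (vcomp A (X, ?W, Y) \<cdot> (Id V \<langle>?W, Y\<rangle>\<^bsub>A\<^esub> \<^bold>\<otimes> cyl_unit P (K, X))) \<cdot> (g \<^bold>\<otimes> Id V K)"
      by (subst cylinder.cyl_eq[OF P]) auto
    finally show ?thesis using that by simp
  qed
  moreover have "bij_betw ((\<lambda>g. ?e \<cdot> (g \<^bold>\<otimes> Id V K)) \<circ> (\<lambda>g. ?i \<cdot> g))
      (hom V L \<langle>?W, Y\<rangle>\<^bsub>A\<^esub>) (hom V (L \<otimes> K) \<langle>X, Y\<rangle>\<^bsub>A\<^esub>)"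
    by (rule bij_betw_trans[OF iso_postcomp_bij[OF i] ihom_counit_bij]) auto
  ultimately show "bij_betw (\<lambda>g. vcomp A (X, ?W, Y) \<cdot> (g \<^bold>\<otimes> cyl_unit P (K, X)))
      (hom V L \<langle>?W, Y\<rangle>\<^bsub>A\<^esub>) (hom V (L \<otimes> K) \<langle>X, Y\<rangle>\<^bsub>A\<^esub>)"
    by (subst bij_betw_cong[where g = "(\<lambda>g. ?e \<cdot> (g \<^bold>\<otimes> Id V K)) \<circ> (\<lambda>g. ?i \<cdot> g)"]) auto
qed

text \<open>\<open>cyl_eq\<close> prescribes the image of \<open>cyl_iso\<close> under the injective
  map of \<open>ihom_counit_bij\<close>, so objects and units determine everything.\<close>

lemma cylinder_unique:
  assumes P: "cylinder V S A P" and Q: "cylinder V S A Q"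
    and ob: "\<And>K X. K \<in> Obj V \<Longrightarrow> X \<in> Obj S \<Longrightarrow> cyl_ob P (K, X) = cyl_ob Q (K, X)"
    and unit: "\<And>K X. K \<in> Obj V \<Longrightarrow> X \<in> Obj S \<Longrightarrow> cyl_unit P (K, X) = cyl_unit Q (K, X)"
  shows "P = Q"
proof -
  interpret P: cylinder V S A P by fact
  interpret Q: cylinder V S A Q by fact
  have "cyl_ob P = cyl_ob Q"
    using P.cyl_ob Q.cyl_ob by (intro extensionalityI[of _ "Obj V \<times> Obj S"]) (auto simp: PiE_def ob)
  moreover have "cyl_unit P = cyl_unit Q"
    using P.cyl_unit Q.cyl_unit by (intro extensionalityI[of _ "Obj V \<times> Obj S"]) (auto simp: PiE_def unit)
  moreover have "cyl_iso P = cyl_iso Q"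
  proof (rule extensionalityI)
    show "cyl_iso P \<in> extensional (Obj V \<times> Obj S \<times> Obj S)" "cyl_iso Q \<in> extensional (Obj V \<times> Obj S \<times> Obj S)"
      using P.cyl_iso Q.cyl_iso by (auto simp: PiE_def)
    fix p assume "p \<in> Obj V \<times> Obj S \<times> Obj S"
    then obtain K X Y where p: "p = (K, X, Y)" and [simp]: "K \<in> Obj V" "X \<in> Obj S" "Y \<in> Obj S" by auto
    let ?W = "cyl_ob Q (K, X)"
    have [simp]: "?W \<in> Obj S" using cylinder_simps(1)[OF Q] by simp
    have "inj_on (\<lambda>g. ihom_counit V K \<langle>X, Y\<rangle>\<^bsub>A\<^esub> \<cdot> (g \<^bold>\<otimes> Id V K))
        (hom V \<langle>?W, Y\<rangle>\<^bsub>A\<^esub> (Fob (ihom V K) \<langle>X, Y\<rangle>\<^bsub>A\<^esub>))"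
      by (rule bij_betw_imp_inj_on[OF ihom_counit_bij]) auto
    moreover have "cyl_iso P p \<in> hom V \<langle>?W, Y\<rangle>\<^bsub>A\<^esub> (Fob (ihom V K) \<langle>X, Y\<rangle>\<^bsub>A\<^esub>)"
      "cyl_iso Q p \<in> hom V \<langle>?W, Y\<rangle>\<^bsub>A\<^esub> (Fob (ihom V K) \<langle>X, Y\<rangle>\<^bsub>A\<^esub>)"
      using iso_homD[OF cylinder_simps(5)[OF P, of K X Y]] iso_homD[OF cylinder_simps(5)[OF Q, of K X Y]]
      by (simp_all add: p ob)
    moreover have "ihom_counit V K \<langle>X, Y\<rangle>\<^bsub>A\<^esub> \<cdot> (cyl_iso P p \<^bold>\<otimes> Id V K)
        = ihom_counit V K \<langle>X, Y\<rangle>\<^bsub>A\<^esub> \<cdot> (cyl_iso Q p \<^bold>\<otimes> Id V K)"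
      using P.cyl_eq[of K X Y] Q.cyl_eq[of K X Y] by (simp add: p ob unit)
    ultimately show "cyl_iso P p = cyl_iso Q p" unfolding inj_on_def by blast
  qed
  ultimately show ?thesis by simp
qed

text \<open>\<open>cyl_eq\<close> can be solved for \<open>i\<close> because the counit map is
  surjective. Postcomposition with \<open>i\<close> followed by the counit map is then
  \<open>- * \<alpha>\<close>; both this and the counit map are bijective, so \<open>i\<close> is
  invertible by Yoneda.\<close>

lemma cylinder_exists:
  assumes W_ext: "W \<in> extensional (Obj V \<times> Obj S)"
    and univ: "\<And>K X. K \<in> Obj V \<Longrightarrow> X \<in> Obj S \<Longrightarrow> universal V S A K X (W (K, X)) (\<alpha> K X)"
  obtains P where "cylinder V S A P" "cyl_ob P = W"
    "\<And>K X. K \<in> Obj V \<Longrightarrow> X \<in> Obj S \<Longrightarrow> cyl_unit P (K, X) = \<alpha> K X"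
proof -
  have [simp]: "W (K, X) \<in> Obj S" "\<alpha> K X \<in> Arr V" "Dom V (\<alpha> K X) = K" "Cod V (\<alpha> K X) = \<langle>X, W (K, X)\<rangle>\<^bsub>A\<^esub>"
    if "K \<in> Obj V" "X \<in> Obj S" for K X
    using univ[OF that] by (auto simp: universal_def)
  let ?c = "\<lambda>K X Y g. ihom_counit V K \<langle>X, Y\<rangle>\<^bsub>A\<^esub> \<cdot> (g \<^bold>\<otimes> Id V K)"
  let ?r = "\<lambda>K X Y. vcomp A (X, W (K, X), Y) \<cdot> (Id V \<langle>W (K, X), Y\<rangle>\<^bsub>A\<^esub> \<^bold>\<otimes> \<alpha> K X)"
  have "\<exists>i \<in> iso_hom V \<langle>W (K, X), Y\<rangle>\<^bsub>A\<^esub> (Fob (ihom V K) \<langle>X, Y\<rangle>\<^bsub>A\<^esub>). ?c K X Y i = ?r K X Y"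
    if [simp]: "K \<in> Obj V" "X \<in> Obj S" "Y \<in> Obj S" for K X Y
  proof -
    let ?P = "\<langle>W (K, X), Y\<rangle>\<^bsub>A\<^esub>" and ?E = "Fob (ihom V K) \<langle>X, Y\<rangle>\<^bsub>A\<^esub>"
    have c: "bij_betw (?c K X Y) (hom V L ?E) (hom V (L \<otimes> K) \<langle>X, Y\<rangle>\<^bsub>A\<^esub>)" if "L \<in> Obj V" for L
      using that by (intro ihom_counit_bij) auto
    from c[of ?P] have "?r K X Y \<in> ?c K X Y ` hom V ?P ?E" by (simp add: bij_betw_def)
    then obtain i where i: "i \<in> hom V ?P ?E" and ci: "?c K X Y i = ?r K X Y" by auto
    have "i \<in> iso_hom V ?P ?E"
    proof (rule postcomp_bij_iso[OF i])
      fix L assume [simp]: "L \<in> Obj V"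
      have "?c K X Y (i \<cdot> g) = vcomp A (X, W (K, X), Y) \<cdot> (g \<^bold>\<otimes> \<alpha> K X)" if "g \<in> hom V L ?P" for g
      proof -
        have "?c K X Y (i \<cdot> g) = ?c K X Y i \<cdot> (g \<^bold>\<otimes> Id V K)" using that i by simp
        also have "\<dots> = ?r K X Y \<cdot> (g \<^bold>\<otimes> Id V K)" unfolding ci ..
        finally show ?thesis using that by simp
      qed
      moreover have "bij_betw (\<lambda>g. vcomp A (X, W (K, X), Y) \<cdot> (g \<^bold>\<otimes> \<alpha> K X)) (hom V L ?P) (hom V (L \<otimes> K) \<langle>X, Y\<rangle>\<^bsub>A\<^esub>)"
        using univ[of K X] by (simp add: universal_def)
      ultimately have "bij_betw (?c K X Y \<circ> (\<lambda>g. i \<cdot> g)) (hom V L ?P) (hom V (L \<otimes> K) \<langle>X, Y\<rangle>\<^bsub>A\<^esub>)"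
        by (subst bij_betw_cong[where g = "\<lambda>g. vcomp A (X, W (K, X), Y) \<cdot> (g \<^bold>\<otimes> \<alpha> K X)"]) auto
      then show "bij_betw (\<lambda>g. i \<cdot> g) (hom V L ?P) (hom V L ?E)"
        using i by (subst bij_betw_comp_iff2[OF c]) auto
    qed
    with ci show ?thesis by blast
  qed
  then obtain i where i: "\<And>K X Y. K \<in> Obj V \<Longrightarrow> X \<in> Obj S \<Longrightarrow> Y \<in> Obj S \<Longrightarrow>
      i K X Y \<in> iso_hom V \<langle>W (K, X), Y\<rangle>\<^bsub>A\<^esub> (Fob (ihom V K) \<langle>X, Y\<rangle>\<^bsub>A\<^esub>) \<and> ?c K X Y (i K X Y) = ?r K X Y"
    by metis
  let ?P = "\<lparr>cyl_ob = W, cyl_unit = (\<lambda>(K, X) \<in> Obj V \<times> Obj S. \<alpha> K X),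
    cyl_iso = (\<lambda>(K, X, Y) \<in> Obj V \<times> Obj S \<times> Obj S. i K X Y)\<rparr>"
  have "cylinder V S A ?P"
  proof
    show "cyl_ob ?P \<in> Obj V \<times> Obj S \<rightarrow>\<^sub>E Obj S"
      using W_ext by (auto simp: PiE_def)
  qed (auto simp: i)
  then show thesis by (rule that) auto
qed

end

section \<open>Modules and \<open>\<V>\<close>-structures with cylinders\<close>

context closed_symmetric_monoidal_category
begin

lemma module_catI: "category S \<Longrightarrow> tensor_closed_module V S M \<Longrightarrow> module_cat V S M"
  by (intro module_cat.intro monoidal_category_axioms)

lemma closed_v_catI: "category S \<Longrightarrow> v_structure V S A \<Longrightarrow> closed_v_cat V S A"
  by (intro closed_v_cat.intro symmetric_v_cat.intro v_cat.intro closed_symmetric_monoidal_category_axioms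
      symmetric_monoidal_category_axioms monoidal_category_axioms)

lemma closed_v_cat_canonical:
  assumes "category S" "tensor_closed_module V S M"
  shows "closed_v_cat V S (canonical_v_struct V S M)"
proof -
  interpret module_cat V S M using assms by (rule module_catI)
  show ?thesis using assms(1) canonical_v_structure by (rule closed_v_catI)
qed

lemma closed_v_cat_op:
  assumes "closed_v_cat V S A"
  shows "closed_v_cat V (op_cat S) (op_v_struct V S A)"
proof -
  interpret closed_v_cat V S A by fact
  show ?thesis using S.category_op op_v_structure by (rule closed_v_catI)
qed

lemma tensored_v_cat_canonical:
  assumes S: "category S" and M: "tensor_closed_module V S M"
  shows "tensored_v_cat V S (canonical_v_struct V S M) (act M) (adj M)"
proof -
  interpret M: module_cat V S M using assms by (rule module_catI)
  interpret closed_v_cat V S M.can using assms by (rule closed_v_cat_canonical)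
  interpret tensored V S "act M" "vhom M.can" "adj M" using M.tensored_axioms by simp
  show ?thesis by unfold_locales (rule M.universal_eta)
qed

lemma module_exists:
  assumes S: "category S" and A: "v_structure V S A" and P: "cylinder V S A P"
  obtains N :: "('o, 'a, 's, 'b) tc_module"
  where "tensor_closed_module V S N" "canonical_v_struct V S N = A"
    "\<And>K X. K \<in> Obj V \<Longrightarrow> X \<in> Obj S \<Longrightarrow> K \<odot>\<^bsub>N\<^esub> X = cyl_ob P (K, X)"
    "\<And>K X. K \<in> Obj V \<Longrightarrow> X \<in> Obj S \<Longrightarrow> adj N (K, X, K \<odot>\<^bsub>N\<^esub> X) (Id S (K \<odot>\<^bsub>N\<^esub> X)) = cyl_unit P (K, X)"
proof -
  interpret closed_v_cat V S A using S A by (rule closed_v_catI)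
  interpret u: universal_v_cat V S A "cyl_ob P" "cyl_unit P"
    by unfold_locales (use cylinder.cyl_ob[OF P] cylinder_universal[OF P] in \<open>auto simp: PiE_def\<close>)
  interpret t: tensored_v_cat V S A u.ten u.phi by (rule u.tensored_v_cat)
  show thesis
    by (rule that[OF t.tensor_closed_module t.canonical_module]) (auto simp: u.phi_apply)
qed

lemma tensored_v_cat_unique:
  assumes "tensored_v_cat V S A T phi" "tensored_v_cat V S A T' phi'"
    and ob: "\<And>K X. K \<in> Obj V \<Longrightarrow> X \<in> Obj S \<Longrightarrow> Fob T' (K, X) = Fob T (K, X)"
    and unit: "\<And>K X. K \<in> Obj V \<Longrightarrow> X \<in> Obj S
      \<Longrightarrow> phi' (K, X, Fob T (K, X)) (Id S (Fob T (K, X))) = phi (K, X, Fob T (K, X)) (Id S (Fob T (K, X)))"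
  shows "T' = T" "phi' = phi"
proof -
  interpret t: tensored_v_cat V S A T phi by fact
  interpret t': tensored_v_cat V S A T' phi' by fact
  show "T' = T" "phi' = phi"
    using t.tensored_unique[OF t'.tensored_axioms ob] unit by (auto simp: t.eta_def)
qed

text \<open>With no associativity given for \<open>cotensor\<close>, the argument of
  \<open>universal_eta\<close> cannot be repeated in \<open>op_cat S\<close>. Universality of the
  units of \<psi> is instead borrowed from that of the units of \<phi>, as both adjunctions share
  one hom functor.\<close>

lemma tensored_v_cat_op:
  assumes S: "category S" and M: "closed_module V S M"
  shows "tensored_v_cat V (op_cat S) (op_v_struct V S (canonical_v_struct V S M)) (cotensor M) (coadj M)"
proof -
  interpret M: closed_module V S M by fact
  interpret M: module_cat V S M using S M.tensor_closed_module_axioms by (rule module_catI)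
  interpret A: closed_v_cat V S M.can
    using S M.tensor_closed_module_axioms by (rule closed_v_cat_canonical)
  let ?A' = "op_v_struct V S M.can"
  interpret op: closed_v_cat V "op_cat S" ?A' by (rule closed_v_cat_op) (rule A.closed_v_cat_axioms)
  interpret op: tensored V "op_cat S" "cotensor M" "vhom ?A'" "coadj M"
  proof
    show "is_functor (prod_cat V (op_cat S)) (op_cat S) (cotensor M)" by (rule M.cotensor_functor)
    show "is_functor (prod_cat (op_cat (op_cat S)) (op_cat S)) V (vhom ?A')" by (rule op.vhom_functor)
    show "coadj M \<in> (\<Pi>\<^sub>E (K, X, Y)\<in>Obj V \<times> Obj (op_cat S) \<times> Obj (op_cat S).
        hom (op_cat S) (Fob (cotensor M) (K, X)) Y \<rightarrow>\<^sub>E hom V K \<langle>X, Y\<rangle>\<^bsub>?A'\<^esub>)"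
    proof (rule PiE_I)
      fix p assume "p \<in> Obj V \<times> Obj (op_cat S) \<times> Obj (op_cat S)"
      then obtain K X Y where p: "p = (K, X, Y)" "K \<in> Obj V" "X \<in> Obj S" "Y \<in> Obj S" by auto
      then show "coadj M p \<in> (case p of (K, X, Y) \<Rightarrow>
          hom (op_cat S) (Fob (cotensor M) (K, X)) Y \<rightarrow>\<^sub>E hom V K \<langle>X, Y\<rangle>\<^bsub>?A'\<^esub>)"
        using PiE_mem[OF M.coadj_maps, of p] by (simp add: hom_op_cat)
    next
      fix p assume "p \<notin> Obj V \<times> Obj (op_cat S) \<times> Obj (op_cat S)"
      then show "coadj M p = undefined" using PiE_arb[OF M.coadj_maps] by simp
    qed
    show "bij_betw (coadj M (K, X, Y)) (hom (op_cat S) (Fob (cotensor M) (K, X)) Y) (hom V K \<langle>X, Y\<rangle>\<^bsub>?A'\<^esub>)"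
      if "K \<in> Obj V" "X \<in> Obj (op_cat S)" "Y \<in> Obj (op_cat S)" for K X Y
      using that M.coadj_bij[of K X Y] by (simp add: hom_op_cat)
    show "coadj M (K', X', Y') (y \<cdot>\<^bsub>op_cat S\<^esub> f \<cdot>\<^bsub>op_cat S\<^esub> Far (cotensor M) (k, x))
        = Far (vhom ?A') (x, y) \<cdot> coadj M (K, X, Y) f \<cdot> k"
      if "k \<in> hom V K' K" "x \<in> hom (op_cat S) X' X" "y \<in> hom (op_cat S) Y Y'"
        "f \<in> hom (op_cat S) (Fob (cotensor M) (K, X)) Y" for k K' K x X' X y Y Y' f
    proof -
      \<comment> \<open>Composition is reversed in \<open>op_cat S\<close>, so the two naturality
        laws bracket their triple composite differently; these facts allow the rebracketing.\<close>
      have "Dom S (Far (cotensor M) (k, x)) = Fob (cotensor M) (K, X)" "Far (cotensor M) (k, x) \<in> Arr S"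
        using bifunctor.bifunctor_Far[of V "op_cat S" "op_cat S" "cotensor M" k x] that M.cotensor_functor
        by (auto simp: bifunctor_def)
      then have "y \<cdot>\<^bsub>op_cat S\<^esub> f \<cdot>\<^bsub>op_cat S\<^esub> Far (cotensor M) (k, x) = Far (cotensor M) (k, x) \<cdot>\<^bsub>S\<^esub> f \<cdot>\<^bsub>S\<^esub> y"
        using that by auto
      then show ?thesis
        using M.coadj_natural[of k K' K x X X' y Y' Y f] that by (auto simp: hom_op_cat)
    qed
  qed
  show ?thesis
  proof
    fix K X assume [simp]: "K \<in> Obj V" and "X \<in> Obj (op_cat S)"
    then have [simp]: "X \<in> Obj S" by simp
    let ?C = "Fob (cotensor M) (K, X)"
    let ?b = "op.eta K X"
    have C [simp]: "?C \<in> Obj S" using op.T.bifunctor_Fob[of K X] by simp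
    have b [simp]: "?b \<in> Arr V" "Dom V ?b = K" "Cod V ?b = Fob (shom M) (?C, X)"
      using op.eta_simps[of K X] by auto
    show "universal V (op_cat S) ?A' K X ?C ?b"
      unfolding universal_def
    proof (intro conjI ballI)
      show "?C \<in> Obj (op_cat S)" "?b \<in> hom V K \<langle>X, ?C\<rangle>\<^bsub>?A'\<^esub>" by simp_all
      fix L Y assume [simp]: "L \<in> Obj V" and "Y \<in> Obj (op_cat S)"
      then have [simp]: "Y \<in> Obj S" by simp
      let ?W = "L \<odot>\<^bsub>M\<^esub> Y"
      let ?D = "hom S ?W ?C"
      let ?c = "\<lambda>g. vcomp ?A' (X, ?C, Y) \<cdot> (g \<^bold>\<otimes> ?b)"
      let ?s = "\<lambda>g. A.star Y ?W X g (M.eta L Y)"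
      let ?F = "(\<lambda>g. g \<cdot> braid V (L, K)) \<circ> (?s \<circ> coadj M (K, X, ?W))"
      have "bij_betw ?s (hom V K (Fob (shom M) (?W, X))) (hom V (K \<otimes> L) (Fob (shom M) (Y, X)))"
        using M.universal_eta[of L Y] by (simp add: universal_def A.star_def)
      moreover have "bij_betw (coadj M (K, X, ?W)) ?D (hom V K (Fob (shom M) (?W, X)))"
        by (rule M.coadj_bij) auto
      moreover have "bij_betw (\<lambda>g. g \<cdot> braid V (L, K)) (hom V (K \<otimes> L) (Fob (shom M) (Y, X)))
          (hom V (L \<otimes> K) (Fob (shom M) (Y, X)))"
        by (rule iso_precomp_bij[OF braid_iso]) auto
      ultimately have F: "bij_betw ?F ?D (hom V (L \<otimes> K) (Fob (shom M) (Y, X)))"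
        by (blast intro: bij_betw_trans)
      have eq: "(?c \<circ> adj M (L, Y, ?C)) f = ?F f" if "f \<in> ?D" for f
      proof -
        have [simp]: "f \<in> Arr S" "Dom S f = ?W" "Cod S f = ?C" using that by auto
        have "?c (adj M (L, Y, ?C) f) = A.star Y ?C X ?b (adj M (L, Y, ?C) f) \<cdot> braid V (L, K)"
          by (subst A.op_vcomp) auto
        also have "A.star Y ?C X ?b (adj M (L, Y, ?C) f)
            = A.star Y ?C X ?b (Far (shom M) (Id S Y, f) \<cdot> M.eta L Y)"
          by (subst M.phi_eta[of f L Y]) auto
        \<comment> \<open>\<open>f\<close> leaves the unit of \<phi> in the second factor and acts
          on the unit of \<psi> in the first, where it produces \<psi>(f).\<close>
        also have "\<dots> = ?s (Far (shom M) (f, Id S X) \<cdot> ?b)"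
          using A.star_middle[of Y f ?W ?C X ?b "M.eta L Y"] by simp
        also have "Far (shom M) (f, Id S X) \<cdot> ?b = coadj M (K, X, ?W) f"
          using op.phi_eta[of f K X ?W] by simp
        finally show ?thesis by simp
      qed
      have "bij_betw (?c \<circ> adj M (L, Y, ?C)) ?D (hom V (L \<otimes> K) (Fob (shom M) (Y, X)))"
        by (subst bij_betw_cong[OF eq]) (auto intro: F)
      moreover have "bij_betw (adj M (L, Y, ?C)) ?D (hom V L (Fob (shom M) (Y, ?C)))"
        by (rule M.phi_bij) auto
      ultimately have "bij_betw ?c (hom V L (Fob (shom M) (Y, ?C))) (hom V (L \<otimes> K) (Fob (shom M) (Y, X)))"
        using bij_betw_comp_iff by fastforce
      then show "bij_betw ?c (hom V L \<langle>?C, Y\<rangle>\<^bsub>?A'\<^esub>) (hom V (L \<otimes> K) \<langle>X, Y\<rangle>\<^bsub>?A'\<^esub>)"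
        by simp
    qed
  qed
qed

end

section \<open>Closed bimodules and the bijection\<close>

lemma truncate_simps [simp]:
  "act (tc_module.truncate M) = act M" "act_assoc (tc_module.truncate M) = act_assoc M"
  "act_unit (tc_module.truncate M) = act_unit M" "shom (tc_module.truncate M) = shom M"
  "adj (tc_module.truncate M) = adj M"
  by (simp_all add: tc_module.truncate_def)

lemma tensor_closed_module_truncate:
  "tensor_closed_module V S (tc_module.truncate M) \<longleftrightarrow> tensor_closed_module V S M"
  by (simp add: tensor_closed_module_def)

lemma canonical_truncate: "canonical_v_struct V S (tc_module.truncate M) = canonical_v_struct V S M"
  by (simp add: canonical_v_struct_def adj_counit_def[abs_def])

lemma cl_module_eqI:
  fixes M M' :: "('o, 'a, 's, 'b) cl_module"
  assumes "tc_module.truncate M = tc_module.truncate M'" "cotensor M = cotensor M'" "coadj M = coadj M'"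
  shows "M = M'"
  using assms by (cases M; cases M') (simp add: tc_module.truncate_def)

context closed_symmetric_monoidal_category
begin

text \<open>An extension fixes \<open>bi_mod\<close>, and on \<open>op_cat S\<close> it fixes the
  tensor and the adjunction; the bimodule condition adds the canonical structure. These are the
  hypotheses of \<open>module_unique\<close>, so \<open>t.module\<close> is the only
  candidate.\<close>

lemma closed_bimodule_extension:
  assumes S: "category S" and M: "closed_module V S M"
  shows "\<exists>!B. closed_bimodule V S B \<and> extends_closed_module B M"
proof -
  interpret t: tensored_v_cat V "op_cat S" "op_v_struct V S (canonical_v_struct V S M)" "cotensor M" "coadj M"
    using S M by (rule tensored_v_cat_op)
  have M': "tensor_closed_module V S M" using M by (simp add: closed_module_def)
  show ?thesis
  proof (rule ex1I[of _ "\<lparr>bi_mod = tc_module.truncate M, bi_opmod = t.module\<rparr>"])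
    show "closed_bimodule V S \<lparr>bi_mod = tc_module.truncate M, bi_opmod = t.module\<rparr> \<and>
        extends_closed_module \<lparr>bi_mod = tc_module.truncate M, bi_opmod = t.module\<rparr> M"
      using M' t.tensor_closed_module t.canonical_module
      by (simp add: closed_bimodule_def extends_closed_module_def tensor_closed_module_truncate canonical_truncate)
    fix B assume "closed_bimodule V S B \<and> extends_closed_module B M"
    moreover from this have "bi_opmod B = t.module"
      by (intro t.module_unique)
        (auto simp: closed_bimodule_def extends_closed_module_def canonical_truncate)
    ultimately show "B = \<lparr>bi_mod = tc_module.truncate M, bi_opmod = t.module\<rparr>"
      by (simp add: extends_closed_module_def)
  qed
qed

text \<open>Equality of the canonical structures identifies \<open>shom N'\<close> with
  \<open>shom N\<close> with its variables swapped, so the adjunction of \<open>N'\<close>, read in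
  \<open>S\<close>, has the type and naturality required of \<psi>.\<close>

lemma closed_moduleI:
  fixes N N' :: "('o, 'a, 's, 'b) tc_module"
  assumes S: "category S" and N: "tensor_closed_module V S N" and N': "tensor_closed_module V (op_cat S) N'"
    and can: "canonical_v_struct V (op_cat S) N' = op_v_struct V S (canonical_v_struct V S N)"
  shows "closed_module V S \<lparr>act = act N, act_assoc = act_assoc N, act_unit = act_unit N,
    shom = shom N, adj = adj N, cotensor = act N', coadj = adj N'\<rparr>" (is "closed_module V S ?M")
proof -
  interpret N: module_cat V S N using S N by (rule module_catI)
  interpret N': module_cat V "op_cat S" N' using N.S.category_op N' by (rule module_catI)
  have shom: "shom N' = vhom (op_v_struct V S N.can)" using N'.vhom_can by (simp add: can)
  have [simp]: "Fob (shom N') (X, Y) = Fob (shom N) (Y, X)" if "X \<in> Obj S" "Y \<in> Obj S" for X Y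
    using that by (simp add: shom)
  have [simp]: "Far (shom N') (x, y) = Far (shom N) (y, x)" if "x \<in> Arr S" "y \<in> Arr S" for x y
    using that by (simp add: shom)
  have "tensor_closed_module V S ?M" using N by (simp add: tensor_closed_module_def)
  moreover have "closed_module_axioms V S ?M"
  proof
    show "is_functor (prod_cat V (op_cat S)) (op_cat S) (cotensor ?M)" by (simp add: N'.act_functor)
    show "coadj ?M \<in> (\<Pi>\<^sub>E (K, X, Y)\<in>Obj V \<times> Obj S \<times> Obj S.
        hom S Y (Fob (cotensor ?M) (K, X)) \<rightarrow>\<^sub>E hom V K (Fob (shom ?M) (Y, X)))"
    proof (rule PiE_I)
      fix p assume "p \<in> Obj V \<times> Obj S \<times> Obj S"
      then obtain K X Y where p: "p = (K, X, Y)" "K \<in> Obj V" "X \<in> Obj S" "Y \<in> Obj S" by auto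
      then show "coadj ?M p \<in> (case p of (K, X, Y) \<Rightarrow>
          hom S Y (Fob (cotensor ?M) (K, X)) \<rightarrow>\<^sub>E hom V K (Fob (shom ?M) (Y, X)))"
        using PiE_mem[OF N'.adj_maps, of p] by (simp add: hom_op_cat)
    next
      fix p assume "p \<notin> Obj V \<times> Obj S \<times> Obj S"
      then show "coadj ?M p = undefined" using PiE_arb[OF N'.adj_maps] by simp
    qed
    show "bij_betw (coadj ?M (K, X, Y)) (hom S Y (Fob (cotensor ?M) (K, X))) (hom V K (Fob (shom ?M) (Y, X)))"
      if "K \<in> Obj V" "X \<in> Obj S" "Y \<in> Obj S" for K X Y
      using that N'.adj_bij[of K X Y] by (simp add: hom_op_cat)
    show "coadj ?M (K', X', Y') (Far (cotensor ?M) (k, x) \<cdot>\<^bsub>S\<^esub> f \<cdot>\<^bsub>S\<^esub> y)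
        = Far (shom ?M) (y, x) \<cdot> coadj ?M (K, X, Y) f \<cdot> k"
      if "k \<in> hom V K' K" "x \<in> hom S X X'" "y \<in> hom S Y' Y" "f \<in> hom S Y (Fob (cotensor ?M) (K, X))"
      for k K' K x X X' y Y' Y f
    proof -
      have "Far (act N') (k, x) \<in> Arr S" "Dom S (Far (act N') (k, x)) = Fob (act N') (K, X)"
        using N'.T.bifunctor_Far[of k x] that by auto
      then show ?thesis
        using N'.adj_natural[of k K' K x X' X y Y Y' f] that by auto
    qed
  qed
  ultimately show ?thesis by (rule closed_module.intro)
qed

lemma corresponds_module:
  fixes S :: "('s, 'b) category" and D :: "('o, 'a, 's, 'b) v_struct_cyl_path"
  assumes S: "category S" and D: "v_structure_cyl_path V S D"
  shows "\<exists>!M. closed_module V S M \<and> corresponds V S D M"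
proof (rule ex_ex1I)
  let ?A = "vstr D"
  let ?A' = "op_v_struct V S ?A"
  interpret S: category S by (rule S)
  have A: "v_structure V S ?A" and P: "cylinder V S ?A (cyl D)" and Q: "cylinder V (op_cat S) ?A' (path D)"
    using D by (simp_all add: v_structure_cyl_path_def)
  interpret A: closed_v_cat V S ?A using S A by (rule closed_v_catI)
  obtain N :: "('o, 'a, 's, 'b) tc_module" where N: "tensor_closed_module V S N" "canonical_v_struct V S N = ?A"
    "\<And>K X. K \<in> Obj V \<Longrightarrow> X \<in> Obj S \<Longrightarrow> K \<odot>\<^bsub>N\<^esub> X = cyl_ob (cyl D) (K, X)"
    "\<And>K X. K \<in> Obj V \<Longrightarrow> X \<in> Obj S \<Longrightarrow> adj N (K, X, K \<odot>\<^bsub>N\<^esub> X) (Id S (K \<odot>\<^bsub>N\<^esub> X)) = cyl_unit (cyl D) (K, X)"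
    by (rule module_exists[OF S A P]) (rule that)
  obtain N' :: "('o, 'a, 's, 'b) tc_module" where
    N': "tensor_closed_module V (op_cat S) N'" "canonical_v_struct V (op_cat S) N' = ?A'"
    "\<And>K X. K \<in> Obj V \<Longrightarrow> X \<in> Obj (op_cat S) \<Longrightarrow> K \<odot>\<^bsub>N'\<^esub> X = cyl_ob (path D) (K, X)"
    "\<And>K X. K \<in> Obj V \<Longrightarrow> X \<in> Obj (op_cat S)
      \<Longrightarrow> adj N' (K, X, K \<odot>\<^bsub>N'\<^esub> X) (Id (op_cat S) (K \<odot>\<^bsub>N'\<^esub> X)) = cyl_unit (path D) (K, X)"
    by (rule module_exists[OF S.category_op A.op_v_structure Q]) (rule that)
  let ?M = "\<lparr>act = act N, act_assoc = act_assoc N, act_unit = act_unit N,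
    shom = shom N, adj = adj N, cotensor = act N', coadj = adj N'\<rparr>"
  have trunc: "tc_module.truncate ?M = N" by (simp add: tc_module.truncate_def)
  have "closed_module V S ?M"
    using S N(1) N'(1) by (rule closed_moduleI) (simp add: N(2) N'(2))
  moreover have "canonical_v_struct V S ?M = ?A"
    using canonical_truncate[of V S ?M] by (simp only: trunc N(2))
  then have "corresponds V S D ?M"
    using N(3,4) N'(3,4) by (simp add: corresponds_def)
  ultimately show "\<exists>M. closed_module V S M \<and> corresponds V S D M" by blast
  fix M M' assume M: "closed_module V S M \<and> corresponds V S D M"
    and M': "closed_module V S M' \<and> corresponds V S D M'"
  have can: "canonical_v_struct V S M = ?A" "canonical_v_struct V S M' = ?A"
    using M M' by (simp_all add: corresponds_def)
  have tc: "tensor_closed_module V S M" "tensor_closed_module V S M'"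
    using M M' by (simp_all add: closed_module_def)
  have eq: "K \<odot>\<^bsub>M'\<^esub> X = K \<odot>\<^bsub>M\<^esub> X"
      "adj M' (K, X, K \<odot>\<^bsub>M\<^esub> X) (Id S (K \<odot>\<^bsub>M\<^esub> X)) = adj M (K, X, K \<odot>\<^bsub>M\<^esub> X) (Id S (K \<odot>\<^bsub>M\<^esub> X))"
      "Fob (cotensor M') (K, X) = Fob (cotensor M) (K, X)"
      "coadj M' (K, X, Fob (cotensor M) (K, X)) (Id S (Fob (cotensor M) (K, X)))
        = coadj M (K, X, Fob (cotensor M) (K, X)) (Id S (Fob (cotensor M) (K, X)))"
    if "K \<in> Obj V" "X \<in> Obj S" for K X
    using M M' that unfolding corresponds_def by metis+
  have t: "tensored_v_cat V S ?A (act M) (adj M)" "tensored_v_cat V S ?A (act M') (adj M')"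
    using tensored_v_cat_canonical[OF S tc(1)] tensored_v_cat_canonical[OF S tc(2)] by (simp_all only: can)
  \<comment> \<open>Equal objects and units give equal adjunctions, which is what
    \<open>module_unique\<close> needs in order to identify \<open>a\<close> and \<open>l\<close> as
    well.\<close>
  have act: "act M' = act M" and adj: "adj M' = adj M"
    by (rule tensored_v_cat_unique[OF t]; simp add: eq)+
  interpret t: tensored_v_cat V S ?A "act M" "adj M" by (rule t(1))
  have "tc_module.truncate M = t.module" "tc_module.truncate M' = t.module"
    by (rule t.module_unique; simp add: tc tensor_closed_module_truncate canonical_truncate can act adj)+
  then have "tc_module.truncate M = tc_module.truncate M'" by simp
  moreover have t': "tensored_v_cat V (op_cat S) ?A' (cotensor M) (coadj M)"
      "tensored_v_cat V (op_cat S) ?A' (cotensor M') (coadj M')"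
    using tensored_v_cat_op[OF S, of M] tensored_v_cat_op[OF S, of M'] M M' by (simp_all only: can)
  \<comment> \<open>The cotensor side of a closed module consists of an adjunction alone, so here
    uniqueness of the adjunction suffices.\<close>
  have "cotensor M' = cotensor M" "coadj M' = coadj M"
    by (rule tensored_v_cat_unique[OF t']; simp add: eq)+
  ultimately show "M = M'" by (simp add: cl_module_eqI)
qed

text \<open>The \<V>-structure is prescribed by \<open>corresponds\<close>. The units of \<phi> and
  \<psi> are universal for it and for its opposite, so they extend to a cylinder and a path, and by
  \<open>cylinder_unique\<close> in only one way.\<close>

lemma corresponds_v_structure:
  fixes S :: "('s, 'b) category" and M :: "('o, 'a, 's, 'b) cl_module"
  assumes S: "category S" and M: "closed_module V S M"
  shows "\<exists>!D. v_structure_cyl_path V S D \<and> corresponds V S D M"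
proof (rule ex_ex1I)
  let ?A = "canonical_v_struct V S M"
  let ?A' = "op_v_struct V S ?A"
  have M': "tensor_closed_module V S M" using M by (simp add: closed_module_def)
  interpret A: closed_v_cat V S ?A using S M' by (rule closed_v_cat_canonical)
  interpret A': closed_v_cat V "op_cat S" ?A' by (rule closed_v_cat_op) (rule A.closed_v_cat_axioms)
  interpret t: tensored_v_cat V S ?A "act M" "adj M" using S M' by (rule tensored_v_cat_canonical)
  interpret t': tensored_v_cat V "op_cat S" ?A' "cotensor M" "coadj M" using S M by (rule tensored_v_cat_op)
  obtain P where P: "cylinder V S ?A P" "cyl_ob P = Fob (act M)"
    "\<And>K X. K \<in> Obj V \<Longrightarrow> X \<in> Obj S \<Longrightarrow> cyl_unit P (K, X) = t.eta K X"
    by (rule A.cylinder_exists[OF t.T.Fob_extensional t.eta_universal]) (assumption, assumption, rule that)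
  obtain Q where Q: "cylinder V (op_cat S) ?A' Q" "cyl_ob Q = Fob (cotensor M)"
    "\<And>K X. K \<in> Obj V \<Longrightarrow> X \<in> Obj (op_cat S) \<Longrightarrow> cyl_unit Q (K, X) = t'.eta K X"
    by (rule A'.cylinder_exists[OF t'.T.Fob_extensional t'.eta_universal]) (assumption, assumption, rule that)
  have "v_structure_cyl_path V S \<lparr>vstr = ?A, cyl = P, path = Q\<rparr>"
    using P(1) Q(1) A.v_structure_axioms by (simp add: v_structure_cyl_path_def)
  moreover have "corresponds V S \<lparr>vstr = ?A, cyl = P, path = Q\<rparr> M"
    using P(2,3) Q(2,3) by (simp add: corresponds_def t.eta_def t'.eta_def)
  ultimately show "\<exists>D. v_structure_cyl_path V S D \<and> corresponds V S D M" by blast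
  fix D D' assume D: "v_structure_cyl_path V S D \<and> corresponds V S D M"
    and D': "v_structure_cyl_path V S D' \<and> corresponds V S D' M"
  have "cyl D = cyl D'"
    using D D' by (intro A.cylinder_unique) (auto simp: v_structure_cyl_path_def corresponds_def)
  moreover have "path D = path D'"
    using D D' by (intro A'.cylinder_unique) (auto simp: v_structure_cyl_path_def corresponds_def)
  ultimately show "D = D'" using D D' by (simp add: corresponds_def)
qed

end

theorem theorem1p26:
  fixes V :: "('o, 'a) csm_category"
    and S :: "('s, 'b) category"
  assumes "closed_symmetric_monoidal_category V"
    and "category S"
  shows "(\<forall>M. closed_module V S M \<longrightarrow>
      (\<exists>!B. closed_bimodule V S B \<and> extends_closed_module B M)) \<and>
    (\<exists>F. bij_betw F {D. v_structure_cyl_path V S D} {M. closed_module V S M} \<and>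
      (\<forall>D. v_structure_cyl_path V S D \<longrightarrow> corresponds V S D (F D)))"
proof (intro conjI allI impI)
  interpret closed_symmetric_monoidal_category V by fact
  note S = assms(2)
  show "\<exists>!B. closed_bimodule V S B \<and> extends_closed_module B M" if "closed_module V S M" for M
    using S that by (rule closed_bimodule_extension)
  \<comment> \<open>Injectivity of \<open>F\<close> will come from uniqueness of \<open>D\<close>
    for a given module. For surjectivity, a module \<open>M\<close> has some corresponding
    \<open>D\<close>, and uniqueness of the module for this \<open>D\<close> gives
    \<open>F D = M\<close>.\<close>
  obtain F where F: "\<And>D. v_structure_cyl_path V S D \<Longrightarrow> closed_module V S (F D) \<and> corresponds V S D (F D)"
    using corresponds_module[OF S] by metis
  have "bij_betw F {D. v_structure_cyl_path V S D} {M. closed_module V S M}"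
    unfolding bij_betw_def
  proof (intro conjI inj_onI equalityI subsetI)
    fix D D' assume "D \<in> {D. v_structure_cyl_path V S D}" "D' \<in> {D. v_structure_cyl_path V S D}" "F D = F D'"
    then show "D = D'"
      using F[of D] F[of D'] corresponds_v_structure[OF S, of "F D"] by auto
  next
    fix M :: "('o, 'a, 's, 'b) cl_module" assume "M \<in> {M. closed_module V S M}"
    then have M: "closed_module V S M" by simp
    then obtain D where "v_structure_cyl_path V S D" "corresponds V S D M"
      using corresponds_v_structure[OF S] by blast
    then show "M \<in> F ` {D. v_structure_cyl_path V S D}"
      using F[of D] M corresponds_module[OF S, of D] by blast
  qed (use F in auto)
  then show "\<exists>F. bij_betw F {D. v_structure_cyl_path V S D} {M. closed_module V S M} \<and>
      (\<forall>D. v_structure_cyl_path V S D \<longrightarrow> corresponds V S D (F D))"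
    using F by blast
qed

end
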